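(* Let $\mathcal T_h$ be a mesh as in the context, $p\ge1$ and $0<\epsilon<(\overline\sigma_t/\overline\sigma_a)^{1/2}$. The source-iteration error propagator satisfies $$\mathsf G_h^\epsilon=c_\epsilon\mathsf H_h^\epsilon$$ and $$\|\mathsf G_h^\epsilon\|_{\rm ex}=\rho(\mathsf G_h^\epsilon)=c_\epsilon\lambda_{\max}(\mathsf H_h^\epsilon)\le c_\epsilon.$$ The inequality is strict under homogeneous vacuum inflow. Moreover, the exact correction identity holds: for every source-iteration step, with error $e_h^k$ before and $e_h^{k+1/2}$ after the predictor step, $$a_{{\rm ex},h}^\epsilon(e_h^{k+1/2},v)=\big(\sigma_s^\epsilon(e_h^k-e_h^{k+1/2}),v\big)_\Omega\qquad\forall v\in V_h.$$
   Context: $\Omega\subset\mathbb R^d$, $d\in\{2,3\}$, is a bounded connected Lipschitz polytopal domain. $\overline\sigma_t,\overline\sigma_a>0$ are constants, $\sigma_t^\epsilon=\overline\sigma_t/\epsilon$, $\sigma_s^\epsilon=\overline\sigma_t/\epsilon-\epsilon\overline\sigma_a$, $c_\epsilon=\sigma_s^\epsilon/\sigma_t^\epsilon=1-\epsilon^2\overline\sigma_a/\overline\sigma_t$. Mesh. $\mathcal T_h$ is a finite, connected, face-to-face partition of $\Omega$ into bounded Lipschitz polytopes (not necessarily convex). $\mathcal E_h^\circ$, $\mathcal E_h^\partial$ are the sets of interior and physical boundary faces, $\mathcal E_h=\mathcal E_h^\circ\cup\mathcal E_h^\partial$. An interior face $e$ has adjacent elements $K^+,K^-$ and a fixed unit normal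 $\vec n_e$ directed from $K^+$ to $K^-$; a boundary face has a unique adjacent element $K^+$ and $\vec n_e$ is the outward unit normal. With $v^\pm$ the traces from $K^\pm$, $[v]=v^+-v^-$; on boundary faces the zero exterior trace $v^-:=0$ is used (this imposes homogeneous vacuum inflow), so $[v]=v^+$. $(\cdot,\cdot)_K$, $(\cdot,\cdot)_\Omega$, $\langle\cdot,\cdot\rangle_e$ are $L^2$ inner products. For $p\ge1$, $V_h=\{v\in L^2(\Omega): v|_K\in\mathbb P_p(K)\ \forall K\in\mathcal T_h\}$. Quadrature. $\{(\vec\omega_m,w_m)\}_{m=1}^{N_\omega}\subset\mathbb S^{d-1}\times(0,1)$ is a set of distinct pairs with $\sum_mw_m=1$, $\sum_mw_m\vec\omega_m=\vec0$, $\sum_mw_m\vec\omega_m\otimes\vec\omega_m=\frac1dI$, and for every $m$ there is an index $\overline m$ with $\vec\omega_{\overline m}=-\vec\omega_m$, $w_{\overline m}=w_m$. Transport form. On a face $e$, $u_m^{\rm up}=u^+$ if $\vec\omega_m\cdot\vec n_e\ge0$ and $u_m^{\rm up}=u^-$ if $\vec\omega_m\cdot\vec n_e<0$ (with $u^-=0$ on boundary faces). For $u,v\in V_h$, $$b_{m,h}^\epsilon(u,v)=-\sum_{K\in\mathcal T_h}(u,\vec\omega_m\cdot\nabla v)_K+\sum_{e\in\mathcal E_h}\langle(\vec\omega_m\cdot\vec n_e)u_m^{\rm up},[v]\rangle_e+(\sigma_t^\epsilon u,v)_\Omega.$$ Each directional problem with form $b_{m,h}^\epsilon$ is uniquely solvable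 in $V_h$. Scalar response and exact correction. For $g\in V_h$ let $\widehat\Psi_{m,h}^\epsilon(g)\in V_h$ solve $\epsilon b_{m,h}^\epsilon(\widehat\Psi_{m,h}^\epsilon(g),v)=(\overline\sigma_tg,v)_\Omega$ for all $v\in V_h$, and put $\mathsf H_h^\epsilon g=\sum_mw_m\widehat\Psi_{m,h}^\epsilon(g)$. The map $\mathsf H_h^\epsilon$ is self-adjoint and positive definite in $(\overline\sigma_t\cdot,\cdot)_\Omega$, hence invertible; $\lambda_{\max}(\mathsf H_h^\epsilon)$ is its largest eigenvalue. The exact correction form, which is symmetric positive definite, is $$a_{{\rm ex},h}^\epsilon(u,v)=\frac1\epsilon\big(\overline\sigma_t[(\mathsf H_h^\epsilon)^{-1}u-c_\epsilon u],v\big)_\Omega,$$ with $\|v\|_{\rm ex}^2=a_{{\rm ex},h}^\epsilon(v,v)$. For linear $\mathsf A:V_h\to V_h$, $\|\mathsf A\|_{\rm ex}=\sup_{0\ne v\in V_h}\|\mathsf Av\|_{\rm ex}/\|v\|_{\rm ex}$, and $\rho(\mathsf A)$ is the spectral radius. Source iteration. Let $q_h\in V_h$ and let $(\{\psi_{m,h}^\star\},\phi_h^\star)\in V_h^{N_\omega}\times V_h$ be the unique solution of $b_{m,h}^\epsilon(\psi_{m,h}^\star,v)=(\sigma_s^\epsilon\phi_h^\star+q_h,v)_\Omega$ for all $v\in V_h$ and all $m$, with $\phi_h^\star=\sum_mw_m\psi_{m,h}^\star$. Given $\phi_h^k\in V_h$, the predictor is $\phi_h^{k+1/2}=\sum_mw_m\psi_{m,h}^{k+1/2}$,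 where $b_{m,h}^\epsilon(\psi_{m,h}^{k+1/2},v)=(\sigma_s^\epsilon\phi_h^k+q_h,v)_\Omega$ for all $v\in V_h$. With $e_h^k=\phi_h^\star-\phi_h^k$, $e_h^{k+1/2}=\phi_h^\star-\phi_h^{k+1/2}$, the source-iteration error propagator $\mathsf G_h^\epsilon:V_h\to V_h$ is the linear map with $e_h^{k+1/2}=\mathsf G_h^\epsilon e_h^k$. *)

theory Defs
  imports "HOL-Analysis.Analysis"
begin

section \<open>Domains and meshes\<close>

text \<open>
  A Lipschitz domain is, near each boundary point z and after choosing a direction n, the strict
  epigraph of a Lipschitz function of the component of \<open>y - z\<close> orthogonal to n.  (Taking \<open>\<gamma>\<close>
  Lipschitz on the whole space is no restriction, since a Lipschitz function on a ball of the
  hyperplane extends.)  Connectedness is not included; it is asked for separately where needed.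
\<close>

definition lipschitz_domain :: "'a::euclidean_space set \<Rightarrow> bool" where
  "lipschitz_domain D \<longleftrightarrow> open D \<and>
     (\<forall>z\<in>frontier D. \<exists>n r h L (\<gamma> :: 'a \<Rightarrow> real).
        norm n = 1 \<and> 0 < r \<and> 0 < h \<and> L-lipschitz_on UNIV \<gamma> \<and>
        (\<forall>y. norm (y - z - ((y - z) \<bullet> n) *\<^sub>R n) < r \<and> \<bar>(y - z) \<bullet> n\<bar> < h \<longrightarrow>
             (y \<in> D \<longleftrightarrow> \<gamma> (y - z - ((y - z) \<bullet> n) *\<^sub>R n) < (y - z) \<bullet> n)))"

text \<open>
  Not necessarily convex polytopes, of any dimension, represented by their relative interior:
  the closure is a finite union of convex polytopes, and the set is recovered from its closure.
\<close>

definition open_polytope :: "'a::euclidean_space set \<Rightarrow> bool" where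
  "open_polytope S \<longleftrightarrow> S \<noteq> {} \<and> S = rel_interior (closure S) \<and>
     (\<exists>\<P>. finite \<P> \<and> (\<forall>P\<in>\<P>. polytope P) \<and> closure S = \<Union>\<P>)"

definition lipschitz_polytope :: "'a::euclidean_space set \<Rightarrow> bool" where
  "lipschitz_polytope K \<longleftrightarrow> bounded K \<and> open_polytope K \<and> lipschitz_domain K"

definition polytope_face :: "'a::euclidean_space set \<Rightarrow> bool" where
  "polytope_face e \<longleftrightarrow> open_polytope e \<and> aff_dim e = int DIM('a) - 1"

definition outward_unit_normal :: "'a::euclidean_space set \<Rightarrow> 'a set \<Rightarrow> 'a \<Rightarrow> bool" where
  "outward_unit_normal K e n \<longleftrightarrow> norm n = 1 \<and> (\<forall>x\<in>e. \<forall>y\<in>e. n \<bullet> (x - y) = 0) \<and>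
     (\<forall>x\<in>e. \<forall>\<^sub>F t in at_right 0. x - t *\<^sub>R n \<in> K \<and> x + t *\<^sub>R n \<notin> closure K)"

text \<open>
  Elements and faces are (relatively) open sets.  Each element comes with its faces,
  so that, as usual for polytopal meshes, neighbouring faces of an element may be coplanar; the
  geometric facets are the basic example.  The fields \<open>plus_elem\<close>, \<open>minus_elem\<close> and \<open>face_normal\<close> give
  the adjacent elements and the fixed unit normal of a face; \<open>minus_elem\<close> is irrelevant on
  boundary faces.
\<close>

record 'd mesh =
  Omega :: "(real ^ 'd) set"
  elems :: "(real ^ 'd) set set"
  elem_faces :: "(real ^ 'd) set \<Rightarrow> (real ^ 'd) set set"
  plus_elem :: "(real ^ 'd) set \<Rightarrow> (real ^ 'd) set"
  minus_elem :: "(real ^ 'd) set \<Rightarrow> (real ^ 'd) set"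
  face_normal :: "(real ^ 'd) set \<Rightarrow> real ^ 'd"

definition faces :: "'d::finite mesh \<Rightarrow> (real ^ 'd) set set" where
  "faces M = (\<Union>K\<in>elems M. elem_faces M K)"

definition interior_faces :: "'d::finite mesh \<Rightarrow> (real ^ 'd) set set" where
  "interior_faces M = {e \<in> faces M. e \<subseteq> Omega M}"

definition boundary_faces :: "'d::finite mesh \<Rightarrow> (real ^ 'd) set set" where
  "boundary_faces M = {e \<in> faces M. e \<subseteq> frontier (Omega M)}"

definition adjacent_elems :: "'d::finite mesh \<Rightarrow> (real ^ 'd) set \<Rightarrow> (real ^ 'd) set set" where
  "adjacent_elems M e = {K \<in> elems M. e \<in> elem_faces M K}"

definition polytopal_partition :: "'d::finite mesh \<Rightarrow> bool" where
  "polytopal_partition M \<longleftrightarrow>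
     finite (elems M) \<and> (\<forall>K\<in>elems M. lipschitz_polytope K) \<and>
     pairwise disjnt (elems M) \<and> \<Union>(elems M) \<subseteq> Omega M \<and>
     closure (Omega M) = (\<Union>K\<in>elems M. closure K) \<and>
     (\<forall>K\<in>elems M. finite (elem_faces M K) \<and> (\<forall>e\<in>elem_faces M K. polytope_face e) \<and>
        frontier K = (\<Union>e\<in>elem_faces M K. closure e))"

text \<open>
  Faces of (possibly different) elements coincide or have disjoint relative interiors, and each
  face is either an interior face shared by exactly two elements or a boundary face of one.
\<close>

definition face_to_face :: "'d::finite mesh \<Rightarrow> bool" where
  "face_to_face M \<longleftrightarrow> pairwise disjnt (faces M) \<and>
     faces M = interior_faces M \<union> boundary_faces M \<and>
     (\<forall>e\<in>interior_faces M. card (adjacent_elems M e) = 2) \<and>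
     (\<forall>e\<in>boundary_faces M. card (adjacent_elems M e) = 1)"

definition oriented_faces :: "'d::finite mesh \<Rightarrow> bool" where
  "oriented_faces M \<longleftrightarrow>
     (\<forall>e\<in>interior_faces M. adjacent_elems M e = {plus_elem M e, minus_elem M e} \<and>
        outward_unit_normal (plus_elem M e) e (face_normal M e) \<and>
        outward_unit_normal (minus_elem M e) e (- face_normal M e)) \<and>
     (\<forall>e\<in>boundary_faces M. adjacent_elems M e = {plus_elem M e} \<and>
        outward_unit_normal (plus_elem M e) e (face_normal M e))"

definition connected_mesh :: "'d::finite mesh \<Rightarrow> bool" where
  "connected_mesh M \<longleftrightarrow> (\<forall>K\<in>elems M. \<forall>K'\<in>elems M.
     (K, K') \<in> {(K1, K2). K1 \<in> elems M \<and> K2 \<in> elems M \<and>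
                  elem_faces M K1 \<inter> elem_faces M K2 \<noteq> {}}\<^sup>*)"

definition transport_mesh :: "'d::finite mesh \<Rightarrow> bool" where
  "transport_mesh M \<longleftrightarrow> lipschitz_polytope (Omega M) \<and> connected (Omega M) \<and>
     polytopal_partition M \<and> face_to_face M \<and> oriented_faces M \<and> connected_mesh M"

section \<open>Angular quadrature\<close>

record 'd quadrature =
  npts :: nat
  dir :: "nat \<Rightarrow> real ^ 'd"
  wt :: "nat \<Rightarrow> real"

definition angular_quadrature :: "'d::finite quadrature \<Rightarrow> bool" where
  "angular_quadrature Q \<longleftrightarrow>
     inj_on (\<lambda>m. (dir Q m, wt Q m)) {1..npts Q} \<and>
     (\<forall>m\<in>{1..npts Q}. norm (dir Q m) = 1 \<and> 0 < wt Q m \<and> wt Q m < 1) \<and>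
     (\<Sum>m=1..npts Q. wt Q m) = 1 \<and>
     (\<Sum>m=1..npts Q. wt Q m *\<^sub>R dir Q m) = 0 \<and>
     (\<Sum>m=1..npts Q. wt Q m *\<^sub>R (\<chi> i j. dir Q m $ i * dir Q m $ j))
       = (1 / real CARD('d)) *\<^sub>R (mat 1 :: real ^ 'd ^ 'd) \<and>
     (\<forall>m\<in>{1..npts Q}. \<exists>m'\<in>{1..npts Q}. dir Q m' = - dir Q m \<and> wt Q m' = wt Q m)"

section \<open>Broken polynomial spaces\<close>

definition poly_space :: "nat \<Rightarrow> (real ^ 'd::finite \<Rightarrow> real) set" where
  "poly_space p = {f. \<exists>c. f = (\<lambda>x. \<Sum>\<alpha> | (\<Sum>i\<in>UNIV. \<alpha> i) \<le> p. c \<alpha> * (\<Prod>i\<in>UNIV. x $ i ^ \<alpha> i))}"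

text \<open>
  Every class in the broken space has a unique representative that is polynomial on each open
  element and vanishes off the elements (on the skeleton, a null set, and outside the domain).
  With these representatives, equality in \<open>L\<^sup>2\<close> is equality of functions.
\<close>

definition Vh :: "'d::finite mesh \<Rightarrow> nat \<Rightarrow> (real ^ 'd \<Rightarrow> real) set" where
  "Vh M p = {v. (\<forall>K\<in>elems M. \<exists>q\<in>poly_space p. \<forall>x\<in>K. v x = q x) \<and>
                (\<forall>x. x \<notin> \<Union>(elems M) \<longrightarrow> v x = 0)}"

definition l2_inner :: "'a::euclidean_space set \<Rightarrow> ('a \<Rightarrow> real) \<Rightarrow> ('a \<Rightarrow> real) \<Rightarrow> real" where
  "l2_inner S f g = (LINT x:S|lborel. f x * g x)"

text \<open>
  Surface integrals over a planar set e with unit normal n.  The prism over e of height 1 in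
  direction n is isometric to \<open>e \<times> [0,1]\<close>, so by Fubini the surface integral of f is the volume
  integral over the prism of f composed with the orthogonal projection onto the hyperplane of e.
\<close>

definition prism :: "'a::euclidean_space set \<Rightarrow> 'a \<Rightarrow> 'a set" where
  "prism e n = {x + t *\<^sub>R n | x t. x \<in> e \<and> 0 \<le> t \<and> t \<le> 1}"

definition hyperplane_proj :: "'a::euclidean_space set \<Rightarrow> 'a \<Rightarrow> 'a \<Rightarrow> 'a" where
  "hyperplane_proj e n y = y - (n \<bullet> (y - (SOME a. a \<in> e))) *\<^sub>R n"

definition face_inner ::
  "'a::euclidean_space set \<Rightarrow> 'a \<Rightarrow> ('a \<Rightarrow> real) \<Rightarrow> ('a \<Rightarrow> real) \<Rightarrow> real" where
  "face_inner e n f g =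
     (LINT y:prism e n|lborel. f (hyperplane_proj e n y) * g (hyperplane_proj e n y))"

definition elem_trace :: "'a::euclidean_space set \<Rightarrow> ('a \<Rightarrow> real) \<Rightarrow> 'a \<Rightarrow> real" where
  "elem_trace K v x = Lim (at x within K) v"

definition plus_trace :: "'d::finite mesh \<Rightarrow> (real ^ 'd) set \<Rightarrow> (real ^ 'd \<Rightarrow> real) \<Rightarrow> real ^ 'd \<Rightarrow> real" where
  "plus_trace M e v = elem_trace (plus_elem M e) v"

text \<open>The zero exterior trace on boundary faces encodes homogeneous vacuum inflow.\<close>

definition minus_trace :: "'d::finite mesh \<Rightarrow> (real ^ 'd) set \<Rightarrow> (real ^ 'd \<Rightarrow> real) \<Rightarrow> real ^ 'd \<Rightarrow> real" where
  "minus_trace M e v = (if e \<in> interior_faces M then elem_trace (minus_elem M e) v else (\<lambda>x. 0))"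

definition jump :: "'d::finite mesh \<Rightarrow> (real ^ 'd) set \<Rightarrow> (real ^ 'd \<Rightarrow> real) \<Rightarrow> real ^ 'd \<Rightarrow> real" where
  "jump M e v x = plus_trace M e v x - minus_trace M e v x"

definition upwind ::
  "'d::finite mesh \<Rightarrow> real ^ 'd \<Rightarrow> (real ^ 'd) set \<Rightarrow> (real ^ 'd \<Rightarrow> real) \<Rightarrow> real ^ 'd \<Rightarrow> real" where
  "upwind M \<omega> e u = (if \<omega> \<bullet> face_normal M e \<ge> 0 then plus_trace M e u else minus_trace M e u)"

definition grad :: "(real ^ 'd::finite \<Rightarrow> real) \<Rightarrow> real ^ 'd \<Rightarrow> real ^ 'd" where
  "grad v x = (\<chi> i. frechet_derivative v (at x) (axis i 1))"

section \<open>Transport form, scalar response and exact correction\<close>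

definition sigma_t :: "real \<Rightarrow> real \<Rightarrow> real" where
  "sigma_t st \<epsilon> = st / \<epsilon>"

definition sigma_s :: "real \<Rightarrow> real \<Rightarrow> real \<Rightarrow> real" where
  "sigma_s st sa \<epsilon> = st / \<epsilon> - \<epsilon> * sa"

definition c_eps :: "real \<Rightarrow> real \<Rightarrow> real \<Rightarrow> real" where
  "c_eps st sa \<epsilon> = sigma_s st sa \<epsilon> / sigma_t st \<epsilon>"

definition bform ::
  "'d::finite mesh \<Rightarrow> 'd quadrature \<Rightarrow> real \<Rightarrow> real \<Rightarrow> nat \<Rightarrow>
   (real ^ 'd \<Rightarrow> real) \<Rightarrow> (real ^ 'd \<Rightarrow> real) \<Rightarrow> real" where
  "bform M Q st \<epsilon> m u v =
     - (\<Sum>K\<in>elems M. l2_inner K u (\<lambda>x. dir Q m \<bullet> grad v x))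
     + (\<Sum>e\<in>faces M. face_inner e (face_normal M e)
          (\<lambda>x. (dir Q m \<bullet> face_normal M e) * upwind M (dir Q m) e u x) (jump M e v))
     + l2_inner (Omega M) (\<lambda>x. sigma_t st \<epsilon> * u x) v"

definition Psi_hat ::
  "'d::finite mesh \<Rightarrow> 'd quadrature \<Rightarrow> nat \<Rightarrow> real \<Rightarrow> real \<Rightarrow> nat \<Rightarrow>
   (real ^ 'd \<Rightarrow> real) \<Rightarrow> real ^ 'd \<Rightarrow> real" where
  "Psi_hat M Q p st \<epsilon> m g = (THE u. u \<in> Vh M p \<and>
     (\<forall>v\<in>Vh M p. \<epsilon> * bform M Q st \<epsilon> m u v = l2_inner (Omega M) (\<lambda>x. st * g x) v))"

definition H_op ::
  "'d::finite mesh \<Rightarrow> 'd quadrature \<Rightarrow> nat \<Rightarrow> real \<Rightarrow> real \<Rightarrow>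
   (real ^ 'd \<Rightarrow> real) \<Rightarrow> real ^ 'd \<Rightarrow> real" where
  "H_op M Q p st \<epsilon> g = (\<lambda>x. \<Sum>m=1..npts Q. wt Q m * Psi_hat M Q p st \<epsilon> m g x)"

definition a_ex ::
  "'d::finite mesh \<Rightarrow> 'd quadrature \<Rightarrow> nat \<Rightarrow> real \<Rightarrow> real \<Rightarrow> real \<Rightarrow>
   (real ^ 'd \<Rightarrow> real) \<Rightarrow> (real ^ 'd \<Rightarrow> real) \<Rightarrow> real" where
  "a_ex M Q p st sa \<epsilon> u v = 1 / \<epsilon> * l2_inner (Omega M)
     (\<lambda>x. st * (inv_into (Vh M p) (H_op M Q p st \<epsilon>) u x - c_eps st sa \<epsilon> * u x)) v"

definition norm_ex ::
  "'d::finite mesh \<Rightarrow> 'd quadrature \<Rightarrow> nat \<Rightarrow> real \<Rightarrow> real \<Rightarrow> real \<Rightarrow>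
   (real ^ 'd \<Rightarrow> real) \<Rightarrow> real" where
  "norm_ex M Q p st sa \<epsilon> v = sqrt (a_ex M Q p st sa \<epsilon> v v)"

definition op_norm_ex ::
  "'d::finite mesh \<Rightarrow> 'd quadrature \<Rightarrow> nat \<Rightarrow> real \<Rightarrow> real \<Rightarrow> real \<Rightarrow>
   ((real ^ 'd \<Rightarrow> real) \<Rightarrow> (real ^ 'd \<Rightarrow> real)) \<Rightarrow> real" where
  "op_norm_ex M Q p st sa \<epsilon> A =
     (SUP v\<in>Vh M p - {\<lambda>x. 0}. norm_ex M Q p st sa \<epsilon> (A v) / norm_ex M Q p st sa \<epsilon> v)"

section \<open>Linear maps on finite-dimensional spaces of real functions\<close>

definition linear_map_on :: "('a \<Rightarrow> real) set \<Rightarrow> (('a \<Rightarrow> real) \<Rightarrow> ('a \<Rightarrow> real)) \<Rightarrow> bool" where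
  "linear_map_on V A \<longleftrightarrow> (\<forall>v\<in>V. A v \<in> V) \<and>
     (\<forall>u\<in>V. \<forall>v\<in>V. \<forall>a b. A (\<lambda>x. a * u x + b * v x) = (\<lambda>x. a * A u x + b * A v x))"

definition lambda_max :: "('a \<Rightarrow> real) set \<Rightarrow> (('a \<Rightarrow> real) \<Rightarrow> ('a \<Rightarrow> real)) \<Rightarrow> real" where
  "lambda_max V A = Max {l. \<exists>u\<in>V. u \<noteq> (\<lambda>x. 0) \<and> A u = (\<lambda>x. l * u x)}"

text \<open>
  Eigenvalues of the complexification: \<open>A (u + \<i> v) = z (u + \<i> v)\<close>, split into real and
  imaginary parts.
\<close>

definition complex_eigenvalue ::
  "('a \<Rightarrow> real) set \<Rightarrow> (('a \<Rightarrow> real) \<Rightarrow> ('a \<Rightarrow> real)) \<Rightarrow> complex \<Rightarrow> bool" where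
  "complex_eigenvalue V A z \<longleftrightarrow>
     (\<exists>u\<in>V. \<exists>v\<in>V. (u \<noteq> (\<lambda>x. 0) \<or> v \<noteq> (\<lambda>x. 0)) \<and>
        A u = (\<lambda>x. Re z * u x - Im z * v x) \<and> A v = (\<lambda>x. Im z * u x + Re z * v x))"

definition spectral_radius :: "('a \<Rightarrow> real) set \<Rightarrow> (('a \<Rightarrow> real) \<Rightarrow> ('a \<Rightarrow> real)) \<Rightarrow> real" where
  "spectral_radius V A = Max (cmod ` {z. complex_eigenvalue V A z})"

section \<open>Source iteration\<close>

definition phi_star ::
  "'d::finite mesh \<Rightarrow> 'd quadrature \<Rightarrow> nat \<Rightarrow> real \<Rightarrow> real \<Rightarrow> real \<Rightarrow>
   (real ^ 'd \<Rightarrow> real) \<Rightarrow> real ^ 'd \<Rightarrow> real" where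
  "phi_star M Q p st sa \<epsilon> q = (THE \<phi>. \<phi> \<in> Vh M p \<and>
     (\<exists>\<psi>. (\<forall>m\<in>{1..npts Q}. \<psi> m \<in> Vh M p \<and>
              (\<forall>v\<in>Vh M p. bform M Q st \<epsilon> m (\<psi> m) v
                 = l2_inner (Omega M) (\<lambda>x. sigma_s st sa \<epsilon> * \<phi> x + q x) v)) \<and>
          \<phi> = (\<lambda>x. \<Sum>m=1..npts Q. wt Q m * \<psi> m x)))"

definition psi_half ::
  "'d::finite mesh \<Rightarrow> 'd quadrature \<Rightarrow> nat \<Rightarrow> real \<Rightarrow> real \<Rightarrow> real \<Rightarrow>
   (real ^ 'd \<Rightarrow> real) \<Rightarrow> (real ^ 'd \<Rightarrow> real) \<Rightarrow> nat \<Rightarrow> real ^ 'd \<Rightarrow> real" where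
  "psi_half M Q p st sa \<epsilon> q \<phi> m = (THE \<psi>. \<psi> \<in> Vh M p \<and>
     (\<forall>v\<in>Vh M p. bform M Q st \<epsilon> m \<psi> v
        = l2_inner (Omega M) (\<lambda>x. sigma_s st sa \<epsilon> * \<phi> x + q x) v))"

definition phi_half ::
  "'d::finite mesh \<Rightarrow> 'd quadrature \<Rightarrow> nat \<Rightarrow> real \<Rightarrow> real \<Rightarrow> real \<Rightarrow>
   (real ^ 'd \<Rightarrow> real) \<Rightarrow> (real ^ 'd \<Rightarrow> real) \<Rightarrow> real ^ 'd \<Rightarrow> real" where
  "phi_half M Q p st sa \<epsilon> q \<phi> = (\<lambda>x. \<Sum>m=1..npts Q. wt Q m * psi_half M Q p st sa \<epsilon> q \<phi> m x)"

text \<open>Errors before and after the predictor step that starts from the iterate \<open>\<phi>\<close>.\<close>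

definition err ::
  "'d::finite mesh \<Rightarrow> 'd quadrature \<Rightarrow> nat \<Rightarrow> real \<Rightarrow> real \<Rightarrow> real \<Rightarrow>
   (real ^ 'd \<Rightarrow> real) \<Rightarrow> (real ^ 'd \<Rightarrow> real) \<Rightarrow> real ^ 'd \<Rightarrow> real" where
  "err M Q p st sa \<epsilon> q \<phi> = (\<lambda>x. phi_star M Q p st sa \<epsilon> q x - \<phi> x)"

definition err_half ::
  "'d::finite mesh \<Rightarrow> 'd quadrature \<Rightarrow> nat \<Rightarrow> real \<Rightarrow> real \<Rightarrow> real \<Rightarrow>
   (real ^ 'd \<Rightarrow> real) \<Rightarrow> (real ^ 'd \<Rightarrow> real) \<Rightarrow> real ^ 'd \<Rightarrow> real" where
  "err_half M Q p st sa \<epsilon> q \<phi> =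
     (\<lambda>x. phi_star M Q p st sa \<epsilon> q x - phi_half M Q p st sa \<epsilon> q \<phi> x)"

text \<open>
  The error propagator of the iteration with source q.  It is only determined on the broken
  space; extensionality fixes it elsewhere.
\<close>

definition G_op ::
  "'d::finite mesh \<Rightarrow> 'd quadrature \<Rightarrow> nat \<Rightarrow> real \<Rightarrow> real \<Rightarrow> real \<Rightarrow>
   (real ^ 'd \<Rightarrow> real) \<Rightarrow> (real ^ 'd \<Rightarrow> real) \<Rightarrow> real ^ 'd \<Rightarrow> real" where
  "G_op M Q p st sa \<epsilon> q = (THE G. G \<in> extensional (Vh M p) \<and> linear_map_on (Vh M p) G \<and>
     (\<forall>\<phi>\<in>Vh M p. err_half M Q p st sa \<epsilon> q \<phi> = G (err M Q p st sa \<epsilon> q \<phi>)))"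

end

theory Submission
  imports Defs "HOL-Library.Function_Algebras"
begin

text \<open>
  Everything rests on the directional divergence theorem for a polytope K.  Almost every line in
  direction \<open>\<omega>\<close> meets the boundary of K only in relative interiors of faces transversal to \<open>\<omega>\<close>,
  so it enters and leaves K finitely often and the fundamental theorem of calculus applies along
  it; integrating over all lines, with Jacobian \<open>\<bar>\<omega> \<bullet> n\<bar>\<close> on a face with normal n, gives the theorem.

  Hence reversing \<open>\<omega>\<close> transposes the upwind transport form, and the form has the energy
  \<open>\<sigma>\<^sub>t \<parallel>u\<parallel>\<^sup>2 + 1/2 \<Sum>\<^sub>e \<bar>\<omega> \<bullet> n\<^sub>e\<bar> \<parallel>[u]\<parallel>\<^sub>e\<^sup>2\<close>.  So H is symmetric and positive, and for an
  eigenfunction g with \<open>H g = \<lambda> g\<close> and angular fluxes \<open>\<psi>\<^sub>m\<close> the energies J of the jumps satisfy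
  \<open>\<Sum>\<^sub>m w\<^sub>m (\<parallel>\<psi>\<^sub>m - g\<parallel>\<^sup>2 + \<epsilon> / \<sigma>\<^sub>t J(\<psi>\<^sub>m)) = (1 - \<lambda>) \<parallel>g\<parallel>\<^sup>2\<close>, where now \<open>\<sigma>\<^sub>t\<close> is unscaled.  If \<open>\<lambda> \<ge> 1\<close>, all fluxes equal g and g has
  no jumps; then its directional derivatives vanish, g is constant, and testing with the
  coordinate along a quadrature direction gives g = 0.  All claims are then read off in an
  orthonormal eigenbasis of H, which also diagonalises the correction form.
\<close>


section \<open>Symmetric forms on finite-dimensional spaces\<close>

text \<open>The definitions speak of concrete functions through \<open>THE\<close>,
  \<open>inv_into\<close>, \<open>Max\<close> and \<open>SUP\<close>, so each of these has to be
  shown to be well determined before it can be computed. Solvability and the eigenbasis are proved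
  for forms on a subspace \<open>V\<close> of an ambient vector space because \<open>Vh\<close> is a
  set of functions and has no type of its own. Elements may be nonconvex with coplanar neighbouring
  faces; crossing counts along lines are insensitive to this. Surface measure never appears: a
  surface integral is a volume integral over a prism, and only Lebesgue integrals and translations
  are compared. Absence of jumps requires, for each face, a quadrature direction transversal to it;
  the second-moment condition supplies one, and it also recovers the full gradient from directional
  derivatives. The vacuum inflow enters as a vanishing trace of g on boundary faces. Testing with a
  coordinate function, which lies in the space because \<open>p \<ge> 1\<close>, treats all boundary
  faces together, so no particular one has to be exhibited.\<close>

locale symmetric_form =
  fixes V :: "'v::real_vector set" and b :: "'v \<Rightarrow> 'v \<Rightarrow> real"
  assumes subspace: "subspace V"
    and add_left: "\<lbrakk>u \<in> V; v \<in> V; w \<in> V\<rbrakk> \<Longrightarrow> b (u + v) w = b u w + b v w"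
    and scale_left: "\<lbrakk>u \<in> V; w \<in> V\<rbrakk> \<Longrightarrow> b (a *\<^sub>R u) w = a * b u w"
    and sym: "\<lbrakk>u \<in> V; v \<in> V\<rbrakk> \<Longrightarrow> b u v = b v u"
begin

lemma add_right: "\<lbrakk>u \<in> V; v \<in> V; w \<in> V\<rbrakk> \<Longrightarrow> b w (u + v) = b w u + b w v"
  using add_left sym subspace_add[OF subspace] by metis

lemma scale_right: "\<lbrakk>u \<in> V; w \<in> V\<rbrakk> \<Longrightarrow> b w (a *\<^sub>R u) = a * b w u"
  using scale_left sym subspace_scale[OF subspace] by metis

lemma zero_left [simp]: "w \<in> V \<Longrightarrow> b 0 w = 0"
  using scale_left[of w w 0] by simp

lemma zero_right [simp]: "w \<in> V \<Longrightarrow> b w 0 = 0"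
  using scale_right[of w w 0] by simp

lemma diff_left: "\<lbrakk>u \<in> V; v \<in> V; w \<in> V\<rbrakk> \<Longrightarrow> b (u - v) w = b u w - b v w"
  using add_left[of "u" "(-1) *\<^sub>R v" w] scale_left[of v w "-1"] subspace_scale[OF subspace, of v "-1"]
  by simp

lemma diff_right: "\<lbrakk>u \<in> V; v \<in> V; w \<in> V\<rbrakk> \<Longrightarrow> b w (u - v) = b w u - b w v"
  using diff_left sym subspace_diff[OF subspace] by metis

lemma sum_left:
  assumes "\<And>i. i \<in> I \<Longrightarrow> f i \<in> V" "w \<in> V"
  shows "b (\<Sum>i\<in>I. f i) w = (\<Sum>i\<in>I. b (f i) w)"
  using assms
proof (induction I rule: infinite_finite_induct)
  case (insert x F)
  then show ?case
    using add_left[of "f x" "sum f F" w] subspace_sum[OF subspace, of F f] by simp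
qed auto

lemma sum_right:
  assumes "\<And>i. i \<in> I \<Longrightarrow> f i \<in> V" "w \<in> V"
  shows "b w (\<Sum>i\<in>I. f i) = (\<Sum>i\<in>I. b w (f i))"
proof -
  have "b w (\<Sum>i\<in>I. f i) = b (\<Sum>i\<in>I. f i) w"
    using assms subspace_sum[OF subspace] by (intro sym) auto
  also have "\<dots> = (\<Sum>i\<in>I. b (f i) w)" by (rule sum_left) (use assms in auto)
  also have "\<dots> = (\<Sum>i\<in>I. b w (f i))" using assms sym by (intro sum.cong) auto
  finally show ?thesis .
qed

lemma form_lincomb:
  "\<lbrakk>u \<in> V; v \<in> V; w \<in> V\<rbrakk> \<Longrightarrow> b (s *\<^sub>R u + t *\<^sub>R v) w = s * b u w + t * b v w"
  using subspace_scale[OF subspace] by (simp add: add_left scale_left)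

text \<open>Nonnegativity of the quadratic polynomial \<open>b (u + t v) (u + t v)\<close> in
  \<open>t\<close>. Only semidefiniteness is assumed, because the lemma is later applied to a form
  that may have null vectors.\<close>

lemma cauchy_schwarz:
  assumes nonneg: "\<And>v. v \<in> V \<Longrightarrow> 0 \<le> b v v" and u: "u \<in> V" and v: "v \<in> V"
  shows "(b u v)\<^sup>2 \<le> b u u * b v v"
proof -
  have q: "0 \<le> b u u + 2 * t * b u v + t\<^sup>2 * b v v" for t
  proof -
    have tv: "t *\<^sub>R v \<in> V" using v subspace subspace_scale by blast
    have "0 \<le> b (u + t *\<^sub>R v) (u + t *\<^sub>R v)" using u tv subspace subspace_add nonneg by blast
    also have "\<dots> = b u u + 2 * t * b u v + t\<^sup>2 * b v v"
      using u v tv subspace_add[OF subspace u tv] sym[OF v u]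
      by (simp add: add_left add_right scale_left scale_right power2_eq_square algebra_simps)
    finally show ?thesis .
  qed
  show ?thesis
  proof (cases "b v v = 0")
    case True
    have "b u v = 0"
    proof (rule ccontr)
      assume "b u v \<noteq> 0"
      \<comment> \<open>With \<open>b v v = 0\<close> the polynomial is affine in \<open>t\<close>;
        this \<open>t\<close> gives it the value -1.\<close>
      then have "2 * (- (b u u + 1) / (2 * b u v)) * b u v = - (b u u + 1)" by simp
      with q[of "- (b u u + 1) / (2 * b u v)"] True show False by simp
    qed
    then show ?thesis using True by simp
  next
    case False
    then have p: "b v v > 0" using nonneg[OF v] by simp
    have "0 \<le> b u u - (b u v)\<^sup>2 / b v v"
      using q[of "- b u v / b v v"] p by (simp add: power2_eq_square field_simps)
    then show ?thesis using p by (simp add: field_simps)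
  qed
qed

end

text \<open>Finite dimension is expressed by a finite set whose span contains \<open>V\<close>, not
  by a basis inside \<open>V\<close>; in this form it passes to subspaces at once.\<close>

locale inner_form = symmetric_form +
  assumes fin: "\<exists>B. finite B \<and> V \<subseteq> span B"
    and pos: "\<lbrakk>u \<in> V; u \<noteq> 0\<rbrakk> \<Longrightarrow> 0 < b u u"
begin

lemma nonneg: "u \<in> V \<Longrightarrow> 0 \<le> b u u"
  using pos[of u] by (cases "u = 0") auto

lemma eq_0_iff: "u \<in> V \<Longrightarrow> b u u = 0 \<longleftrightarrow> u = 0"
  using pos[of u] by (cases "u = 0") auto

lemma inner_form_subspace:
  assumes "subspace W" "W \<subseteq> V"
  shows "inner_form W b"
proof unfold_locales
  show "subspace W" by fact
  show "\<exists>B. finite B \<and> W \<subseteq> span B" using fin assms(2) by (meson subset_trans)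
qed (use assms(2) add_left scale_left sym pos in \<open>simp_all add: subset_iff\<close>)

definition orthonormal :: "'a set \<Rightarrow> bool" where
  "orthonormal S \<longleftrightarrow> finite S \<and> S \<subseteq> V \<and> (\<forall>e\<in>S. \<forall>f\<in>S. b e f = (if e = f then 1 else 0))"

lemma orthonormal_sum_coord:
  assumes "orthonormal S" "f \<in> S"
  shows "b (\<Sum>e\<in>S. c e *\<^sub>R e) f = c f"
proof -
  have "b (\<Sum>e\<in>S. c e *\<^sub>R e) f = (\<Sum>e\<in>S. b (c e *\<^sub>R e) f)"
    using assms subspace_scale[OF subspace] unfolding orthonormal_def by (intro sum_left) auto
  also have "\<dots> = (\<Sum>e\<in>S. if e = f then c f else 0)"
    using assms unfolding orthonormal_def by (intro sum.cong) (auto simp: scale_left subset_iff)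
  also have "\<dots> = c f" using assms unfolding orthonormal_def by simp
  finally show ?thesis .
qed

text \<open>Pairing a linear relation with one of its members isolates that coefficient, so
  orthonormal sets are independent and no larger than a finite spanning set. The bound guarantees a
  largest orthonormal set with a given property.\<close>

lemma orthonormal_card_bound: "\<exists>n. \<forall>S. orthonormal S \<longrightarrow> card S \<le> n"
proof -
  obtain B where B: "finite B" "V \<subseteq> span B" using fin by blast
  have "card S \<le> card B" if S: "orthonormal S" for S
  proof -
    have fS: "finite S" "S \<subseteq> V" using S unfolding orthonormal_def by auto
    have "independent S"
    proof
      assume "dependent S"
      then obtain c v where c: "v \<in> S" "c v \<noteq> 0" "(\<Sum>v\<in>S. c v *\<^sub>R v) = 0"
        using dependent_finite[OF fS(1)] by auto
      then show False
        using orthonormal_sum_coord[OF S c(1), of c] fS by (auto simp: subset_iff)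
    qed
    then show ?thesis using independent_span_bound[OF B(1)] fS B(2) by blast
  qed
  then show ?thesis by blast
qed

text \<open>Gram-Schmidt as a maximality argument: a largest orthonormal subset of \<open>W\<close>
  with \<open>P\<close> on all members must expand \<open>W\<close>, since otherwise a normalised
  vector could be added. \<open>P\<close> is required of all nonzero multiples because the new
  vector is rescaled. Trivial \<open>P\<close> gives a basis; being an eigenvector, as
  \<open>P\<close>, gives an eigenbasis.\<close>

lemma orthonormal_basis_such_that:
  assumes W: "subspace W" "W \<subseteq> V"
    and ext: "\<And>S. \<lbrakk>orthonormal S; S \<subseteq> W; \<forall>e\<in>S. P e; \<exists>w\<in>W. w \<noteq> 0 \<and> (\<forall>e\<in>S. b w e = 0)\<rbrakk>
               \<Longrightarrow> \<exists>w\<in>W. w \<noteq> 0 \<and> (\<forall>e\<in>S. b w e = 0) \<and> (\<forall>a. a \<noteq> 0 \<longrightarrow> P (a *\<^sub>R w))"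
  obtains S where "orthonormal S" "S \<subseteq> W" "\<forall>e\<in>S. P e" "\<And>v. v \<in> W \<Longrightarrow> v = (\<Sum>e\<in>S. b v e *\<^sub>R e)"
proof -
  let ?Q = "\<lambda>S. orthonormal S \<and> S \<subseteq> W \<and> (\<forall>e\<in>S. P e)"
  obtain n where n: "\<And>S. orthonormal S \<Longrightarrow> card S \<le> n" using orthonormal_card_bound by blast
  have "?Q {}" by (simp add: orthonormal_def)
  from ex_has_greatest_nat[of ?Q, OF this, of card "Suc n"] obtain S
    where S: "?Q S" and max: "\<And>T. ?Q T \<Longrightarrow> card T \<le> card S" using n by (auto simp: less_Suc_eq_le)
  have fS: "finite S" "S \<subseteq> V" using S unfolding orthonormal_def by auto
  have "v = (\<Sum>e\<in>S. b v e *\<^sub>R e)" if v: "v \<in> W" for v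
  proof (rule ccontr)
    assume neq: "v \<noteq> (\<Sum>e\<in>S. b v e *\<^sub>R e)"
    define w where "w = v - (\<Sum>e\<in>S. b v e *\<^sub>R e)"
    have sW: "(\<Sum>e\<in>S. b v e *\<^sub>R e) \<in> W"
      using S by (intro subspace_sum[OF W(1)] subspace_scale[OF W(1)]) auto
    have wW: "w \<in> W" unfolding w_def using v sW subspace_diff[OF W(1)] by blast
    have "b w e = 0" if "e \<in> S" for e
      using orthonormal_sum_coord[of S e "b v"] S that sW v W fS unfolding w_def
      by (subst diff_left) auto
    moreover have "w \<noteq> 0" using neq by (simp add: w_def)
    ultimately have "\<exists>w\<in>W. w \<noteq> 0 \<and> (\<forall>e\<in>S. b w e = 0)" using wW by blast
    from ext[OF _ _ _ this] S obtain x where x: "x \<in> W" "x \<noteq> 0" "\<forall>e\<in>S. b x e = 0"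
      "\<forall>a. a \<noteq> 0 \<longrightarrow> P (a *\<^sub>R x)" by blast
    have px: "b x x > 0" using pos x W by auto
    define y where "y = (1 / sqrt (b x x)) *\<^sub>R x"
    have yW: "y \<in> W" using x(1) subspace_scale[OF W(1)] y_def by auto
    have Py: "P y" using x px by (simp add: y_def)
    have yy: "b y y = 1"
      using x(1) W(2) px subspace_scale[OF subspace, of x] by (auto simp: y_def scale_left scale_right subset_iff)
    have ye: "b y e = 0" "b e y = 0" if "e \<in> S" for e
    proof -
      show *: "b y e = 0" using x W that fS by (auto simp: y_def scale_left subset_iff)
      then show "b e y = 0" using sym[of e y] yW W that fS by auto
    qed
    have "y \<notin> S" using ye[of y] yy by auto
    moreover have "?Q (insert y S)"
      using S yW W ye yy Py unfolding orthonormal_def by auto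
    ultimately show False using max[of "insert y S"] fS by simp
  qed
  with S that show thesis by blast
qed

lemma orthonormal_basis:
  obtains S where "orthonormal S" "\<And>v. v \<in> V \<Longrightarrow> v = (\<Sum>e\<in>S. b v e *\<^sub>R e)"
  by (rule orthonormal_basis_such_that[of V "\<lambda>_. True"]) (use subspace in auto)

text \<open>In an orthonormal basis each coordinate of \<open>v\<close> is at most
  \<open>sqrt (b v v)\<close> in modulus, so the sum of the moduli of the matrix entries of
  \<open>c\<close> serves as \<open>C\<close>. This does the work of compactness of the unit
  sphere.\<close>

lemma symmetric_form_bounded:
  assumes "symmetric_form V c"
  obtains C where "\<And>v. v \<in> V \<Longrightarrow> c v v \<le> C * b v v"
proof -
  interpret c: symmetric_form V c by fact
  obtain S where S: "orthonormal S" and ex: "\<And>v. v \<in> V \<Longrightarrow> v = (\<Sum>e\<in>S. b v e *\<^sub>R e)"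
    by (rule orthonormal_basis) blast
  have SV: "S \<subseteq> V" using S by (simp add: orthonormal_def)
  have "c v v \<le> (\<Sum>e\<in>S. \<Sum>f\<in>S. \<bar>c e f\<bar>) * b v v" if v: "v \<in> V" for v
  proof -
    have le: "\<bar>b v e\<bar> \<le> sqrt (b v v)" if "e \<in> S" for e
      using cauchy_schwarz[OF nonneg v, of e] that S SV
      by (intro real_le_rsqrt) (auto simp: orthonormal_def)
    have sv: "b v e *\<^sub>R e \<in> V" if "e \<in> S" for e using that SV subspace_scale[OF subspace] by auto
    have "c v v = c (\<Sum>e\<in>S. b v e *\<^sub>R e) (\<Sum>e\<in>S. b v e *\<^sub>R e)" using ex[OF v] by simp
    also have "\<dots> = (\<Sum>e\<in>S. \<Sum>f\<in>S. c (b v e *\<^sub>R e) (b v f *\<^sub>R f))"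
      using sv subspace_sum[OF subspace, of S] by (subst c.sum_left) (auto simp: c.sum_right intro!: sum.cong)
    also have "\<dots> = (\<Sum>e\<in>S. \<Sum>f\<in>S. (b v e * b v f) * c e f)"
      using SV sv by (intro sum.cong) (auto simp: c.scale_left c.scale_right subset_iff)
    also have "\<dots> \<le> (\<Sum>e\<in>S. \<Sum>f\<in>S. b v v * \<bar>c e f\<bar>)"
    proof (intro sum_mono)
      fix e f assume "e \<in> S" "f \<in> S"
      then have "\<bar>b v e\<bar> * \<bar>b v f\<bar> \<le> sqrt (b v v) * sqrt (b v v)"
        by (intro mult_mono le) (auto simp: nonneg v)
      then have "\<bar>b v e * b v f\<bar> \<le> b v v" by (simp add: abs_mult nonneg v)
      then have "\<bar>b v e * b v f\<bar> * \<bar>c e f\<bar> \<le> b v v * \<bar>c e f\<bar>" by (rule mult_right_mono) simp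
      then show "(b v e * b v f) * c e f \<le> b v v * \<bar>c e f\<bar>"
        by (metis abs_le_D1 abs_mult)
    qed
    also have "\<dots> = (\<Sum>e\<in>S. \<Sum>f\<in>S. \<bar>c e f\<bar>) * b v v"
      by (simp add: sum_distrib_left[symmetric] mult.commute)
    finally show ?thesis .
  qed
  then show thesis using that by blast
qed

text \<open>An eigenvector maximises the Rayleigh quotient.  If the supremum M were not attained, the form
  \<open>M b(u, v) - b(A u, v)\<close> would be positive definite, hence bounded from below by a multiple of b,
  and M would not be the least upper bound.\<close>

lemma symmetric_eigenvector_exists:
  assumes AV: "\<And>v. v \<in> V \<Longrightarrow> A v \<in> V"
    and Aadd: "\<And>u v. \<lbrakk>u \<in> V; v \<in> V\<rbrakk> \<Longrightarrow> A (u + v) = A u + A v"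
    and Ascale: "\<And>a u. u \<in> V \<Longrightarrow> A (a *\<^sub>R u) = a *\<^sub>R A u"
    and Asym: "\<And>u v. \<lbrakk>u \<in> V; v \<in> V\<rbrakk> \<Longrightarrow> b (A u) v = b u (A v)"
    and ne: "\<exists>v\<in>V. v \<noteq> 0"
  obtains l v where "v \<in> V" "v \<noteq> 0" "A v = l *\<^sub>R v"
proof -
  have SA: "symmetric_form V (\<lambda>u v. b (A u) v)"
    using subspace AV Asym sym
    by unfold_locales (auto simp: Aadd Ascale add_left scale_left)
  then obtain C where C: "\<And>v. v \<in> V \<Longrightarrow> b (A v) v \<le> C * b v v"
    by (rule symmetric_form_bounded) blast
  define R where "R = (\<lambda>v. b (A v) v / b v v) ` (V - {0})"
  have Rne: "R \<noteq> {}" using ne by (auto simp: R_def)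
  have bdd: "bdd_above R"
    unfolding R_def by (rule bdd_aboveI2[of _ _ C]) (use C pos in \<open>auto simp: field_simps\<close>)
  define M where "M = Sup R"
  define c where "c = (\<lambda>u v. M * b u v - b (A u) v)"
  have Mv: "b (A v) v \<le> M * b v v" if "v \<in> V" for v
  proof (cases "v = 0")
    case False
    then have "b (A v) v / b v v \<le> M"
      unfolding M_def using that by (intro cSup_upper bdd) (auto simp: R_def)
    then show ?thesis using pos[OF that False] by (simp add: field_simps)
  qed (use AV that in auto)
  interpret c: symmetric_form V c
    using subspace AV Asym sym unfolding c_def
    by unfold_locales (auto simp: Aadd Ascale add_left scale_left algebra_simps)
  have cnn: "0 \<le> c v v" if "v \<in> V" for v using Mv[OF that] by (simp add: c_def)
  show thesis
  proof (cases "\<exists>v\<in>V. v \<noteq> 0 \<and> c v v = 0")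
    case True
    then obtain v where v: "v \<in> V" "v \<noteq> 0" "c v v = 0" by blast
    have MV: "M *\<^sub>R v \<in> V" "M *\<^sub>R v - A v \<in> V"
      using v AV subspace_scale[OF subspace] subspace_diff[OF subspace] by auto
    \<comment> \<open>For a semidefinite form, Cauchy-Schwarz places every null vector in the
      radical; hence \<open>M v - A v\<close> is orthogonal to all of \<open>V\<close>.\<close>
    have "c v w = 0" if "w \<in> V" for w
      using c.cauchy_schwarz[OF cnn v(1) that] v(3) by simp
    then have "b (M *\<^sub>R v - A v) w = 0" if "w \<in> V" for w
      using that v(1) AV MV by (simp add: c_def diff_left scale_left)
    then have "M *\<^sub>R v - A v = 0" using MV eq_0_iff by blast
    then show thesis using that[of v M] v by simp
  next
    case False
    interpret c: inner_form V c
      using fin cnn False by unfold_locales (auto simp: less_le)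
    \<comment> \<open>Now \<open>c\<close> is an inner product, so the boundedness lemma applies
      with the roles of the two forms exchanged.\<close>
    obtain D where D: "\<And>v. v \<in> V \<Longrightarrow> b v v \<le> D * c v v"
      by (rule c.symmetric_form_bounded[OF symmetric_form_axioms]) blast
    have D0: "D > 0"
    proof -
      obtain v where v: "v \<in> V" "v \<noteq> 0" using ne by blast
      with D[OF v(1)] pos[OF v] c.pos[OF v] show ?thesis
        by (metis less_le_trans zero_less_mult_pos2)
    qed
    have "M \<le> M - 1 / D"
      unfolding M_def
    proof (rule cSup_least[OF Rne])
      fix r assume "r \<in> R"
      then obtain v where v: "v \<in> V" "v \<noteq> 0" "r = b (A v) v / b v v" by (auto simp: R_def)
      have "b v v / D \<le> M * b v v - b (A v) v"
        using D[OF v(1)] D0 by (simp add: c_def field_simps)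
      then have "b (A v) v \<le> (M - 1 / D) * b v v" by (simp add: algebra_simps)
      then show "r \<le> Sup R - 1 / D"
        using pos[OF v(1,2)] unfolding v(3) M_def by (simp add: divide_le_eq)
    qed
    then show thesis using D0 by simp
  qed
qed

text \<open>The orthogonal complement of a set of eigenvectors is invariant under a symmetric
  \<open>A\<close>, so a further eigenvector can be found there as long as the complement is
  nontrivial.\<close>

theorem symmetric_eigenbasis:
  assumes AV: "\<And>v. v \<in> V \<Longrightarrow> A v \<in> V"
    and Aadd: "\<And>u v. \<lbrakk>u \<in> V; v \<in> V\<rbrakk> \<Longrightarrow> A (u + v) = A u + A v"
    and Ascale: "\<And>a u. u \<in> V \<Longrightarrow> A (a *\<^sub>R u) = a *\<^sub>R A u"
    and Asym: "\<And>u v. \<lbrakk>u \<in> V; v \<in> V\<rbrakk> \<Longrightarrow> b (A u) v = b u (A v)"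
  obtains S l where "orthonormal S" "\<And>e. e \<in> S \<Longrightarrow> A e = l e *\<^sub>R e"
    "\<And>v. v \<in> V \<Longrightarrow> v = (\<Sum>e\<in>S. b v e *\<^sub>R e)"
proof (rule orthonormal_basis_such_that[of V "\<lambda>e. \<exists>l. A e = l *\<^sub>R e"])
  fix S assume S: "orthonormal S" "\<forall>e\<in>S. \<exists>l. A e = l *\<^sub>R e" and ne: "\<exists>w\<in>V. w \<noteq> 0 \<and> (\<forall>e\<in>S. b w e = 0)"
  define W where "W = {w\<in>V. \<forall>e\<in>S. b w e = 0}"
  have SV: "S \<subseteq> V" using S by (simp add: orthonormal_def)
  have W: "subspace W" "W \<subseteq> V"
    using SV subspace_add[OF subspace] subspace_scale[OF subspace] subspace_0[OF subspace]
    by (auto simp: W_def subspace_def[of "Collect _"] add_left scale_left subset_iff)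
  interpret W: inner_form W b by (rule inner_form_subspace[OF W])
  have AW: "A w \<in> W" if w: "w \<in> W" for w
  proof -
    have "b (A w) e = 0" if e: "e \<in> S" for e
    proof -
      obtain l where l: "A e = l *\<^sub>R e" using S(2) e by blast
      have "b (A w) e = b w (A e)" using Asym w W(2) e SV by auto
      then show ?thesis using l w e W SV scale_right[of e w l] by (auto simp: W_def)
    qed
    then show ?thesis using AV w by (auto simp: W_def)
  qed
  have neW: "\<exists>v\<in>W. v \<noteq> 0" using ne by (auto simp: W_def)
  obtain l w where w: "w \<in> W" "w \<noteq> 0" "A w = l *\<^sub>R w"
  proof (rule W.symmetric_eigenvector_exists[of A])
    show "A (u + v) = A u + A v" if "u \<in> W" "v \<in> W" for u v using that W(2) by (intro Aadd) auto
    show "A (a *\<^sub>R u) = a *\<^sub>R A u" if "u \<in> W" for a u using that W(2) by (intro Ascale) auto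
    show "b (A u) v = b u (A v)" if "u \<in> W" "v \<in> W" for u v using that W(2) by (intro Asym) auto
  qed (use AW neW in blast)+
  have wV: "w \<in> V" using w(1) W(2) by (rule subsetD[rotated])
  have ev: "\<exists>l. A (a *\<^sub>R w) = l *\<^sub>R (a *\<^sub>R w)" for a
  proof
    show "A (a *\<^sub>R w) = l *\<^sub>R (a *\<^sub>R w)"
      unfolding Ascale[OF wV] w(3) scaleR_scaleR by (simp only: mult.commute)
  qed
  have "\<forall>e\<in>S. b w e = 0" using w(1) unfolding W_def by blast
  then show "\<exists>w\<in>V. w \<noteq> 0 \<and> (\<forall>e\<in>S. b w e = 0) \<and> (\<forall>a. a \<noteq> 0 \<longrightarrow> (\<exists>l. A (a *\<^sub>R w) = l *\<^sub>R (a *\<^sub>R w)))"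
    using w(2) wV ev by blast
next
  fix S assume "orthonormal S" "\<forall>e\<in>S. \<exists>l. A e = l *\<^sub>R e"
    "\<And>v. v \<in> V \<Longrightarrow> v = (\<Sum>e\<in>S. b v e *\<^sub>R e)"
  moreover from this(2) obtain l where "\<And>e. e \<in> S \<Longrightarrow> A e = l e *\<^sub>R e" by metis
  ultimately show thesis using that[of S l] by blast
qed (use subspace in auto)

end

text \<open>Induction on a spanning set: the solution for an enlarged space is corrected in the direction
  of the component of the new vector that is b-orthogonal to the old space.\<close>

lemma definite_form_solvable:
  fixes b :: "'v::real_vector \<Rightarrow> 'v \<Rightarrow> real"
  assumes V: "subspace V"
    and add_left: "\<And>u v w. \<lbrakk>u \<in> V; v \<in> V; w \<in> V\<rbrakk> \<Longrightarrow> b (u + v) w = b u w + b v w"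
    and scale_left: "\<And>a u w. \<lbrakk>u \<in> V; w \<in> V\<rbrakk> \<Longrightarrow> b (a *\<^sub>R u) w = a * b u w"
    and add_right: "\<And>u v w. \<lbrakk>u \<in> V; v \<in> V; w \<in> V\<rbrakk> \<Longrightarrow> b w (u + v) = b w u + b w v"
    and scale_right: "\<And>a u w. \<lbrakk>u \<in> V; w \<in> V\<rbrakk> \<Longrightarrow> b w (a *\<^sub>R u) = a * b w u"
    and pos: "\<And>u. \<lbrakk>u \<in> V; u \<noteq> 0\<rbrakk> \<Longrightarrow> 0 < b u u"
    and S: "finite S" "S \<subseteq> V"
    and ladd: "\<And>u v. \<lbrakk>u \<in> V; v \<in> V\<rbrakk> \<Longrightarrow> l (u + v) = l u + l v"
    and lscale: "\<And>a u. u \<in> V \<Longrightarrow> l (a *\<^sub>R u) = a * l u"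
  shows "\<exists>u\<in>span S. \<forall>v\<in>span S. b u v = (l v :: real)"
  using S ladd lscale
proof (induction S arbitrary: l rule: finite_induct)
  case empty
  have "(0::'v) \<in> V" using V subspace_0 by blast
  then have "l 0 = 0" "b 0 0 = 0" using empty(3)[of 0 0] scale_left[of 0 0 0] by auto
  then show ?case by simp
next
  case (insert e S)
  have SV: "span S \<subseteq> V" using insert.prems(1) V by (meson insert_subset span_minimal)
  have eV: "e \<in> V" using insert.prems by auto
  \<comment> \<open>\<open>b\<close> need not be symmetric: \<open>w\<close> reproduces
    \<open>b e\<close> on the old space, so \<open>e - w\<close> is orthogonal to it as a first
    argument, the slot in which the correction is made.\<close>
  obtain w where w: "w \<in> span S" "\<And>v. v \<in> span S \<Longrightarrow> b w v = b e v"
    using insert.IH[of "b e"] insert.prems(1) add_right scale_right eV by auto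
  obtain u where u: "u \<in> span S" "\<And>v. v \<in> span S \<Longrightarrow> b u v = l v"
    using insert.IH[of l] insert.prems by auto
  define d where "d = e - w"
  have dV: "d \<in> V" using eV w(1) SV V subspace_diff unfolding d_def by blast
  have dv: "b d v = 0" if "v \<in> span S" for v
  proof -
    have "b e v = b (d + w) v" by (simp add: d_def)
    also have "\<dots> = b d v + b w v" using dV w(1) that SV by (intro add_left) auto
    finally show ?thesis using w(2)[OF that] by simp
  qed
  have span_ins: "\<exists>k. v - k *\<^sub>R d \<in> span S" if "v \<in> span (insert e S)" for v
  proof -
    have "\<exists>k. v - k *\<^sub>R e \<in> span S" using that unfolding span_insert by simp
    then obtain k where "v - k *\<^sub>R e \<in> span S" ..
    then have "v - k *\<^sub>R e + k *\<^sub>R w \<in> span S" using w(1) by (intro span_add span_scale)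
    then show ?thesis by (auto simp: d_def algebra_simps intro!: exI[of _ k])
  qed
  have dS: "d \<in> span (insert e S)"
    unfolding d_def using w(1) by (meson insertI1 span_base span_diff span_mono subset_insertI subsetD)
  \<comment> \<open>\<open>d = 0\<close> means that \<open>e\<close> already lies in
    \<open>span S\<close>; then nothing has to be corrected and \<open>k\<close> is set to
    0.\<close>
  define k where "k = (if d = 0 then 0 else (l d - b u d) / b d d)"
  have kV: "k *\<^sub>R d \<in> V" using dV V subspace_scale by blast
  have uV: "u \<in> V" "u + k *\<^sub>R d \<in> V" using u(1) SV kV V subspace_add by blast+
  have zV: "(0::'v) \<in> V" using V subspace_0 by blast
  have z0: "b x 0 = 0" if "x \<in> V" for x using scale_right[of 0 x 0] zV that by simp
  have l0: "l 0 = 0" using insert.prems(3)[of 0 0] zV by simp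
  have kd: "b (u + k *\<^sub>R d) d = l d"
  proof (cases "d = 0")
    case False
    then show ?thesis using add_left[OF uV(1) kV dV] scale_left[OF dV dV] pos[OF dV] by (simp add: k_def)
  qed (use z0 uV l0 in auto)
  show ?case
  proof (intro bexI ballI)
    show "u + k *\<^sub>R d \<in> span (insert e S)"
      using u(1) dS by (meson span_add span_mono span_scale subsetD subset_insertI)
    fix v assume "v \<in> span (insert e S)"
    then obtain j where j: "v - j *\<^sub>R d \<in> span S" using span_ins by blast
    define x where "x = v - j *\<^sub>R d"
    have x: "x \<in> span S" "x \<in> V" "v = x + j *\<^sub>R d" using j SV by (auto simp: x_def)
    have jV: "j *\<^sub>R d \<in> V" using dV V subspace_scale by blast
    have "b (u + k *\<^sub>R d) v = b (u + k *\<^sub>R d) x + j * b (u + k *\<^sub>R d) d"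
      unfolding x(3) using add_right[OF x(2) jV uV(2)] scale_right[OF dV uV(2)] by simp
    also have "b (u + k *\<^sub>R d) x = l x"
      using add_left[OF uV(1) kV x(2)] scale_left[OF dV x(2)] dv[OF x(1)] u(2)[OF x(1)] by simp
    finally show "b (u + k *\<^sub>R d) v = l v"
      using kd x insert.prems(2)[OF x(2) jV] insert.prems(3)[OF dV] by simp
  qed
qed

section \<open>Polynomial spaces\<close>

definition monomial :: "('d::finite \<Rightarrow> nat) \<Rightarrow> real ^ 'd \<Rightarrow> real" where
  "monomial \<alpha> x = (\<Prod>i\<in>UNIV. x $ i ^ \<alpha> i)"

lemma finite_exponents: "finite {\<alpha> :: 'd::finite \<Rightarrow> nat. (\<Sum>i\<in>UNIV. \<alpha> i) \<le> p}"
proof (rule finite_subset)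
  show "{\<alpha> :: 'd \<Rightarrow> nat. (\<Sum>i\<in>UNIV. \<alpha> i) \<le> p} \<subseteq> (UNIV :: 'd set) \<rightarrow>\<^sub>E {..p}"
  proof
    fix \<alpha> :: "'d \<Rightarrow> nat" assume "\<alpha> \<in> {\<alpha>. (\<Sum>i\<in>UNIV. \<alpha> i) \<le> p}"
    then have "\<alpha> i \<le> p" for i using member_le_sum[of i UNIV \<alpha>] by simp
    then show "\<alpha> \<in> UNIV \<rightarrow>\<^sub>E {..p}" by auto
  qed
qed (auto intro: finite_PiE)

lemma poly_space_eq:
  "poly_space p = {f. \<exists>c. f = (\<lambda>x. \<Sum>\<alpha> | (\<Sum>i\<in>UNIV. \<alpha> i) \<le> p. c \<alpha> * monomial \<alpha> x)}"
  by (simp add: poly_space_def monomial_def)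

lemma poly_space_add: "f \<in> poly_space p \<Longrightarrow> g \<in> poly_space p \<Longrightarrow> (\<lambda>x. f x + g x) \<in> poly_space p"
proof -
  assume "f \<in> poly_space p" "g \<in> poly_space p"
  then obtain c d where "f = (\<lambda>x. \<Sum>\<alpha> | (\<Sum>i\<in>UNIV. \<alpha> i) \<le> p. c \<alpha> * monomial \<alpha> x)"
    "g = (\<lambda>x. \<Sum>\<alpha> | (\<Sum>i\<in>UNIV. \<alpha> i) \<le> p. d \<alpha> * monomial \<alpha> x)"
    by (auto simp: poly_space_eq)
  then show ?thesis
    unfolding poly_space_eq
    by (intro CollectI exI[of _ "\<lambda>\<alpha>. c \<alpha> + d \<alpha>"]) (simp add: distrib_right sum.distrib)
qed

lemma poly_space_scale: "f \<in> poly_space p \<Longrightarrow> (\<lambda>x. a * f x) \<in> poly_space p"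
proof -
  assume "f \<in> poly_space p"
  then obtain c where "f = (\<lambda>x. \<Sum>\<alpha> | (\<Sum>i\<in>UNIV. \<alpha> i) \<le> p. c \<alpha> * monomial \<alpha> x)"
    by (auto simp: poly_space_eq)
  then show ?thesis
    unfolding poly_space_eq
    by (intro CollectI exI[of _ "\<lambda>\<alpha>. a * c \<alpha>"]) (simp add: sum_distrib_left mult.assoc)
qed

lemma poly_space_zero: "(\<lambda>x. 0) \<in> poly_space p"
  unfolding poly_space_eq by (intro CollectI exI[of _ "\<lambda>\<alpha>. 0"]) simp

lemma poly_space_sum:
  "(\<And>i. i \<in> I \<Longrightarrow> f i \<in> poly_space p) \<Longrightarrow> (\<lambda>x. \<Sum>i\<in>I. f i x) \<in> poly_space p"
  by (induction I rule: infinite_finite_induct) (auto simp: poly_space_zero intro: poly_space_add)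

lemma monomial_in_poly_space: "(\<Sum>i\<in>UNIV. \<alpha> i) \<le> p \<Longrightarrow> monomial \<alpha> \<in> poly_space p"
  unfolding poly_space_eq
  by (intro CollectI exI[of _ "\<lambda>\<beta>. if \<beta> = \<alpha> then 1 else 0"])
     (auto simp: if_distrib[of "\<lambda>c. c * _"] sum.delta finite_exponents cong: if_cong)

lemma poly_space_const: "(\<lambda>x :: real ^ 'd::finite. c) \<in> poly_space p"
proof -
  have "(\<lambda>x :: real ^ 'd. c * monomial (\<lambda>i. 0) x) \<in> poly_space p"
    by (intro poly_space_scale monomial_in_poly_space) simp
  then show ?thesis by (simp add: monomial_def)
qed

lemma poly_space_inner:
  assumes "p \<ge> 1" shows "(\<lambda>x :: real ^ 'd::finite. w \<bullet> x) \<in> poly_space p"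
proof -
  have "monomial (\<lambda>j. if j = i then 1 else 0) = (\<lambda>x :: real ^ 'd. x $ i)" for i
    unfolding monomial_def by (simp add: if_distrib[of "(^) _"] prod.delta cong: if_cong)
  moreover have "monomial (\<lambda>j. if j = i then 1 else 0) \<in> poly_space p" for i :: 'd
    using assms by (intro monomial_in_poly_space) (simp add: sum.delta)
  ultimately have "(\<lambda>x :: real ^ 'd. x $ i) \<in> poly_space p" for i by metis
  then have "(\<lambda>x :: real ^ 'd. \<Sum>i\<in>UNIV. w $ i * x $ i) \<in> poly_space p"
    by (intro poly_space_sum poly_space_scale)
  then show ?thesis by (simp add: inner_vec_def)
qed

text \<open>For \<open>\<alpha> i = 0\<close> the natural subtraction leaves the exponent at 0, but
  then the factor \<open>real (\<alpha> i)\<close> removes the term.\<close>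

lemma monomial_has_derivative:
  "(monomial \<alpha> has_derivative
     (\<lambda>h. \<Sum>i\<in>UNIV. (real (\<alpha> i) * h $ i) * monomial (\<alpha>(i := \<alpha> i - 1)) x)) (at (x :: real ^ 'd::finite))"
proof -
  have "((\<lambda>x :: real ^ 'd. \<Prod>i\<in>UNIV. x $ i ^ \<alpha> i) has_derivative
      (\<lambda>h. \<Sum>i\<in>UNIV. (real (\<alpha> i) * h $ i * x $ i ^ (\<alpha> i - 1)) * (\<Prod>j\<in>UNIV - {i}. x $ j ^ \<alpha> j))) (at x)"
  proof (rule has_derivative_prod)
    show "((\<lambda>x :: real ^ 'd. x $ i ^ \<alpha> i) has_derivative (\<lambda>h. real (\<alpha> i) * h $ i * x $ i ^ (\<alpha> i - 1))) (at x)" for i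
      by (rule has_derivative_power[where f = "\<lambda>x. x $ i" and f' = "\<lambda>h. h $ i", THEN has_derivative_eq_rhs])
         (auto intro!: bounded_linear_imp_has_derivative bounded_linear_vec_nth)
  qed
  moreover have "monomial (\<alpha>(i := \<alpha> i - 1)) x = x $ i ^ (\<alpha> i - 1) * (\<Prod>j\<in>UNIV - {i}. x $ j ^ \<alpha> j)" for i
    unfolding monomial_def by (subst prod.remove[of UNIV i]) (auto intro!: arg_cong2[of _ _ _ _ "(*)"] prod.cong)
  moreover have "monomial \<alpha> = (\<lambda>x :: real ^ 'd. \<Prod>i\<in>UNIV. x $ i ^ \<alpha> i)"
    by (simp add: monomial_def fun_eq_iff)
  ultimately show ?thesis by (simp add: mult.assoc)
qed

text \<open>Derivatives are placed in the space with the same degree bound \<open>p\<close>. This is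
  what allows a derivative of a member of the broken space to serve as a test function.\<close>

lemma poly_space_has_derivative:
  assumes "q \<in> poly_space p"
  obtains q' where "\<And>x. (q has_derivative q' x) (at x)" "\<And>h. (\<lambda>x. q' x h) \<in> poly_space p"
proof -
  let ?I = "{\<alpha> :: 'a \<Rightarrow> nat. (\<Sum>i\<in>UNIV. \<alpha> i) \<le> p}"
  obtain c where q: "q = (\<lambda>x. \<Sum>\<alpha>\<in>?I. c \<alpha> * monomial \<alpha> x)"
    using assms by (auto simp: poly_space_eq)
  let ?d = "\<lambda>x h. \<Sum>\<alpha>\<in>?I. c \<alpha> * (\<Sum>i\<in>UNIV. (real (\<alpha> i) * h $ i) * monomial (\<alpha>(i := \<alpha> i - 1)) x)"
  show thesis
  proof (rule that[of ?d])
    show "(q has_derivative ?d x) (at x)" for x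
      unfolding q by (intro has_derivative_sum has_derivative_mult_right monomial_has_derivative)
    fix h :: "real ^ 'a"
    have "sum (\<alpha>(i := \<alpha> i - 1)) UNIV \<le> p" if "\<alpha> \<in> ?I" for \<alpha> i
    proof -
      have "sum (\<alpha>(i := \<alpha> i - 1)) UNIV \<le> sum \<alpha> UNIV" by (intro sum_mono) simp
      with that show ?thesis by (auto intro: order_trans)
    qed
    then show "(\<lambda>x. ?d x h) \<in> poly_space p"
      by (intro poly_space_sum poly_space_scale monomial_in_poly_space)
  qed
qed

lemma poly_space_frechet:
  assumes "q \<in> poly_space p"
  shows "(q has_derivative frechet_derivative q (at x)) (at x)"
    and "(\<lambda>x. frechet_derivative q (at x) h) \<in> poly_space p"
proof -
  obtain q' where q': "\<And>x. (q has_derivative q' x) (at x)" "\<And>h. (\<lambda>x. q' x h) \<in> poly_space p"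
    by (rule poly_space_has_derivative[OF assms]) blast
  have "frechet_derivative q (at x) = q' x" for x
    using frechet_derivative_at[OF q'(1)] by metis
  then show "(q has_derivative frechet_derivative q (at x)) (at x)"
    and "(\<lambda>x. frechet_derivative q (at x) h) \<in> poly_space p" using q' by auto
qed

lemma poly_space_continuous_on: "q \<in> poly_space p \<Longrightarrow> continuous_on S q"
  by (meson continuous_at_imp_continuous_on has_derivative_continuous poly_space_frechet(1))

lemma poly_space_real_polynomial_function:
  assumes "q \<in> poly_space p" shows "real_polynomial_function q"
proof -
  obtain c where q: "q = (\<lambda>x. \<Sum>\<alpha> | (\<Sum>i\<in>UNIV. \<alpha> i) \<le> p. c \<alpha> * (\<Prod>i\<in>UNIV. x $ i ^ \<alpha> i))"
    using assms unfolding poly_space_def by blast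
  show ?thesis
    unfolding q
    by (intro real_polynomial_function_sum real_polynomial_function.intros(2,4) real_polynomial_function_prod
        real_polynomial_function_power real_polynomial_function.intros(1) bounded_linear_vec_nth finite_exponents finite)
qed

text \<open>On the line from \<open>a\<close> to \<open>x\<close> the polynomial becomes univariate
  and vanishes on a nonempty open set of parameters, hence has infinitely many roots.\<close>

lemma poly_space_eq_0_if_open:
  fixes q :: "real ^ 'd::finite \<Rightarrow> real"
  assumes q: "q \<in> poly_space p" and K: "open K" "a \<in> K" "\<And>x. x \<in> K \<Longrightarrow> q x = 0"
  shows "q x = 0"
proof -
  define h where "h = (\<lambda>t :: real. a + t *\<^sub>R (x - a))"
  have "real_polynomial_function (q \<circ> h)"
    unfolding h_def
    by (intro real_polynomial_function_compose poly_space_real_polynomial_function[OF q]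
        polynomial_function_add polynomial_function_const polynomial_function_mult polynomial_function_id)
  then obtain c n where c: "q \<circ> h = (\<lambda>t. \<Sum>i\<le>n. c i * t ^ i)"
    by (auto simp: real_polynomial_function_iff_sum)
  have "open (h -` K)" unfolding h_def by (intro open_vimage K continuous_intros)
  moreover have "0 \<in> h -` K" using K by (simp add: h_def)
  ultimately have "infinite (h -` K)" using finite_imp_not_open by blast
  moreover have "h -` K \<subseteq> {t. (\<Sum>i\<le>n. c i * t ^ i) = 0}"
    using K(3) fun_cong[OF c, symmetric] by auto
  ultimately have "infinite {t. (\<Sum>i\<le>n. c i * t ^ i) = 0}" using finite_subset by blast
  then have "c i = 0" if "i \<le> n" for i using polyfun_finite_roots[of c n] that by blast
  then have "(q \<circ> h) 1 = 0" unfolding c by simp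
  then show ?thesis by (simp add: h_def)
qed

text \<open>The directional derivatives are polynomials themselves, so they vanish on the whole
  space, which is convex.\<close>

lemma poly_space_const_if_frechet_0:
  fixes q :: "real ^ 'd::finite \<Rightarrow> real"
  assumes q: "q \<in> poly_space p" and K: "open K" "a \<in> K"
    and 0: "\<And>x h. x \<in> K \<Longrightarrow> frechet_derivative q (at x) h = 0"
  shows "q x = q a"
proof -
  have "frechet_derivative q (at x) h = 0" for x h
    using poly_space_eq_0_if_open[OF poly_space_frechet(2)[OF q] K] 0 by blast
  then have "frechet_derivative q (at x) = (\<lambda>h. 0)" for x by auto
  then have "(q has_derivative (\<lambda>h. 0)) (at x within UNIV)" for x
    using poly_space_frechet(1)[OF q, of x] by simp
  then show ?thesis using has_derivative_zero_unique[of UNIV q a x] by simp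
qed

section \<open>Integration along a line\<close>

lemma eventually_nhds_left_right:
  fixes t :: real
  assumes "P t" "eventually P (at_left t)" "eventually P (at_right t)"
  shows "eventually P (nhds t)"
  using assms by (simp add: eventually_nhds_conv_at eventually_at_split)

lemma integral_FTC_greaterThanAtMost:
  fixes F f :: "real \<Rightarrow> real"
  assumes ab: "a \<le> b" and F: "\<And>t. (F has_real_derivative f t) (at t)" and f: "continuous_on UNIV f"
  shows "(LINT t|lborel. indicator {a<..b} t * f t) = F b - F a"
    and "(LINT t|lborel. indicator {a..b} t * f t) = F b - F a"
    and "integrable lborel (\<lambda>t. indicator {a<..b} t * f t)"
    and "integrable lborel (\<lambda>t. indicator {a..b} t * f t)"
proof -
  have [measurable]: "f \<in> borel_measurable borel" using f by (rule borel_measurable_continuous_onI)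
  have isc: "isCont f t" for t using f continuous_on_eq_continuous_at open_UNIV by blast
  have "(LINT t|lborel. f t * indicator {a..b} t) = F b - F a"
    by (rule integral_FTC_Icc_real[OF ab]) (use F isc in auto)
  then show Icc: "(LINT t|lborel. indicator {a..b} t * f t) = F b - F a"
    by (simp add: mult.commute)
  have "integrable lborel (\<lambda>t. f t * indicator {a..b} t)"
    by (rule borel_integrable_atLeastAtMost) (use isc in auto)
  then show i: "integrable lborel (\<lambda>t. indicator {a..b} t * f t)" by (simp add: mult.commute)
  have ae: "AE t in lborel. indicator {a<..b} t * f t = indicator {a..b} t * f t"
    using AE_lborel_singleton[of a] by eventually_elim (auto simp: indicator_def)
  show "(LINT t|lborel. indicator {a<..b} t * f t) = F b - F a"
    unfolding Icc[symmetric] by (rule integral_cong_AE) (use ae in auto)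
  show "integrable lborel (\<lambda>t. indicator {a<..b} t * f t)"
    by (rule integrable_cong_AE_imp[OF i]) (use ae in auto)
qed

text \<open>The indicator of U is the number of entries before t minus the number of exits up to t, since
  the difference is locally constant and vanishes far to the left.\<close>

lemma integral_derivative_over_crossings:
  fixes U En Ex :: "real set" and F f :: "real \<Rightarrow> real"
  assumes U: "bounded U" and fin: "finite En" "finite Ex" and disj: "En \<inter> Ex = {}"
    and off: "\<And>t. t \<notin> En \<union> Ex \<Longrightarrow> \<forall>\<^sub>F s in nhds t. s \<in> U \<longleftrightarrow> t \<in> U"
    and En: "\<And>t. t \<in> En \<Longrightarrow> t \<notin> U \<and> (\<forall>\<^sub>F s in at_left t. s \<notin> U) \<and> (\<forall>\<^sub>F s in at_right t. s \<in> U)"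
    and Ex: "\<And>t. t \<in> Ex \<Longrightarrow> t \<notin> U \<and> (\<forall>\<^sub>F s in at_left t. s \<in> U) \<and> (\<forall>\<^sub>F s in at_right t. s \<notin> U)"
    and F: "\<And>t. (F has_real_derivative f t) (at t)" and f: "continuous_on UNIV f"
  shows "(LINT t|lborel. indicator U t * f t) = sum F Ex - sum F En"
proof -
  \<comment> \<open>Crossing points lie outside \<open>U\<close>. The strict inequality makes an
    entry count only after the point, the weak one makes an exit count already at the point; thus
    \<open>c\<close> does not change at a crossing.\<close>
  define a where "a = (\<lambda>z s :: real. if z < s then 1 else 0 :: real)"
  define b where "b = (\<lambda>z s :: real. if z \<le> s then 1 else 0 :: real)"
  define c where "c = (\<lambda>s. indicator U s - (\<Sum>z\<in>En. a z s) + (\<Sum>z\<in>Ex. b z s))"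
  have a_const: "\<forall>\<^sub>F s in nhds t. a z s = a z t" and b_const: "\<forall>\<^sub>F s in nhds t. b z s = b z t"
    if "z \<noteq> t" for z t
  proof -
    have "\<forall>\<^sub>F s in nhds t. (z < s \<longleftrightarrow> z < t) \<and> (z \<le> s \<longleftrightarrow> z \<le> t)"
    proof (cases "z < t")
      case True
      then have "\<forall>\<^sub>F s in nhds t. s \<in> {z<..}" by (intro eventually_nhds_in_open) auto
      then show ?thesis by eventually_elim (use True in auto)
    next
      case False
      then have "\<forall>\<^sub>F s in nhds t. s \<in> {..<z}" using that by (intro eventually_nhds_in_open) auto
      then show ?thesis by eventually_elim (use False that in auto)
    qed
    then show "\<forall>\<^sub>F s in nhds t. a z s = a z t" and "\<forall>\<^sub>F s in nhds t. b z s = b z t"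
      unfolding a_def b_def by (auto elim: eventually_mono)
  qed
  have rest: "\<forall>\<^sub>F s in nhds t. (\<Sum>z\<in>En - {t}. a z s) = (\<Sum>z\<in>En - {t}. a z t) \<and>
                 (\<Sum>z\<in>Ex - {t}. b z s) = (\<Sum>z\<in>Ex - {t}. b z t)" for t
  proof -
    have "\<forall>\<^sub>F s in nhds t. \<forall>z\<in>En - {t}. a z s = a z t"
      by (rule eventually_ball_finite) (use fin a_const in auto)
    moreover have "\<forall>\<^sub>F s in nhds t. \<forall>z\<in>Ex - {t}. b z s = b z t"
      by (rule eventually_ball_finite) (use fin b_const in auto)
    ultimately show ?thesis by eventually_elim (auto intro: sum.cong)
  qed
  have loc: "\<forall>\<^sub>F s in nhds t. c s = c t" for t
  proof -
    consider "t \<notin> En \<union> Ex" | "t \<in> En" | "t \<in> Ex" by blast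
    then show ?thesis
    proof cases
      case 1
      then have "En - {t} = En" "Ex - {t} = Ex" by auto
      then show ?thesis
        by (intro eventually_mono[OF eventually_conj[OF rest[of t] off[OF 1]]])
           (simp add: c_def indicator_def)
    next
      case 2
      then have Ex0: "Ex - {t} = Ex" using disj by auto
      have c_eq: "c s = (indicator U s - a t s) - (\<Sum>z\<in>En - {t}. a z s) + (\<Sum>z\<in>Ex - {t}. b z s)" for s
        using sum.remove[OF fin(1) 2, of "\<lambda>z. a z s"] by (simp add: c_def Ex0)
      have "\<forall>\<^sub>F s in nhds t. indicator U s - a t s = (0 :: real)"
      proof (rule eventually_nhds_left_right)
        show "indicator U t - a t t = (0 :: real)" using En[OF 2] by (simp add: a_def)
        have "\<forall>\<^sub>F s in at_left t. s \<notin> U" "\<forall>\<^sub>F s in at_left t. s < t"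
          using En[OF 2] by (auto simp: eventually_at_filter)
        then show "\<forall>\<^sub>F s in at_left t. indicator U s - a t s = (0 :: real)"
          by eventually_elim (simp add: a_def)
        have "\<forall>\<^sub>F s in at_right t. s \<in> U" "\<forall>\<^sub>F s in at_right t. t < s"
          using En[OF 2] by (auto simp: eventually_at_filter)
        then show "\<forall>\<^sub>F s in at_right t. indicator U s - a t s = (0 :: real)"
          by eventually_elim (simp add: a_def)
      qed
      then show ?thesis
      proof (rule eventually_mono[OF eventually_conj[OF _ rest[of t]]])
        fix s
        assume "indicator U s - a t s = (0 :: real) \<and>
          (\<Sum>z\<in>En - {t}. a z s) = (\<Sum>z\<in>En - {t}. a z t) \<and> (\<Sum>z\<in>Ex - {t}. b z s) = (\<Sum>z\<in>Ex - {t}. b z t)"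
        moreover have "indicator U t - a t t = (0 :: real)" using En[OF 2] by (simp add: a_def)
        ultimately show "c s = c t" unfolding c_eq by simp
      qed
    next
      case 3
      then have En0: "En - {t} = En" using disj by auto
      have c_eq: "c s = (indicator U s + b t s) - (\<Sum>z\<in>En - {t}. a z s) + (\<Sum>z\<in>Ex - {t}. b z s)" for s
        using sum.remove[OF fin(2) 3, of "\<lambda>z. b z s"] by (simp add: c_def En0)
      have "\<forall>\<^sub>F s in nhds t. indicator U s + b t s = (1 :: real)"
      proof (rule eventually_nhds_left_right)
        show "indicator U t + b t t = (1 :: real)" using Ex[OF 3] by (simp add: b_def)
        have "\<forall>\<^sub>F s in at_left t. s \<in> U" "\<forall>\<^sub>F s in at_left t. s < t"
          using Ex[OF 3] by (auto simp: eventually_at_filter)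
        then show "\<forall>\<^sub>F s in at_left t. indicator U s + b t s = (1 :: real)"
          by eventually_elim (simp add: b_def)
        have "\<forall>\<^sub>F s in at_right t. s \<notin> U" "\<forall>\<^sub>F s in at_right t. t < s"
          using Ex[OF 3] by (auto simp: eventually_at_filter)
        then show "\<forall>\<^sub>F s in at_right t. indicator U s + b t s = (1 :: real)"
          by eventually_elim (simp add: b_def)
      qed
      then show ?thesis
      proof (rule eventually_mono[OF eventually_conj[OF _ rest[of t]]])
        fix s
        assume "indicator U s + b t s = (1 :: real) \<and>
          (\<Sum>z\<in>En - {t}. a z s) = (\<Sum>z\<in>En - {t}. a z t) \<and> (\<Sum>z\<in>Ex - {t}. b z s) = (\<Sum>z\<in>Ex - {t}. b z t)"
        moreover have "indicator U t + b t t = (1 :: real)" using Ex[OF 3] by (simp add: b_def)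
        ultimately show "c s = c t" unfolding c_eq by simp
      qed
    qed
  qed
  have "(c has_real_derivative 0) (at t)" for t
    using DERIV_cong_ev[OF refl loc[of t] refl, of 0] by simp
  then have c_const: "c s = c t" for s t using DERIV_isconst_all[of c] by blast
  have "bounded (U \<union> En \<union> Ex)" using U finite_imp_bounded[OF fin(1)] finite_imp_bounded[OF fin(2)] by simp
  then obtain R0 where R0: "\<And>t. t \<in> U \<union> En \<union> Ex \<Longrightarrow> \<bar>t\<bar> \<le> R0" by (auto simp: bounded_iff)
  define R where "R = R0 + 1"
  have R: "- R < t" "t < R" if "t \<in> U \<union> En \<union> Ex" for t using R0[OF that] by (auto simp: R_def)
  have "- R \<notin> U" "\<And>z. z \<in> En \<Longrightarrow> a z (- R) = 0" "\<And>z. z \<in> Ex \<Longrightarrow> b z (- R) = 0"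
    using R(1) by (force simp: a_def b_def)+
  then have "c (- R) = 0" by (simp add: c_def)
  then have c0: "c t = 0" for t using c_const by metis
  have "R \<notin> U" "\<And>z. z \<in> En \<Longrightarrow> a z R = 1" "\<And>z. z \<in> Ex \<Longrightarrow> b z R = 1"
    using R(2) by (force simp: a_def b_def less_imp_le)+
  \<comment> \<open>The value of \<open>c\<close> far to the right shows that entries and exits are
    equally many; the contributions \<open>F R\<close> of the cut-off will cancel.\<close>
  then have card: "real (card En) = real (card Ex)" using c0[of R] by (simp add: c_def)
  have split: "indicator U t * f t
      = (\<Sum>z\<in>En. indicator {z<..R} t * f t) - (\<Sum>z\<in>Ex. indicator {z..R} t * f t)" for t
  proof (cases "t \<le> R")
    case True
    then have "indicator {z<..R} t = a z t" "indicator {z..R} t = b z t" for z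
      by (auto simp: a_def b_def indicator_def)
    moreover have "indicator U t = (\<Sum>z\<in>En. a z t) - (\<Sum>z\<in>Ex. b z t)" using c0[of t] by (simp add: c_def)
    ultimately show ?thesis by (simp only: left_diff_distrib sum_distrib_right)
  next
    case False
    then have "t \<notin> U" using R(2)[of t] by auto
    then show ?thesis using False by (simp add: indicator_def)
  qed
  have le: "z \<le> R" if "z \<in> En \<union> Ex" for z using R(2)[of z] that by auto
  note FTC = integral_FTC_greaterThanAtMost[OF _ F f]
  have "(LINT t|lborel. indicator U t * f t)
      = (LINT t|lborel. (\<Sum>z\<in>En. indicator {z<..R} t * f t)) - (LINT t|lborel. (\<Sum>z\<in>Ex. indicator {z..R} t * f t))"
    unfolding split using le
    by (intro Bochner_Integration.integral_diff Bochner_Integration.integrable_sum FTC(3,4)) auto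
  also have "\<dots> = (\<Sum>z\<in>En. LINT t|lborel. indicator {z<..R} t * f t) - (\<Sum>z\<in>Ex. LINT t|lborel. indicator {z..R} t * f t)"
    using le by (intro arg_cong2[of _ _ _ _ "(-)"] Bochner_Integration.integral_sum FTC(3,4)) auto
  also have "\<dots> = (\<Sum>z\<in>En. F R - F z) - (\<Sum>z\<in>Ex. F R - F z)"
    using le by (intro arg_cong2[of _ _ _ _ "(-)"] sum.cong FTC(1,2)) auto
  also have "\<dots> = sum F Ex - sum F En" using card by (simp add: sum_subtractf)
  finally show ?thesis .
qed

section \<open>Integration over families of parallel lines\<close>

lemma integrable_bounded_support:
  fixes F :: "'a::euclidean_space \<Rightarrow> real"
  assumes [measurable]: "F \<in> borel_measurable borel"
    and B: "\<And>x. \<bar>F x\<bar> \<le> B" and R: "\<And>x. F x \<noteq> 0 \<Longrightarrow> norm x \<le> R"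
  shows "integrable lborel F"
proof (rule Bochner_Integration.integrable_bound)
  have "emeasure lborel (cball (0::'a) R) < \<infinity>"
    by (rule emeasure_bounded_finite) simp
  then show "integrable lborel (\<lambda>x. B * indicator (cball (0::'a) R) x)"
    by (intro integrable_mult_right integrable_real_indicator) auto
  show "AE x in lborel. norm (F x) \<le> norm (B * indicator (cball 0 R) x)"
  proof (rule AE_I2)
    fix x
    have "B \<ge> 0" using B[of x] by linarith
    then show "norm (F x) \<le> norm (B * indicator (cball 0 R) x)"
      using B[of x] R[of x] by (cases "F x = 0") (auto simp: indicator_def)
  qed
qed simp

lemma continuous_on_bounded_bound:
  fixes f :: "'a::euclidean_space \<Rightarrow> real"
  assumes "continuous_on UNIV f" "bounded S"
  obtains B where "\<And>x. x \<in> S \<Longrightarrow> \<bar>f x\<bar> \<le> B"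
proof -
  have "compact (f ` closure S)"
    using assms by (intro compact_continuous_image) (auto intro: continuous_on_subset)
  then have "bounded (f ` S)" by (meson bounded_subset closure_subset compact_imp_bounded image_mono)
  then show thesis using that by (auto simp: bounded_iff)
qed

lemma lborel_integral_translate:
  fixes F :: "'a::euclidean_space \<Rightarrow> real"
  assumes [measurable]: "F \<in> borel_measurable borel"
  shows "(LINT x|lborel. F (x + c)) = (LINT x|lborel. F x)"
proof -
  have "(LINT x|lborel. F x) = (LINT x|distr lborel borel ((+) c). F x)"
    by (simp add: lborel_distr_plus)
  also have "\<dots> = (LINT x|lborel. F (c + x))" by (rule integral_distr) auto
  finally show ?thesis by (simp add: add.commute)
qed

lemma lborel_Fubini_bounded_support:
  fixes H :: "'a::euclidean_space \<times> real \<Rightarrow> real"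
  assumes "H \<in> borel_measurable borel"
    and "\<And>z. \<bar>H z\<bar> \<le> B" and "\<And>x t. H (x, t) \<noteq> 0 \<Longrightarrow> norm x \<le> R \<and> \<bar>t\<bar> \<le> R"
  shows "(LINT x|lborel. LINT t|lborel. H (x, t)) = (LINT t|lborel. LINT x|lborel. H (x, t))"
proof -
  have "integrable lborel H"
  proof (rule integrable_bounded_support[OF assms(1,2)])
    fix z assume "H z \<noteq> 0"
    then have "norm (fst z) \<le> R" "\<bar>snd z\<bar> \<le> R" using assms(3)[of "fst z" "snd z"] by auto
    then show "norm z \<le> R + R"
      using norm_Pair_le[of "fst z" "snd z"] by simp
  qed
  then have "integrable (lborel \<Otimes>\<^sub>M lborel) (\<lambda>(x, t). H (x, t))"
    by (simp add: lborel_prod)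
  from lborel_pair.Fubini_integral[OF this] show ?thesis by simp
qed

text \<open>Both sides are the double integral of \<open>A x * B (x + t *\<^sub>R \<omega>)\<close>,
  by Fubini and a translation along \<open>\<omega>\<close> for fixed \<open>t\<close>. The support
  bound concerns the product only, because one factor will be the indicator of an unbounded
  slab.\<close>

lemma line_exchange:
  fixes A B :: "'a::euclidean_space \<Rightarrow> real" and \<omega> :: 'a
  assumes meas [measurable]: "A \<in> borel_measurable borel" "B \<in> borel_measurable borel"
    and a: "\<And>x. \<bar>A x\<bar> \<le> a" and b: "\<And>x. \<bar>B x\<bar> \<le> b"
    and R: "\<And>x t. A x \<noteq> 0 \<Longrightarrow> B (x + t *\<^sub>R \<omega>) \<noteq> 0 \<Longrightarrow> norm x \<le> R \<and> \<bar>t\<bar> \<le> R"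
  shows "(LINT x|lborel. A x * (LINT t|lborel. B (x + t *\<^sub>R \<omega>)))
       = (LINT x|lborel. B x * (LINT t|lborel. A (x - t *\<^sub>R \<omega>)))"
proof -
  have ab: "\<bar>A x * B y\<bar> \<le> a * b" for x y
    unfolding abs_mult by (intro mult_mono a b) (use a[of x] in auto)
  have "(LINT x|lborel. A x * (LINT t|lborel. B (x + t *\<^sub>R \<omega>)))
      = (LINT x|lborel. LINT t|lborel. (\<lambda>(x, t). A x * B (x + t *\<^sub>R \<omega>)) (x, t))"
    by simp
  also have "\<dots> = (LINT t|lborel. LINT x|lborel. (\<lambda>(x, t). A x * B (x + t *\<^sub>R \<omega>)) (x, t))"
    by (rule lborel_Fubini_bounded_support[where B = "a * b" and R = R]) (use ab R in \<open>auto simp: borel_prod[symmetric]\<close>)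
  also have "\<dots> = (LINT t|lborel. LINT x|lborel. (\<lambda>(x, t). B x * A (x - t *\<^sub>R \<omega>)) (x, t))"
  proof (rule Bochner_Integration.integral_cong[OF refl])
    fix t :: real
    have "(\<lambda>x. B x * A (x - t *\<^sub>R \<omega>)) \<in> borel_measurable borel" by measurable
    from lborel_integral_translate[OF this, of "t *\<^sub>R \<omega>"]
    show "(LINT x|lborel. (\<lambda>(x, t). A x * B (x + t *\<^sub>R \<omega>)) (x, t))
        = (LINT x|lborel. (\<lambda>(x, t). B x * A (x - t *\<^sub>R \<omega>)) (x, t))"
      by (simp add: mult.commute)
  qed
  also have "\<dots> = (LINT x|lborel. LINT t|lborel. (\<lambda>(x, t). B x * A (x - t *\<^sub>R \<omega>)) (x, t))"
  proof (rule lborel_Fubini_bounded_support[where B = "a * b" and R = "R + R * norm \<omega>", symmetric])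
    show "norm x \<le> R + R * norm \<omega> \<and> \<bar>t\<bar> \<le> R + R * norm \<omega>"
      if "(\<lambda>(x, t). B x * A (x - t *\<^sub>R \<omega>)) (x, t) \<noteq> 0" for x t
    proof -
      have t: "norm (x - t *\<^sub>R \<omega>) \<le> R" "\<bar>t\<bar> \<le> R" using R[of "x - t *\<^sub>R \<omega>" t] that by auto
      have "norm x \<le> norm (x - t *\<^sub>R \<omega>) + norm (t *\<^sub>R \<omega>)" by (metis diff_add_cancel norm_triangle_ineq)
      also have "\<dots> \<le> R + R * norm \<omega>" using t mult_right_mono[OF t(2), of "norm \<omega>"] by simp
      finally have "norm x \<le> R + R * norm \<omega>" .
      moreover have "0 \<le> R * norm \<omega>" using t by (intro mult_nonneg_nonneg) auto
      ultimately show ?thesis using t by linarith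
    qed
    show "\<bar>(\<lambda>(x, t). B x * A (x - t *\<^sub>R \<omega>)) z\<bar> \<le> a * b" for z
      using ab[of "fst z - snd z *\<^sub>R \<omega>" "fst z"] by (simp add: split_beta mult.commute)
  qed (auto simp: borel_prod[symmetric])
  finally show ?thesis by simp
qed

text \<open>Every line in a direction \<open>\<omega>\<close> with
  \<open>\<omega> \<bullet> \<nu> = 1\<close> meets the slab in a parameter interval of length 1.
  Integrating over the slab a function that is constant along these lines is therefore integration
  over the space of lines, without choosing transversal coordinates.\<close>

definition slab :: "'a::euclidean_space \<Rightarrow> 'a \<Rightarrow> 'a set" where
  "slab a \<nu> = {x. 0 \<le> \<nu> \<bullet> (x - a) \<and> \<nu> \<bullet> (x - a) \<le> 1}"

lemma slab_measurable [measurable]: "slab a \<nu> \<in> sets borel"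
proof -
  have "closed (slab a \<nu>)" unfolding slab_def
    by (intro closed_Collect_conj closed_Collect_le continuous_intros)
  then show ?thesis by simp
qed

lemma integral_line_slab:
  assumes "\<omega> \<bullet> \<nu> = 1"
  shows "(LINT t|lborel. indicator (slab a \<nu>) (x + t *\<^sub>R \<omega>)) = (1::real)"
    and "(LINT t|lborel. indicator (slab a \<nu>) (x - t *\<^sub>R \<omega>)) = (1::real)"
proof -
  let ?r = "\<nu> \<bullet> (x - a)"
  have e: "\<nu> \<bullet> (x + t *\<^sub>R \<omega> - a) = ?r + t" "\<nu> \<bullet> (x - t *\<^sub>R \<omega> - a) = ?r - t" for t
    using assms by (simp_all add: inner_diff_right inner_add_right inner_commute)
  have "(\<lambda>t. indicator (slab a \<nu>) (x + t *\<^sub>R \<omega>)) = (indicator {- ?r .. 1 - ?r} :: real \<Rightarrow> real)"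
    by (auto simp: slab_def e indicator_def fun_eq_iff)
  then show "(LINT t|lborel. indicator (slab a \<nu>) (x + t *\<^sub>R \<omega>)) = (1::real)" by simp
  have "(\<lambda>t. indicator (slab a \<nu>) (x - t *\<^sub>R \<omega>)) = (indicator {?r - 1 .. ?r} :: real \<Rightarrow> real)"
    by (auto simp: slab_def e indicator_def fun_eq_iff)
  then show "(LINT t|lborel. indicator (slab a \<nu>) (x - t *\<^sub>R \<omega>)) = (1::real)" by simp
qed

lemma slab_line_bound:
  assumes "\<omega> \<bullet> \<nu> = 1" "x \<in> slab a \<nu>" "norm (x + t *\<^sub>R \<omega>) \<le> R"
  shows "\<bar>t\<bar> \<le> norm \<nu> * (R + norm a) + 1"
    and "norm x \<le> R + (norm \<nu> * (R + norm a) + 1) * norm \<omega>"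
proof -
  have "\<nu> \<bullet> (x + t *\<^sub>R \<omega> - a) = \<nu> \<bullet> (x - a) + t"
    using assms(1) by (simp add: inner_diff_right inner_add_right inner_commute)
  then have "\<bar>t\<bar> \<le> \<bar>\<nu> \<bullet> (x + t *\<^sub>R \<omega> - a)\<bar> + 1" using assms(2) by (auto simp: slab_def)
  also have "\<bar>\<nu> \<bullet> (x + t *\<^sub>R \<omega> - a)\<bar> \<le> norm \<nu> * norm (x + t *\<^sub>R \<omega> - a)"
    by (rule Cauchy_Schwarz_ineq2)
  also have "norm (x + t *\<^sub>R \<omega> - a) \<le> R + norm a"
    using assms(3) norm_triangle_ineq4[of "x + t *\<^sub>R \<omega>" a] by linarith
  finally show t: "\<bar>t\<bar> \<le> norm \<nu> * (R + norm a) + 1" by (simp add: mult_left_mono)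
  have "norm x \<le> norm (x + t *\<^sub>R \<omega>) + norm (t *\<^sub>R \<omega>)"
    by (metis add_diff_cancel_right' norm_triangle_ineq4)
  also have "\<dots> \<le> R + (norm \<nu> * (R + norm a) + 1) * norm \<omega>"
    using t assms(3) by (auto intro!: add_mono mult_right_mono)
  finally show "norm x \<le> R + (norm \<nu> * (R + norm a) + 1) * norm \<omega>" .
qed

text \<open>\<open>line_exchange\<close> with the slab indicator as one factor; its integral along
  each line is 1.\<close>

lemma integral_by_lines:
  fixes F :: "'a::euclidean_space \<Rightarrow> real"
  assumes [measurable]: "F \<in> borel_measurable borel"
    and B: "\<And>x. \<bar>F x\<bar> \<le> B" and R: "\<And>x. F x \<noteq> 0 \<Longrightarrow> norm x \<le> R" and \<nu>: "\<omega> \<bullet> \<nu> = 1"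
  shows "(LINT x|lborel. F x) = (LINT x|lborel. indicator (slab a \<nu>) x * (LINT t|lborel. F (x + t *\<^sub>R \<omega>)))"
proof -
  define T where "T = norm \<nu> * (R + norm a) + 1"
  have "(LINT x|lborel. indicator (slab a \<nu>) x * (LINT t|lborel. F (x + t *\<^sub>R \<omega>)))
      = (LINT x|lborel. F x * (LINT t|lborel. indicator (slab a \<nu>) (x - t *\<^sub>R \<omega>)))"
  proof (rule line_exchange[where a = 1 and b = B and R = "max T (R + T * norm \<omega>)"])
    fix x t assume "indicator (slab a \<nu>) x \<noteq> (0::real)" "F (x + t *\<^sub>R \<omega>) \<noteq> 0"
    then show "norm x \<le> max T (R + T * norm \<omega>) \<and> \<bar>t\<bar> \<le> max T (R + T * norm \<omega>)"
      using slab_line_bound[OF \<nu>, of x a t R] R[of "x + t *\<^sub>R \<omega>"] unfolding T_def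
      by (auto simp: indicator_def split: if_splits)
  qed (use B in \<open>auto simp: indicator_def\<close>)
  also have "\<dots> = (LINT x|lborel. F x)" by (simp add: integral_line_slab[OF \<nu>])
  finally show ?thesis by simp
qed

text \<open>Insert the unit line integral of the second slab, exchange, and carry out the line
  integral over the first: all slabs crossed in unit time induce the same measure on the
  lines.\<close>

lemma integral_slab_change:
  fixes \<Phi> :: "'a::euclidean_space \<Rightarrow> real"
  assumes [measurable]: "\<Phi> \<in> borel_measurable borel"
    and B: "\<And>x. \<bar>\<Phi> x\<bar> \<le> B" and R: "\<And>x. x \<in> slab a \<nu> \<Longrightarrow> \<Phi> x \<noteq> 0 \<Longrightarrow> norm x \<le> R"
    and \<nu>: "\<omega> \<bullet> \<nu> = 1" "\<omega> \<bullet> \<nu>' = 1" and inv: "\<And>x t. \<Phi> (x + t *\<^sub>R \<omega>) = \<Phi> x"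
  shows "(LINT x|lborel. indicator (slab a \<nu>) x * \<Phi> x) = (LINT x|lborel. indicator (slab a' \<nu>') x * \<Phi> x)"
proof -
  define T where "T = 1 + norm \<nu>' * (R + norm a')"
  have inv': "\<Phi> (x - t *\<^sub>R \<omega>) = \<Phi> x" for x t using inv[of x "- t"] by simp
  have "(LINT x|lborel. indicator (slab a \<nu>) x * \<Phi> x)
      = (LINT x|lborel. (indicator (slab a \<nu>) x * \<Phi> x) * (LINT t|lborel. indicator (slab a' \<nu>') (x + t *\<^sub>R \<omega>)))"
    by (simp add: integral_line_slab[OF \<nu>(2)])
  also have "\<dots> = (LINT x|lborel. indicator (slab a' \<nu>') x * (LINT t|lborel. indicator (slab a \<nu>) (x - t *\<^sub>R \<omega>) * \<Phi> (x - t *\<^sub>R \<omega>)))"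
  proof (rule line_exchange[where a = B and b = 1 and R = "max R T"])
    fix x t assume A: "indicator (slab a \<nu>) x * \<Phi> x \<noteq> 0" "indicator (slab a' \<nu>') (x + t *\<^sub>R \<omega>) \<noteq> (0::real)"
    then have x: "norm x \<le> R" using R[of x] by (auto simp: indicator_def split: if_splits)
    have "\<nu>' \<bullet> (x + t *\<^sub>R \<omega> - a') = \<nu>' \<bullet> (x - a') + t"
      using \<nu>(2) by (simp add: inner_diff_right inner_add_right inner_commute)
    then have "\<bar>t\<bar> \<le> 1 + \<bar>\<nu>' \<bullet> (x - a')\<bar>"
      using A(2) by (auto simp: slab_def indicator_def split: if_splits)
    also have "\<bar>\<nu>' \<bullet> (x - a')\<bar> \<le> norm \<nu>' * norm (x - a')" by (rule Cauchy_Schwarz_ineq2)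
    also have "norm (x - a') \<le> R + norm a'" using x norm_triangle_ineq4[of x a'] by linarith
    finally have "\<bar>t\<bar> \<le> T" by (simp add: T_def mult_left_mono)
    with x show "norm x \<le> max R T \<and> \<bar>t\<bar> \<le> max R T" by auto
  next
    fix x show "\<bar>indicator (slab a \<nu>) x * \<Phi> x\<bar> \<le> B" using B[of x] by (auto simp: indicator_def)
  qed (auto simp: indicator_def)
  also have "\<dots> = (LINT x|lborel. indicator (slab a' \<nu>') x * \<Phi> x)"
    by (simp add: inv' integral_line_slab[OF \<nu>(1)])
  finally show ?thesis .
qed

text \<open>The point where the line through \<open>x\<close> in direction \<open>\<omega>\<close>
  meets the hyperplane through \<open>a\<close> with normal \<open>n\<close>; for
  \<open>\<omega> = n\<close> the orthogonal projection. If \<open>n \<bullet> \<omega> = 0\<close>,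
  division by zero returns \<open>x\<close>; such faces will carry the weight
  \<open>sgn 0 = 0\<close>.\<close>

definition oblique_proj :: "'a::euclidean_space \<Rightarrow> 'a \<Rightarrow> 'a \<Rightarrow> 'a \<Rightarrow> 'a" where
  "oblique_proj a n \<omega> x = x - (n \<bullet> (x - a) / (n \<bullet> \<omega>)) *\<^sub>R \<omega>"

lemma oblique_proj_measurable [measurable]: "oblique_proj a n \<omega> \<in> borel_measurable borel"
  unfolding oblique_proj_def[abs_def] by measurable

lemma oblique_proj_line [simp]:
  "n \<bullet> \<omega> \<noteq> 0 \<Longrightarrow> oblique_proj a n \<omega> (x + t *\<^sub>R \<omega>) = oblique_proj a n \<omega> x"
  by (simp add: oblique_proj_def inner_diff_right inner_add_right diff_divide_distrib add_divide_distrib algebra_simps)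

text \<open>The Jacobian \<open>\<bar>n \<bullet> \<omega>\<bar>\<close> of the oblique projection onto a hyperplane: a line in direction n
  sweeps the slab of oblique height 1 during a time \<open>\<bar>n \<bullet> \<omega>\<bar>\<close>, and along it the oblique and the
  orthogonal projection differ by a tangential translation.\<close>

lemma integral_oblique_proj:
  fixes h :: "'a::euclidean_space \<Rightarrow> real"
  assumes meas [measurable]: "h \<in> borel_measurable borel"
    and B: "\<And>x. \<bar>h x\<bar> \<le> B" and R: "\<And>x. h x \<noteq> 0 \<Longrightarrow> norm x \<le> R"
    and n: "norm n = 1" and k: "n \<bullet> \<omega> \<noteq> 0" and \<nu>: "\<omega> \<bullet> \<nu> = 1"
  shows "(LINT x|lborel. indicator (slab b \<nu>) x * h (oblique_proj a n \<omega> x))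
       = \<bar>n \<bullet> \<omega>\<bar> * (LINT x|lborel. indicator (slab a n) x * h (oblique_proj a n n x))"
proof -
  define k where "k = n \<bullet> \<omega>"
  define \<tau> where "\<tau> = (1 / k) *\<^sub>R \<omega> - n"
  \<comment> \<open>This slab is parallel to the hyperplane and still crossed by
    \<open>\<omega>\<close> in unit time, so it may replace the slab of
    \<open>\<nu>\<close>.\<close>
  define S where "S = slab a ((1 / k) *\<^sub>R n)"
  let ?\<chi> = "\<lambda>t. indicator {t. 0 \<le> t / k \<and> t / k \<le> 1} t :: real"
  let ?J = "\<lambda>(x, t). indicator (slab a n) x * (?\<chi> t * h (oblique_proj a n n x - t *\<^sub>R \<tau>))"
  have k0: "k \<noteq> 0" using k by (simp add: k_def)
  have nn: "n \<bullet> n = 1" using n by (simp add: dot_square_norm)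
  have n\<tau>: "n \<bullet> \<tau> = 0" using k0 nn by (simp add: \<tau>_def inner_diff_right k_def)
  have \<omega>S: "\<omega> \<bullet> ((1 / k) *\<^sub>R n) = 1" using k0 by (simp add: k_def inner_commute)
  have heightS: "((1 / k) *\<^sub>R n) \<bullet> (x - a) = n \<bullet> (x - a) / k" for x by simp
  have bS: "norm x \<le> R + norm \<omega>" if "x \<in> S" "h (oblique_proj a n \<omega> x) \<noteq> 0" for x
  proof -
    have "0 \<le> n \<bullet> (x - a) / k" "n \<bullet> (x - a) / k \<le> 1" using that(1) by (auto simp: S_def slab_def)
    then have "\<bar>n \<bullet> (x - a) / k\<bar> \<le> 1" by (simp only: abs_of_nonneg)
    then have "norm ((n \<bullet> (x - a) / k) *\<^sub>R \<omega>) \<le> norm \<omega>"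
      unfolding norm_scaleR by (rule mult_left_le_one_le[OF norm_ge_zero abs_ge_zero])
    moreover have "norm (oblique_proj a n \<omega> x) \<le> R" using R that(2) by blast
    moreover have "x = oblique_proj a n \<omega> x + (n \<bullet> (x - a) / k) *\<^sub>R \<omega>" by (simp add: oblique_proj_def k_def)
    ultimately show ?thesis by (metis add_mono norm_triangle_le)
  qed
  have S_meas [measurable]: "S \<in> sets borel" by (simp add: S_def)
  have "(LINT x|lborel. indicator (slab b \<nu>) x * h (oblique_proj a n \<omega> x))
      = (LINT x|lborel. indicator S x * h (oblique_proj a n \<omega> x))"
    unfolding S_def using bS B k \<omega>S \<nu> unfolding S_def
    by (intro integral_slab_change[symmetric, where B = B and \<omega> = \<omega>]) auto
  also have "\<dots> = (LINT x|lborel. indicator (slab a n) x *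
      (LINT t|lborel. indicator S (x + t *\<^sub>R n) * h (oblique_proj a n \<omega> (x + t *\<^sub>R n))))"
  proof (rule integral_by_lines)
    show "\<bar>indicator S x * h (oblique_proj a n \<omega> x)\<bar> \<le> B" for x using B order_trans[OF abs_ge_zero B]
      by (simp add: indicator_def)
    show "norm x \<le> R + norm \<omega>" if "indicator S x * h (oblique_proj a n \<omega> x) \<noteq> 0" for x
      using bS[of x] that by (auto simp: indicator_def split: if_splits)
  qed (use nn in auto)
  also have "\<dots> = (LINT x|lborel. LINT t|lborel.
      ?J (x, t))"
  proof (rule Bochner_Integration.integral_cong[OF refl])
    fix x
    \<comment> \<open>Shifting the parameter by the height of \<open>x\<close> makes
      \<open>t\<close> the signed distance from the hyperplane.\<close>
    define r where "r = n \<bullet> (x - a)"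
    have h: "n \<bullet> (x + (t - r) *\<^sub>R n - a) = t" for t
      using nn by (simp add: r_def inner_diff_right inner_add_right)
    have "(\<lambda>t. indicator S (x + t *\<^sub>R n) * h (oblique_proj a n \<omega> (x + t *\<^sub>R n))) \<in> borel_measurable borel"
      by measurable
    from lborel_integral_translate[OF this, of "- r"]
    have "(LINT t|lborel. indicator S (x + t *\<^sub>R n) * h (oblique_proj a n \<omega> (x + t *\<^sub>R n)))
        = (LINT t|lborel. indicator S (x + (t - r) *\<^sub>R n) * h (oblique_proj a n \<omega> (x + (t - r) *\<^sub>R n)))"
      by simp
    also have "\<dots> = (LINT t|lborel. ?\<chi> t * h (oblique_proj a n n x - t *\<^sub>R \<tau>))"
    proof (rule Bochner_Integration.integral_cong[OF refl])
      fix t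
      have "oblique_proj a n \<omega> (x + (t - r) *\<^sub>R n) = oblique_proj a n n x - t *\<^sub>R \<tau>"
        unfolding oblique_proj_def h k_def[symmetric] nn r_def[symmetric] by (simp add: \<tau>_def algebra_simps)
      moreover have "x + (t - r) *\<^sub>R n \<in> S \<longleftrightarrow> 0 \<le> t / k \<and> t / k \<le> 1"
        by (simp add: S_def slab_def h)
      ultimately show "indicator S (x + (t - r) *\<^sub>R n) * h (oblique_proj a n \<omega> (x + (t - r) *\<^sub>R n))
          = ?\<chi> t * h (oblique_proj a n n x - t *\<^sub>R \<tau>)"
        by (simp add: indicator_def)
    qed
    finally show "indicator (slab a n) x * (LINT t|lborel. indicator S (x + t *\<^sub>R n) * h (oblique_proj a n \<omega> (x + t *\<^sub>R n)))
      = (LINT t|lborel. ?J (x, t))"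
      by simp
  qed
  also have "\<dots> = (LINT t|lborel. LINT x|lborel.
      ?J (x, t))"
  proof (rule lborel_Fubini_bounded_support[where B = B and R = "max \<bar>k\<bar> (R + \<bar>k\<bar> * norm \<tau> + 1)"])
    have [measurable]: "{t. 0 \<le> t / k \<and> t / k \<le> 1} \<in> sets borel" by measurable
    show "?J \<in> borel_measurable borel"
      unfolding borel_prod[symmetric] by measurable
    show "\<bar>?J z\<bar> \<le> B" for z
      using B order_trans[OF abs_ge_zero B] by (simp add: indicator_def split_beta)
    fix x t
    assume "?J (x, t) \<noteq> 0"
    then have x: "x \<in> slab a n" and t: "0 \<le> t / k" "t / k \<le> 1" and h: "norm (oblique_proj a n n x - t *\<^sub>R \<tau>) \<le> R"
      using R by (auto simp: indicator_def split: if_splits)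
    have "\<bar>t / k\<bar> \<le> 1" using t by simp
    then have tk: "\<bar>t\<bar> \<le> \<bar>k\<bar>" using k0 by (simp add: abs_divide)
    have "x = (oblique_proj a n n x - t *\<^sub>R \<tau>) + t *\<^sub>R \<tau> + (n \<bullet> (x - a)) *\<^sub>R n"
      using nn by (simp add: oblique_proj_def)
    then have "norm x \<le> norm (oblique_proj a n n x - t *\<^sub>R \<tau>) + norm (t *\<^sub>R \<tau>) + norm ((n \<bullet> (x - a)) *\<^sub>R n)"
      by (metis add_mono norm_triangle_ineq norm_triangle_le order_refl)
    also have "\<dots> \<le> R + \<bar>k\<bar> * norm \<tau> + 1"
      using h tk x n by (intro add_mono) (auto simp: slab_def intro: mult_right_mono)
    finally show "norm x \<le> max \<bar>k\<bar> (R + \<bar>k\<bar> * norm \<tau> + 1) \<and> \<bar>t\<bar> \<le> max \<bar>k\<bar> (R + \<bar>k\<bar> * norm \<tau> + 1)"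
      using tk by linarith
  qed
  also have "\<dots> = (LINT t|lborel. ?\<chi> t *
       (LINT x|lborel. indicator (slab a n) x * h (oblique_proj a n n x)))"
  proof (rule Bochner_Integration.integral_cong[OF refl])
    fix t
    \<comment> \<open>\<open>\<tau>\<close> is tangential, so translating by a multiple of it
      preserves the slab and cancels the shift between the two projections; the inner integral no
      longer depends on \<open>t\<close>.\<close>
    have shift: "oblique_proj a n n (x + t *\<^sub>R \<tau>) = oblique_proj a n n x + t *\<^sub>R \<tau>"
      "x + t *\<^sub>R \<tau> \<in> slab a n \<longleftrightarrow> x \<in> slab a n" for x
    proof -
      have "n \<bullet> (x + t *\<^sub>R \<tau> - a) = n \<bullet> (x - a)" using n\<tau> by (simp add: inner_diff_right inner_add_right)
      then show "oblique_proj a n n (x + t *\<^sub>R \<tau>) = oblique_proj a n n x + t *\<^sub>R \<tau>"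
        "x + t *\<^sub>R \<tau> \<in> slab a n \<longleftrightarrow> x \<in> slab a n" by (simp_all add: oblique_proj_def slab_def)
    qed
    have "(\<lambda>x. indicator (slab a n) x * h (oblique_proj a n n x - t *\<^sub>R \<tau>)) \<in> borel_measurable borel"
      by measurable
    from lborel_integral_translate[OF this, of "t *\<^sub>R \<tau>"]
    have "(LINT x|lborel. indicator (slab a n) x * h (oblique_proj a n n x))
        = (LINT x|lborel. indicator (slab a n) x * h (oblique_proj a n n x - t *\<^sub>R \<tau>))"
      by (simp add: shift indicator_def)
    then show "(LINT x|lborel. ?J (x, t))
      = ?\<chi> t * (LINT x|lborel. indicator (slab a n) x * h (oblique_proj a n n x))"
      by (cases "t \<in> {t. 0 \<le> t / k \<and> t / k \<le> 1}") simp_all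
  qed
  also have "{t. 0 \<le> t / k \<and> t / k \<le> 1} = (if k > 0 then {0..k} else {k..0})"
    using k0 by (auto simp: field_simps)
  finally show ?thesis using k0 by (auto simp: k_def[symmetric])
qed

section \<open>The divergence theorem for polytopes\<close>

definition cylinder :: "'a::euclidean_space \<Rightarrow> 'a set \<Rightarrow> 'a set" where
  "cylinder \<omega> S = {x + t *\<^sub>R \<omega> | x t. x \<in> S}"

text \<open>The differences of points of \<open>P\<close> span a space of codimension at least two;
  adding \<open>\<omega>\<close> leaves a proper subspace, and the cylinder lies in a translate of
  it.\<close>

lemma negligible_cylinder:
  fixes P :: "'a::euclidean_space set"
  assumes "aff_dim P \<le> int DIM('a) - 2"
  shows "negligible (cylinder \<omega> P)"
proof (cases "P = {}")
  case False
  then obtain p where p: "p \<in> P" by blast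
  define D where "D = (\<lambda>x. - p + x) ` P"
  have "int (dim D) = aff_dim P" unfolding D_def using aff_dim_eq_dim[of p P] p by (simp add: hull_inc)
  then have "dim (insert \<omega> D) < DIM('a)"
    using assms dim_insert[of \<omega> D] by (auto split: if_splits)
  then have "negligible (span (insert \<omega> D))" by (intro negligible_lowdim) simp
  then have "negligible ((+) p ` span (insert \<omega> D))" by (rule negligible_translation)
  moreover have "cylinder \<omega> P \<subseteq> (+) p ` span (insert \<omega> D)"
  proof
    fix y assume "y \<in> cylinder \<omega> P"
    then obtain x t where x: "x \<in> P" "y = x + t *\<^sub>R \<omega>" by (auto simp: cylinder_def)
    have "- p + x \<in> span (insert \<omega> D)" unfolding D_def using x(1) by (intro span_base) blast
    then have "(- p + x) + t *\<^sub>R \<omega> \<in> span (insert \<omega> D)"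
      by (rule span_add[OF _ span_scale[OF span_base]]) simp
    moreover have "y = p + ((- p + x) + t *\<^sub>R \<omega>)" by (simp add: x(2))
    ultimately show "y \<in> (+) p ` span (insert \<omega> D)" by blast
  qed
  ultimately show ?thesis using negligible_subset by blast
qed (simp add: cylinder_def)

lemma polytope_face_aff_dim_closure: "polytope_face e \<Longrightarrow> aff_dim (closure e) = int DIM('a) - 1"
  for e :: "'a::euclidean_space set"
  by (simp add: polytope_face_def)

text \<open>A relatively open set is the intersection of an open set with its affine hull, which is
  closed.\<close>

lemma polytope_face_borel: "polytope_face e \<Longrightarrow> e \<in> sets borel"
  for e :: "'a::euclidean_space set"
proof -
  assume "polytope_face e"
  then have "e = rel_interior (closure e)" by (auto simp: polytope_face_def open_polytope_def)
  then have "openin (top_of_set (affine hull closure e)) e" using openin_rel_interior by metis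
  then obtain T where "open T" "e = affine hull closure e \<inter> T" by (auto simp: openin_open)
  then show ?thesis by (metis borel_closed borel_open closed_affine_hull sets.Int)
qed

lemma polytope_face_bounded: "polytope_face e \<Longrightarrow> bounded e"
  for e :: "'a::euclidean_space set"
proof -
  assume "polytope_face e"
  then obtain \<P> where "finite \<P>" "\<forall>P\<in>\<P>. polytope P" "closure e = \<Union>\<P>"
    by (auto simp: polytope_face_def open_polytope_def)
  then have "bounded (closure e)" by (auto simp: polytope_imp_bounded intro: bounded_Union)
  then show ?thesis using bounded_subset closure_subset by blast
qed

text \<open>The relative boundary of a face is covered by finitely many sets of codimension two.\<close>

lemma negligible_cylinder_face_boundary:
  fixes e :: "'a::euclidean_space set"
  assumes e: "polytope_face e"
  shows "negligible (cylinder \<omega> (closure e - e))"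
proof -
  obtain \<P> where P: "finite \<P>" "\<forall>P\<in>\<P>. polytope P" "closure e = \<Union>\<P>"
    and eq: "e = rel_interior (closure e)"
    using e unfolding polytope_face_def open_polytope_def by blast
  define Q where "Q = {F \<in> \<P> \<union> (\<Union>P\<in>\<P>. {F. F facet_of P}). aff_dim F \<le> int DIM('a) - 2}"
  have "finite (\<P> \<union> (\<Union>P\<in>\<P>. {F. F facet_of P}))" using P finite_polytope_facets by blast
  then have "finite Q" by (rule rev_finite_subset) (auto simp: Q_def)
  then have "negligible (\<Union>F\<in>Q. cylinder \<omega> F)"
    by (intro negligible_Union) (auto simp: Q_def intro: negligible_cylinder)
  moreover have "closure e - e \<subseteq> \<Union>Q"
  proof
    fix x assume x: "x \<in> closure e - e"
    then obtain P0 where P0: "P0 \<in> \<P>" "x \<in> P0" using P by auto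
    have sub: "P0 \<subseteq> closure e" using P P0 by auto
    then have le: "aff_dim P0 \<le> int DIM('a) - 1"
      using aff_dim_subset polytope_face_aff_dim_closure[OF e] by metis
    show "x \<in> \<Union>Q"
    proof (cases "aff_dim P0 \<le> int DIM('a) - 2")
      case True
      then show ?thesis using P0 by (auto simp: Q_def)
    next
      case False
      then have d: "aff_dim P0 = int DIM('a) - 1" using le by simp
      \<comment> \<open>A piece of the same dimension as the face spans the same hyperplane, hence
        its relative interior lies inside the face; the exceptional point must then be on one of its
        facets.\<close>
      have "affine hull P0 = affine hull closure e"
        by (rule affine_dim_equal[OF affine_affine_hull affine_affine_hull _ hull_mono[OF sub]])
           (use P0 d polytope_face_aff_dim_closure[OF e] in auto)
      then have "rel_interior P0 \<subseteq> e" using subset_rel_interior[OF sub] eq by metis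
      then have "x \<notin> rel_interior P0" using x by auto
      then have "x \<in> rel_frontier P0" using P0 closure_subset by (auto simp: rel_frontier_def)
      then obtain F where F: "F facet_of P0" "x \<in> F"
        using rel_frontier_of_polyhedron[of P0] P P0 polytope_imp_polyhedron by auto
      then have "aff_dim F \<le> int DIM('a) - 2" using d by (simp add: facet_of_def)
      then show ?thesis using F P0 by (auto simp: Q_def)
    qed
  qed
  then have "cylinder \<omega> (closure e - e) \<subseteq> (\<Union>F\<in>Q. cylinder \<omega> F)"
    by (fastforce simp: cylinder_def)
  ultimately show ?thesis using negligible_subset by blast
qed

text \<open>In a small ball around \<open>x\<close> the frontier of \<open>K\<close> stays within
  the plane of \<open>e\<close>. The two open half balls are convex and miss the frontier, so each
  lies in \<open>K\<close> or outside it, and the outward normal decides which.\<close>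

lemma half_ball_at_face:
  fixes K :: "'a::euclidean_space set"
  assumes K: "open K" and E: "finite E" "frontier K = (\<Union>e\<in>E. closure e)"
    and e: "e \<in> E" "outward_unit_normal K e n" and x: "x \<in> e" "\<And>e'. e' \<in> E \<Longrightarrow> e' \<noteq> e \<Longrightarrow> x \<notin> closure e'"
  obtains r where "r > 0" "\<And>y. y \<in> ball x r \<Longrightarrow> y \<in> K \<longleftrightarrow> n \<bullet> (y - x) < 0"
proof -
  have n: "norm n = 1" "\<And>y. y \<in> e \<Longrightarrow> n \<bullet> (y - x) = 0"
    "\<forall>\<^sub>F t in at_right 0. x - t *\<^sub>R n \<in> K \<and> x + t *\<^sub>R n \<notin> closure K"
    using e x unfolding outward_unit_normal_def by auto
  have nn: "n \<bullet> n = 1" using n by (simp add: dot_square_norm)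
  have n_cl: "n \<bullet> (y - x) = 0" if "y \<in> closure e" for y
  proof -
    have "closed {y. n \<bullet> (y - x) = 0}" by (intro closed_Collect_eq continuous_intros)
    moreover have "e \<subseteq> {y. n \<bullet> (y - x) = 0}" using n(2) by auto
    ultimately show ?thesis using closure_minimal that by blast
  qed
  have "open (- (\<Union>e'\<in>E - {e}. closure e'))" using E by (intro open_Compl closed_UN) auto
  moreover have "x \<in> - (\<Union>e'\<in>E - {e}. closure e')" using x by auto
  ultimately obtain r where r: "r > 0" "ball x r \<subseteq> - (\<Union>e'\<in>E - {e}. closure e')"
    by (meson open_contains_ball)
  then have fr: "n \<bullet> (y - x) = 0" if "y \<in> ball x r" "y \<in> frontier K" for y
    using that E(2) n_cl by blast
  have "\<forall>\<^sub>F t in at_right (0::real). t < r" using r(1) by (intro eventually_at_right_less[THEN eventually_mono] order_tendstoD) (auto intro: tendsto_ident_at)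
  then have "\<forall>\<^sub>F t in at_right 0. (x - t *\<^sub>R n \<in> K \<and> x + t *\<^sub>R n \<notin> closure K) \<and> (t < r \<and> 0 < t)"
    by (intro eventually_conj[OF n(3) eventually_conj] eventually_at_right_less)
  then obtain t where t: "x - t *\<^sub>R n \<in> K" "x + t *\<^sub>R n \<notin> closure K" "t < r" "0 < t"
    using eventually_happens'[OF trivial_limit_at_right_real] by blast
  define Hm where "Hm = ball x r \<inter> {y. n \<bullet> y < n \<bullet> x}"
  define Hp where "Hp = ball x r \<inter> {y. n \<bullet> y > n \<bullet> x}"
  have conn: "connected Hm" "connected Hp" unfolding Hm_def Hp_def
    by (intro convex_connected convex_Int convex_ball convex_halfspace_lt convex_halfspace_gt)+
  have disj: "Hm \<inter> frontier K = {}" "Hp \<inter> frontier K = {}"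
    using fr by (auto simp: Hm_def Hp_def inner_diff_right)
  have "x - t *\<^sub>R n \<in> Hm" "x + t *\<^sub>R n \<in> Hp" using t n nn
    by (auto simp: Hm_def Hp_def dist_norm inner_diff_right inner_add_right)
  moreover have "x + t *\<^sub>R n \<notin> K" using t(2) closure_subset by blast
  ultimately have "Hm \<inter> K \<noteq> {}" "Hp - K \<noteq> {}" using t(1) by blast+
  then have Hm: "Hm \<subseteq> K" and Hp: "Hp \<inter> K = {}"
    using connected_Int_frontier[OF conn(1), of K] connected_Int_frontier[OF conn(2), of K] disj by auto
  have "y \<in> K \<longleftrightarrow> n \<bullet> (y - x) < 0" if y: "y \<in> ball x r" for y
  proof -
    consider "n \<bullet> (y - x) < 0" | "n \<bullet> (y - x) > 0" | "n \<bullet> (y - x) = 0" by linarith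
    then show ?thesis
    proof cases
      case 1 then show ?thesis using Hm y by (auto simp: Hm_def inner_diff_right)
    next
      case 2 then show ?thesis using Hp y by (auto simp: Hp_def inner_diff_right)
    next
      case 3
      \<comment> \<open>A neighbourhood in \<open>K\<close> of a point of the plane would reach into
        the outer half ball.\<close>
      have "y \<notin> K"
      proof
        assume "y \<in> K"
        then have "open (K \<inter> ball x r)" "y \<in> K \<inter> ball x r" using K y by auto
        then obtain s where s: "s > 0" "ball y s \<subseteq> K \<inter> ball x r" by (meson open_contains_ball)
        have "y + (s/2) *\<^sub>R n \<in> ball y s" using s n by (simp add: dist_norm)
        then have "y + (s/2) *\<^sub>R n \<in> K \<inter> ball x r" using s by blast
        moreover have "n \<bullet> (y + (s/2) *\<^sub>R n) > n \<bullet> x" using 3 s nn by (simp add: inner_diff_right inner_add_right)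
        ultimately show False using Hp unfolding Hp_def by blast
      qed
      then show ?thesis using 3 by simp
    qed
  qed
  then show thesis using that r by blast
qed

lemma eventually_line_notin_frontier:
  fixes K :: "'a::euclidean_space set"
  assumes "x + t *\<^sub>R \<omega> \<notin> frontier K"
  shows "\<forall>\<^sub>F s in nhds t. x + s *\<^sub>R \<omega> \<in> K \<longleftrightarrow> x + t *\<^sub>R \<omega> \<in> K"
proof -
  have lim: "((\<lambda>s. x + s *\<^sub>R \<omega>) \<longlongrightarrow> x + t *\<^sub>R \<omega>) (nhds t)" by (intro tendsto_intros filterlim_ident)
  show ?thesis
  proof (cases "x + t *\<^sub>R \<omega> \<in> K")
    case True
    then have "x + t *\<^sub>R \<omega> \<in> interior K" using assms closure_subset by (auto simp: frontier_def)
    then have "\<forall>\<^sub>F s in nhds t. x + s *\<^sub>R \<omega> \<in> interior K" using lim by (intro topological_tendstoD) auto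
    then show ?thesis by eventually_elim (use True interior_subset in auto)
  next
    case False
    then have "x + t *\<^sub>R \<omega> \<in> - closure K" using assms interior_subset by (auto simp: frontier_def)
    then have "\<forall>\<^sub>F s in nhds t. x + s *\<^sub>R \<omega> \<in> - closure K" using lim by (intro topological_tendstoD) auto
    then show ?thesis by eventually_elim (use False closure_subset in auto)
  qed
qed

text \<open>Describes the prism by a slab and an orthogonal projection, the shape that appears in
  \<open>integral_oblique_proj\<close>. The base point is the same \<open>SOME\<close> choice as in
  \<open>hyperplane_proj\<close>.\<close>

lemma prism_iff:
  assumes n: "outward_unit_normal K e n" and ne: "e \<noteq> {}"
  defines "a \<equiv> SOME a. a \<in> e"
  shows "y \<in> prism e n \<longleftrightarrow> y \<in> slab a n \<and> oblique_proj a n n y \<in> e"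
    and "hyperplane_proj e n y = oblique_proj a n n y" and "a \<in> e"
proof -
  have nn: "n \<bullet> n = 1" and perp: "\<And>x y. x \<in> e \<Longrightarrow> y \<in> e \<Longrightarrow> n \<bullet> (x - y) = 0"
    using n by (auto simp: outward_unit_normal_def dot_square_norm)
  show a: "a \<in> e" using ne by (simp add: a_def some_in_eq)
  show "hyperplane_proj e n y = oblique_proj a n n y"
    by (simp add: hyperplane_proj_def oblique_proj_def a_def nn)
  show "y \<in> prism e n \<longleftrightarrow> y \<in> slab a n \<and> oblique_proj a n n y \<in> e"
  proof
    assume "y \<in> prism e n"
    then obtain x t where x: "x \<in> e" "0 \<le> t" "t \<le> 1" "y = x + t *\<^sub>R n" by (auto simp: prism_def)
    have "n \<bullet> (y - a) = t" using perp[OF x(1) a] nn unfolding x(4) by (simp add: inner_diff_right inner_add_right)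
    then show "y \<in> slab a n \<and> oblique_proj a n n y \<in> e"
      using x nn by (simp add: slab_def oblique_proj_def)
  next
    assume "y \<in> slab a n \<and> oblique_proj a n n y \<in> e"
    then show "y \<in> prism e n" unfolding prism_def using nn
      by (intro CollectI exI[of _ "oblique_proj a n n y"] exI[of _ "n \<bullet> (y - a)"])
         (auto simp: slab_def oblique_proj_def)
  qed
qed

definition face_integral :: "'a::euclidean_space set \<Rightarrow> 'a \<Rightarrow> ('a \<Rightarrow> real) \<Rightarrow> real" where
  "face_integral e n f = (LINT y:prism e n|lborel. f (hyperplane_proj e n y))"

lemma face_integral_eq:
  assumes n: "outward_unit_normal K e n" and ne: "e \<noteq> {}"
  defines "a \<equiv> SOME a. a \<in> e"
  shows "face_integral e n f
    = (LINT x|lborel. indicator (slab a n) x * (indicator e (oblique_proj a n n x) * f (oblique_proj a n n x)))"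
  unfolding face_integral_def set_lebesgue_integral_def a_def prism_iff(2)[OF n ne]
  by (intro Bochner_Integration.integral_cong) (auto simp: prism_iff(1)[OF n ne] indicator_def)

theorem directional_divergence:
  fixes K :: "'a::euclidean_space set" and f g :: "'a \<Rightarrow> real"
  assumes K: "open K" "bounded K" and E: "finite E" "\<And>e. e \<in> E \<Longrightarrow> polytope_face e" "pairwise disjnt E"
    and fr: "frontier K = (\<Union>e\<in>E. closure e)"
    and \<nu>: "\<And>e. e \<in> E \<Longrightarrow> outward_unit_normal K e (\<nu> e)"
    and \<omega>: "norm \<omega> = 1"
    and f: "continuous_on UNIV f" and g: "continuous_on UNIV g"
    and fg: "\<And>x t. ((\<lambda>t. f (x + t *\<^sub>R \<omega>)) has_real_derivative g (x + t *\<^sub>R \<omega>)) (at t)"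
  shows "(LINT x:K|lborel. g x) = (\<Sum>e\<in>E. (\<omega> \<bullet> \<nu> e) * face_integral e (\<nu> e) f)"
proof -
  define a where "a e = (SOME a. a \<in> e)" for e :: "'a set"
  define k where "k e = \<nu> e \<bullet> \<omega>" for e
  define z where "z e = oblique_proj (a e) (\<nu> e) \<omega>" for e
  define h where "h e x = indicator e x * f x" for e x
  have ne: "e \<noteq> {}" if "e \<in> E" for e using E(2)[OF that] by (auto simp: polytope_face_def open_polytope_def)
  have a: "a e \<in> e" if "e \<in> E" for e using prism_iff(3)[OF \<nu> ne] that by (simp add: a_def)
  have perp: "\<nu> e \<bullet> (x - y) = 0" if "e \<in> E" "x \<in> e" "y \<in> e" for e x y
    using \<nu>[OF that(1)] that by (auto simp: outward_unit_normal_def)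
  have n1: "norm (\<nu> e) = 1" if "e \<in> E" for e using \<nu>[OF that] by (simp add: outward_unit_normal_def)
  have \<omega>\<omega>: "\<omega> \<bullet> \<omega> = 1" using \<omega> by (simp add: dot_square_norm)
  have [measurable]: "f \<in> borel_measurable borel" "g \<in> borel_measurable borel" "K \<in> sets borel"
    using f g K by (auto intro: borel_measurable_continuous_onI)
  obtain Bg where Bg: "\<And>x. x \<in> K \<Longrightarrow> \<bar>g x\<bar> \<le> Bg" by (rule continuous_on_bounded_bound[OF g K(2)]) blast
  obtain RK where RK: "\<And>x. x \<in> K \<Longrightarrow> norm x \<le> RK" using K(2) by (auto simp: bounded_iff)
  \<comment> \<open>Lines to be discarded: those through the relative boundary of a face, and those
    inside the plane of a face parallel to \<open>\<omega>\<close>. All these sets are unions of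
    whole lines in direction \<open>\<omega>\<close>, so \<open>x\<close> decides about its entire
    line.\<close>
  define bad where "bad = (\<Union>e\<in>E. cylinder \<omega> (closure e - e)) \<union> (\<Union>e\<in>{e\<in>E. k e = 0}. {x. \<nu> e \<bullet> x = \<nu> e \<bullet> a e})"
  have "negligible bad" unfolding bad_def
  proof (intro negligible_Un negligible_Union)
    fix S assume "S \<in> (\<lambda>e. {x. \<nu> e \<bullet> x = \<nu> e \<bullet> a e}) ` {e\<in>E. k e = 0}"
    then obtain e where "e \<in> E" "S = {x. \<nu> e \<bullet> x = \<nu> e \<bullet> a e}" by auto
    moreover have "\<nu> e \<noteq> 0" using n1[of e] calculation by auto
    ultimately show "negligible S" using negligible_hyperplane by blast
  qed (use E negligible_cylinder_face_boundary in auto)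
  then have good: "AE x in lborel. x \<notin> bad"
    by (metis AE_not_in AE_completion_iff negligible_iff_null_sets AE_completion)
  have line: "(LINT t|lborel. indicator K (x + t *\<^sub>R \<omega>) * g (x + t *\<^sub>R \<omega>)) = (\<Sum>e\<in>E. sgn (k e) * h e (z e x))"
    if x: "x \<notin> bad" for x
  proof -
    define \<tau> where "\<tau> e = - (\<nu> e \<bullet> (x - a e)) / k e" for e
    have z\<tau>: "z e x = x + \<tau> e *\<^sub>R \<omega>" for e by (simp add: z_def oblique_proj_def \<tau>_def k_def)
    define H where "H = {e \<in> E. k e \<noteq> 0 \<and> z e x \<in> e}"
    \<comment> \<open>A good line meets the closure of a face only in the face itself,
      transversally, and at the single parameter \<open>\<tau> e\<close>.\<close>
    have hit_cl: "e \<in> H \<and> t = \<tau> e" if e: "e \<in> E" and t: "x + t *\<^sub>R \<omega> \<in> closure e" for e t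
    proof -
      have in_e: "x + t *\<^sub>R \<omega> \<in> e"
      proof (rule ccontr)
        assume "x + t *\<^sub>R \<omega> \<notin> e"
        then have "(x + t *\<^sub>R \<omega>) + (- t) *\<^sub>R \<omega> \<in> cylinder \<omega> (closure e - e)"
          using t unfolding cylinder_def by blast
        then show False using x e by (auto simp: bad_def)
      qed
      have p: "\<nu> e \<bullet> (x - a e) + t * k e = 0"
        using perp[OF e in_e a[OF e]] by (simp add: inner_diff_right inner_add_right k_def)
      have k0: "k e \<noteq> 0"
      proof
        assume "k e = 0"
        then have "x \<in> bad" using p e by (auto simp: bad_def inner_diff_right)
        then show False using x by simp
      qed
      then have "t = \<tau> e" using p by (simp add: \<tau>_def field_simps)
      then show ?thesis using e k0 in_e by (simp add: H_def z\<tau>)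
    qed
    \<comment> \<open>Faces are disjoint, so a crossing point lies in the closure of one face only,
      as \<open>half_ball_at_face\<close> demands.\<close>
    have unique: "e' = e" if "e \<in> H" "e' \<in> E" "z e x \<in> closure e'" for e e'
    proof -
      have "e' \<in> H" "\<tau> e = \<tau> e'" using hit_cl[OF that(2)] that(3) by (auto simp: z\<tau>)
      then have "z e x \<in> e \<inter> e'" using that(1) by (auto simp: H_def z\<tau>)
      then show ?thesis using E(3) that by (auto simp: pairwise_def disjnt_def H_def)
    qed
    have inj: "inj_on \<tau> H"
    proof (rule inj_onI)
      fix e e' assume "e \<in> H" "e' \<in> H" "\<tau> e = \<tau> e'"
      then show "e = e'" using unique[of e e'] closure_subset by (auto simp: H_def z\<tau>)
    qed
    define U where "U = {t. x + t *\<^sub>R \<omega> \<in> K}"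
    define En where "En = \<tau> ` {e\<in>H. k e < 0}"
    define Ex where "Ex = \<tau> ` {e\<in>H. k e > 0}"
    \<comment> \<open>The sign of \<open>k e\<close> tells whether the line enters or leaves: the
      side of the plane is given by the sign of \<open>(s - \<tau> e) * k e\<close>.\<close>
    have near: "\<tau> e \<notin> U \<and> (\<forall>\<^sub>F s in nhds (\<tau> e). s \<in> U \<longleftrightarrow> (s - \<tau> e) * k e < 0)" if e: "e \<in> H" for e
    proof -
      have e': "e \<in> E" "z e x \<in> e" using e by (auto simp: H_def)
      obtain r where r: "r > 0" "\<And>y. y \<in> ball (z e x) r \<Longrightarrow> y \<in> K \<longleftrightarrow> \<nu> e \<bullet> (y - z e x) < 0"
        by (rule half_ball_at_face[OF K(1) E(1) fr e'(1) \<nu>[OF e'(1)] e'(2)]) (use unique[OF e] in blast)+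
      have U: "s \<in> U \<longleftrightarrow> (s - \<tau> e) * k e < 0" if "\<bar>s - \<tau> e\<bar> < r" for s
      proof -
        have d: "(x + s *\<^sub>R \<omega>) - z e x = (s - \<tau> e) *\<^sub>R \<omega>" by (simp add: z\<tau> algebra_simps)
        then have "x + s *\<^sub>R \<omega> \<in> ball (z e x) r" using that \<omega> by (simp add: dist_norm norm_minus_commute[of "z e x"])
        from r(2)[OF this] show ?thesis unfolding d by (simp add: U_def k_def)
      qed
      have "\<tau> e \<notin> U" using U[of "\<tau> e"] r(1) by simp
      moreover have "\<forall>\<^sub>F s in nhds (\<tau> e). s \<in> {\<tau> e - r <..< \<tau> e + r}"
        using r(1) by (intro eventually_nhds_in_open) auto
      then have "\<forall>\<^sub>F s in nhds (\<tau> e). s \<in> U \<longleftrightarrow> (s - \<tau> e) * k e < 0"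
        by (rule eventually_mono) (use U in \<open>auto simp: abs_less_iff\<close>)
      ultimately show ?thesis by blast
    qed
    have lr: "\<forall>\<^sub>F s in at_left t. s < t" "\<forall>\<^sub>F s in at_right t. t < s" for t :: real
      by (auto simp: eventually_at_filter)
    have lr2: "\<forall>\<^sub>F s in at_left t. P s" "\<forall>\<^sub>F s in at_right t. P s" if "\<forall>\<^sub>F s in nhds t. P s" for t :: real and P
      using that by (auto simp: eventually_at_filter elim: eventually_mono)
    have "(LINT t|lborel. indicator U t * g (x + t *\<^sub>R \<omega>)) = sum (\<lambda>t. f (x + t *\<^sub>R \<omega>)) Ex - sum (\<lambda>t. f (x + t *\<^sub>R \<omega>)) En"
    proof (rule integral_derivative_over_crossings)
      show "bounded U" unfolding bounded_iff
      proof (intro exI[of _ "RK + norm x"] ballI)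
        fix t assume "t \<in> U"
        then have "norm (x + t *\<^sub>R \<omega>) \<le> RK" using RK by (simp add: U_def)
        moreover have "norm (t *\<^sub>R \<omega>) \<le> norm (x + t *\<^sub>R \<omega>) + norm x"
          by (metis add_diff_cancel_left' norm_triangle_ineq4)
        ultimately show "norm t \<le> RK + norm x" using \<omega> by simp
      qed
      show "finite En" "finite Ex" using E(1) by (auto simp: En_def Ex_def H_def)
      have "{e\<in>H. k e < 0} \<inter> {e\<in>H. k e > 0} = {}" by auto
      then show "En \<inter> Ex = {}" unfolding En_def Ex_def
        using inj_on_image_Int[OF inj, of "{e\<in>H. k e < 0}" "{e\<in>H. k e > 0}"] by simp
      fix t
      show "\<forall>\<^sub>F s in nhds t. s \<in> U \<longleftrightarrow> t \<in> U" if "t \<notin> En \<union> Ex"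
      proof -
        have "t \<notin> \<tau> ` H"
        proof
          assume "t \<in> \<tau> ` H"
          then obtain e where e: "e \<in> H" "t = \<tau> e" by blast
          then have "k e \<noteq> 0" by (simp add: H_def)
          then consider "k e < 0" | "k e > 0" by linarith
          then have "t \<in> En \<union> Ex" by cases (auto simp: En_def Ex_def e)
          then show False using that by blast
        qed
        then have "x + t *\<^sub>R \<omega> \<notin> frontier K" using hit_cl unfolding fr by blast
        from eventually_line_notin_frontier[OF this] show ?thesis by (simp add: U_def)
      qed
      show "t \<notin> U \<and> (\<forall>\<^sub>F s in at_left t. s \<notin> U) \<and> (\<forall>\<^sub>F s in at_right t. s \<in> U)" if tEn: "t \<in> En"
      proof -
        obtain e where e: "e \<in> H" "k e < 0" "t = \<tau> e" using tEn by (auto simp: En_def)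
        note nr = near[OF e(1), folded e(3)]
        have "\<forall>\<^sub>F s in at_left t. s \<notin> U"
          by (rule eventually_mono[OF eventually_conj[OF lr(1) lr2(1)[OF conjunct2[OF nr]]]])
             (use e(2) in \<open>auto simp: mult_less_0_iff\<close>)
        moreover have "\<forall>\<^sub>F s in at_right t. s \<in> U"
          by (rule eventually_mono[OF eventually_conj[OF lr(2) lr2(2)[OF conjunct2[OF nr]]]])
             (use e(2) in \<open>auto simp: mult_less_0_iff\<close>)
        ultimately show ?thesis using nr by blast
      qed
      show "t \<notin> U \<and> (\<forall>\<^sub>F s in at_left t. s \<in> U) \<and> (\<forall>\<^sub>F s in at_right t. s \<notin> U)" if tEx: "t \<in> Ex"
      proof -
        obtain e where e: "e \<in> H" "k e > 0" "t = \<tau> e" using tEx by (auto simp: Ex_def)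
        note nr = near[OF e(1), folded e(3)]
        have "\<forall>\<^sub>F s in at_left t. s \<in> U"
          by (rule eventually_mono[OF eventually_conj[OF lr(1) lr2(1)[OF conjunct2[OF nr]]]])
             (use e(2) in \<open>auto simp: mult_less_0_iff\<close>)
        moreover have "\<forall>\<^sub>F s in at_right t. s \<notin> U"
          by (rule eventually_mono[OF eventually_conj[OF lr(2) lr2(2)[OF conjunct2[OF nr]]]])
             (use e(2) in \<open>auto simp: mult_less_0_iff\<close>)
        ultimately show ?thesis using nr by blast
      qed
      show "((\<lambda>t. f (x + t *\<^sub>R \<omega>)) has_real_derivative g (x + t *\<^sub>R \<omega>)) (at t)" by (rule fg)
      show "continuous_on UNIV (\<lambda>t. g (x + t *\<^sub>R \<omega>))"
        by (intro continuous_on_compose2[OF g] continuous_intros) auto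
    qed
    also have "sum (\<lambda>t. f (x + t *\<^sub>R \<omega>)) Ex = (\<Sum>e\<in>{e\<in>H. k e > 0}. f (z e x))"
      unfolding Ex_def z\<tau> by (subst sum.reindex) (auto intro: inj_on_subset[OF inj])
    also have "sum (\<lambda>t. f (x + t *\<^sub>R \<omega>)) En = (\<Sum>e\<in>{e\<in>H. k e < 0}. f (z e x))"
      unfolding En_def z\<tau> by (subst sum.reindex) (auto intro: inj_on_subset[OF inj])
    also have "(\<Sum>e\<in>{e\<in>H. k e > 0}. f (z e x)) = (\<Sum>e\<in>E. if e \<in> H \<and> k e > 0 then f (z e x) else 0)"
      using E(1) by (intro sum.mono_neutral_cong_left) (auto simp: H_def)
    also have "(\<Sum>e\<in>{e\<in>H. k e < 0}. f (z e x)) = (\<Sum>e\<in>E. if e \<in> H \<and> k e < 0 then f (z e x) else 0)"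
      using E(1) by (intro sum.mono_neutral_cong_left) (auto simp: H_def)
    also have "(\<Sum>e\<in>E. if e \<in> H \<and> k e > 0 then f (z e x) else 0) - (\<Sum>e\<in>E. if e \<in> H \<and> k e < 0 then f (z e x) else 0)
       = (\<Sum>e\<in>E. sgn (k e) * h e (z e x))"
      unfolding sum_subtractf[symmetric] by (intro sum.cong) (auto simp: H_def h_def sgn_if)
    finally show ?thesis by (simp add: U_def indicator_def)
  qed
  have h_meas [measurable]: "h e \<in> borel_measurable borel" if "e \<in> E" for e
  proof -
    have [measurable]: "e \<in> sets borel" using polytope_face_borel E(2) that by blast
    show ?thesis unfolding h_def[abs_def] by measurable
  qed
  have z_meas [measurable]: "z e \<in> borel_measurable borel" for e unfolding z_def by measurable
  have hB: "\<exists>B. \<forall>x. \<bar>h e x\<bar> \<le> B" and hR: "\<exists>R. \<forall>x. h e x \<noteq> 0 \<longrightarrow> norm x \<le> R" if e: "e \<in> E" for e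
  proof -
    have b: "bounded e" using polytope_face_bounded E(2) e by blast
    obtain B where B: "\<And>x. x \<in> e \<Longrightarrow> \<bar>f x\<bar> \<le> B" by (rule continuous_on_bounded_bound[OF f b]) blast
    have "\<bar>h e x\<bar> \<le> max B 0" for x using B by (auto simp: h_def indicator_def intro: le_max_iff_disj[THEN iffD2])
    then show "\<exists>B. \<forall>x. \<bar>h e x\<bar> \<le> B" by blast
    obtain R where "\<forall>x\<in>e. norm x \<le> R" using b by (auto simp: bounded_iff)
    then show "\<exists>R. \<forall>x. h e x \<noteq> 0 \<longrightarrow> norm x \<le> R" by (auto simp: h_def indicator_def intro!: exI[of _ R])
  qed
  \<comment> \<open>Every crossing is counted with \<open>sgn (k e)\<close> and the projection has
    Jacobian \<open>\<bar>k e\<bar>\<close>; the product is the factor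
    \<open>\<omega> \<bullet> \<nu> e\<close>.\<close>
  have face: "(LINT x|lborel. indicator (slab 0 \<omega>) x * (sgn (k e) * h e (z e x))) = (\<omega> \<bullet> \<nu> e) * face_integral e (\<nu> e) f"
    and int: "integrable lborel (\<lambda>x. indicator (slab 0 \<omega>) x * (sgn (k e) * h e (z e x)))" if e: "e \<in> E" for e
  proof -
    obtain B where B: "\<And>x. \<bar>h e x\<bar> \<le> B" using hB[OF e] by blast
    obtain R where R: "\<And>x. h e x \<noteq> 0 \<Longrightarrow> norm x \<le> R" using hR[OF e] by blast
    have [measurable]: "h e \<in> borel_measurable borel" by (rule h_meas[OF e])
    show "(LINT x|lborel. indicator (slab 0 \<omega>) x * (sgn (k e) * h e (z e x))) = (\<omega> \<bullet> \<nu> e) * face_integral e (\<nu> e) f"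
    proof (cases "k e = 0")
      case False
      have "(LINT x|lborel. indicator (slab 0 \<omega>) x * (sgn (k e) * h e (z e x)))
          = sgn (k e) * (LINT x|lborel. indicator (slab 0 \<omega>) x * h e (oblique_proj (a e) (\<nu> e) \<omega> x))"
        by (simp add: z_def mult.left_commute)
      also have "\<dots> = sgn (k e) * (\<bar>k e\<bar> * face_integral e (\<nu> e) f)"
        using False integral_oblique_proj[where a = "a e" and b = 0, OF h_meas[OF e] B R n1[OF e] _ \<omega>\<omega>]
        by (simp add: face_integral_eq[OF \<nu>[OF e] ne[OF e]] k_def a_def h_def)
      finally show ?thesis by (simp add: mult_sgn_abs k_def inner_commute)
    qed (simp add: k_def inner_commute)
    show "integrable lborel (\<lambda>x. indicator (slab 0 \<omega>) x * (sgn (k e) * h e (z e x)))"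
    proof (rule integrable_bounded_support)
      show "\<bar>indicator (slab 0 \<omega>) x * (sgn (k e) * h e (z e x))\<bar> \<le> B" for x
        using B[of "z e x"] by (auto simp: indicator_def abs_mult sgn_if)
      fix x assume "indicator (slab 0 \<omega>) x * (sgn (k e) * h e (z e x)) \<noteq> 0"
      then have "x \<in> slab 0 \<omega>" "h e (z e x) \<noteq> 0" by (auto simp: indicator_def split: if_splits)
      moreover have "z e x = x + (- (\<nu> e \<bullet> (x - a e)) / k e) *\<^sub>R \<omega>" by (simp add: z_def oblique_proj_def k_def)
      ultimately show "norm x \<le> R + (norm \<omega> * (R + norm (0::'a)) + 1) * norm \<omega>"
        using slab_line_bound(2)[OF \<omega>\<omega>] R by metis
    qed measurable
  qed
  have "(LINT x:K|lborel. g x) = (LINT x|lborel. indicator K x * g x)" by (simp add: set_lebesgue_integral_def)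
  also have "\<dots> = (LINT x|lborel. indicator (slab 0 \<omega>) x * (LINT t|lborel. indicator K (x + t *\<^sub>R \<omega>) * g (x + t *\<^sub>R \<omega>)))"
  proof (rule integral_by_lines)
    show "\<bar>indicator K x * g x\<bar> \<le> max Bg 0" for x using Bg[of x] by (auto simp: indicator_def)
    show "norm x \<le> RK" if "indicator K x * g x \<noteq> 0" for x using that RK by (auto simp: indicator_def split: if_splits)
  qed (use \<omega>\<omega> in auto)
  also have "\<dots> = (LINT x|lborel. (\<Sum>e\<in>E. indicator (slab 0 \<omega>) x * (sgn (k e) * h e (z e x))))"
  proof (rule integral_cong_AE)
    show "AE x in lborel. indicator (slab 0 \<omega>) x * (LINT t|lborel. indicator K (x + t *\<^sub>R \<omega>) * g (x + t *\<^sub>R \<omega>))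
        = (\<Sum>e\<in>E. indicator (slab 0 \<omega>) x * (sgn (k e) * h e (z e x)))"
      using good by eventually_elim (simp add: line sum_distrib_left)
    show "(\<lambda>x. \<Sum>e\<in>E. indicator (slab 0 \<omega>) x * (sgn (k e) * h e (z e x))) \<in> borel_measurable lborel"
      using int by (intro borel_measurable_sum) auto
  qed measurable
  also have "\<dots> = (\<Sum>e\<in>E. LINT x|lborel. indicator (slab 0 \<omega>) x * (sgn (k e) * h e (z e x)))"
    by (intro Bochner_Integration.integral_sum int)
  also have "\<dots> = (\<Sum>e\<in>E. (\<omega> \<bullet> \<nu> e) * face_integral e (\<nu> e) f)" by (intro sum.cong refl face)
  finally show ?thesis .
qed

section \<open>Integrals over elements and faces\<close>

text \<open>Pointwise scalar multiplication, next to the pointwise addition of functions, turns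
  \<open>Vh\<close> into a subspace, so that the results on symmetric forms apply to it.\<close>

instantiation "fun" :: (type, real_vector) real_vector
begin

definition scaleR_fun_def: "scaleR r f = (\<lambda>x. r *\<^sub>R f x)"

instance
  by standard (auto simp: scaleR_fun_def fun_eq_iff scaleR_add_right scaleR_add_left)

end

lemma scaleR_fun_apply [simp]: "(r *\<^sub>R f) x = r *\<^sub>R f x"
  by (simp add: scaleR_fun_def)

lemma sum_fun_apply: "(\<Sum>i\<in>I. f i) x = (\<Sum>i\<in>I. f i x)"
  for f :: "'i \<Rightarrow> 'a \<Rightarrow> 'b::comm_monoid_add"
  by (induction I rule: infinite_finite_induct) auto

lemma AE_imp_ex_in_open:
  fixes S :: "'a::euclidean_space set"
  assumes "AE x in lborel. P x" "open S" "S \<noteq> {}"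
  shows "\<exists>x\<in>S. P x"
proof (rule ccontr)
  assume "\<not> ?thesis"
  then have "AE x in lborel. x \<notin> S" using assms(1) by (auto elim: eventually_mono)
  then have "S \<in> null_sets lborel" using assms(2) AE_iff_null_sets[of S lborel] by simp
  then have "negligible S" using negligible_iff_null_sets null_sets_completionI by blast
  then show False using open_not_negligible assms by blast
qed

lemma set_integrable_bounded_continuous:
  fixes f :: "'a::euclidean_space \<Rightarrow> real"
  assumes f: "continuous_on UNIV f" and K: "bounded K" "K \<in> sets borel"
  shows "set_integrable lborel K f"
proof -
  have [measurable]: "f \<in> borel_measurable borel" "K \<in> sets borel" using f K by (auto intro: borel_measurable_continuous_onI)
  obtain B where B: "\<And>x. x \<in> K \<Longrightarrow> \<bar>f x\<bar> \<le> B" by (rule continuous_on_bounded_bound[OF f K(1)]) blast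
  obtain R where R: "\<And>x. x \<in> K \<Longrightarrow> norm x \<le> R" using K by (auto simp: bounded_iff)
  show ?thesis unfolding set_integrable_def
  proof (rule integrable_bounded_support)
    show "\<bar>indicator K x *\<^sub>R f x\<bar> \<le> max B 0" for x using B[of x] by (auto simp: indicator_def)
    show "norm x \<le> R" if "indicator K x *\<^sub>R f x \<noteq> 0" for x
      using R that by (auto simp: indicator_def split: if_splits)
  qed measurable
qed

lemma set_integral_add_continuous:
  fixes f g :: "'a::euclidean_space \<Rightarrow> real"
  assumes "continuous_on UNIV f" "continuous_on UNIV g" "bounded K" "K \<in> sets borel"
  shows "(LINT x:K|lborel. f x + g x) = (LINT x:K|lborel. f x) + (LINT x:K|lborel. g x)"
  using assms by (intro set_integral_add set_integrable_bounded_continuous)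

lemma set_integral_continuous_eq_0:
  fixes f :: "'a::euclidean_space \<Rightarrow> real"
  assumes f: "continuous_on UNIV f" and K: "bounded K" "open K"
    and nn: "\<And>x. x \<in> K \<Longrightarrow> 0 \<le> f x" and 0: "(LINT x:K|lborel. f x) = 0" and x: "x \<in> K"
  shows "f x = 0"
proof (rule ccontr)
  assume "f x \<noteq> 0"
  have "integrable lborel (\<lambda>x. indicator K x *\<^sub>R f x)"
    using set_integrable_bounded_continuous[OF f K(1)] K(2) by (simp add: set_integrable_def)
  then have "AE x in lborel. indicator K x *\<^sub>R f x = 0"
    using integral_nonneg_eq_0_iff_AE[of lborel "\<lambda>x. indicator K x *\<^sub>R f x"] nn 0
    by (auto simp: set_lebesgue_integral_def indicator_def)
  moreover have "open (K \<inter> f -` (- {0}))"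
    by (intro continuous_open_preimage[OF continuous_on_subset[OF f subset_UNIV] K(2)]) auto
  moreover have "K \<inter> f -` (- {0}) \<noteq> {}" using x \<open>f x \<noteq> 0\<close> by auto
  ultimately have "\<exists>x\<in>K \<inter> f -` (- {0}). indicator K x *\<^sub>R f x = 0" by (rule AE_imp_ex_in_open)
  then show False by (auto simp: indicator_def)
qed

lemma affine_hull_polytope_face:
  fixes e :: "'a::euclidean_space set"
  assumes e: "polytope_face e" and n: "outward_unit_normal K e n" and a: "a \<in> e"
  shows "affine hull e = {x. n \<bullet> x = n \<bullet> a}"
proof (rule affine_dim_equal)
  have "n \<bullet> x = n \<bullet> a" if "x \<in> e" for x
  proof -
    have "n \<bullet> (x - a) = 0" using n a that unfolding outward_unit_normal_def by blast
    then show ?thesis by (simp add: inner_diff_right)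
  qed
  then have "e \<subseteq> {x. n \<bullet> x = n \<bullet> a}" by blast
  then show "affine hull e \<subseteq> {x. n \<bullet> x = n \<bullet> a}" by (simp add: affine_hyperplane hull_minimal)
  have "n \<noteq> 0" using n by (auto simp: outward_unit_normal_def)
  then show "aff_dim (affine hull e) = aff_dim {x. n \<bullet> x = n \<bullet> a}"
    using e by (simp add: polytope_face_def aff_dim_hyperplane)
  show "affine hull e \<noteq> {}" using a by (metis empty_iff hull_inc)
qed (rule affine_affine_hull affine_hyperplane)+

context
  fixes K e :: "'a::euclidean_space set" and n :: 'a
  assumes e: "polytope_face e" and n: "outward_unit_normal K e n"
begin

private lemma ne: "e \<noteq> {}" using e by (auto simp: polytope_face_def open_polytope_def)

private lemma nn: "n \<bullet> n = 1" using n by (simp add: outward_unit_normal_def dot_square_norm)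

private abbreviation (input) "base \<equiv> SOME a. a \<in> e"

private abbreviation (input) "integrand f x \<equiv>
  indicator (slab base n) x * (indicator e (oblique_proj base n n x) * f (oblique_proj base n n x) :: real)"

lemma face_integral_integrable:
  assumes f: "continuous_on UNIV f"
  shows "integrable lborel (\<lambda>x. integrand f x)"
proof -
  have [measurable]: "e \<in> sets borel" "f \<in> borel_measurable borel"
    using polytope_face_borel[OF e] f by (auto intro: borel_measurable_continuous_onI)
  have b: "bounded e" by (rule polytope_face_bounded[OF e])
  obtain B where B: "\<And>x. x \<in> e \<Longrightarrow> \<bar>f x\<bar> \<le> B" by (rule continuous_on_bounded_bound[OF f b]) blast
  obtain R where R: "\<And>x. x \<in> e \<Longrightarrow> norm x \<le> R" using b by (auto simp: bounded_iff)
  show ?thesis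
  proof (rule integrable_bounded_support)
    show "\<bar>integrand f x\<bar> \<le> max B 0" for x
      using B[of "oblique_proj base n n x"] by (auto simp: indicator_def)
    fix x assume "integrand f x \<noteq> 0"
    then have x: "x \<in> slab base n" "oblique_proj base n n x \<in> e" by (auto simp: indicator_def split: if_splits)
    have "x + (- (n \<bullet> (x - base))) *\<^sub>R n = oblique_proj base n n x" by (simp add: oblique_proj_def nn)
    with x show "norm x \<le> R + (norm n * (R + norm base) + 1) * norm n"
      using slab_line_bound(2)[OF nn x(1)] R by metis
  qed measurable
qed

lemma face_integral_add:
  assumes "continuous_on UNIV f" "continuous_on UNIV g"
  shows "face_integral e n (\<lambda>x. f x + g x) = face_integral e n f + face_integral e n g"
  unfolding face_integral_eq[OF n ne]
  using Bochner_Integration.integral_add[OF face_integral_integrable[OF assms(1)] face_integral_integrable[OF assms(2)]]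
  by (simp add: distrib_left)

lemma face_integral_scale: "face_integral e n (\<lambda>x. c * f x) = c * face_integral e n f"
  unfolding face_integral_eq[OF n ne]
  by (simp add: mult.left_commute[of _ c])

lemma face_integral_cong: "(\<And>x. x \<in> e \<Longrightarrow> f x = g x) \<Longrightarrow> face_integral e n f = face_integral e n g"
  unfolding face_integral_eq[OF n ne]
  by (intro Bochner_Integration.integral_cong) (auto simp: indicator_def)

lemma face_integral_nonneg:
  assumes "\<And>x. x \<in> e \<Longrightarrow> 0 \<le> f x" shows "0 \<le> face_integral e n f"
  unfolding face_integral_eq[OF n ne]
  using assms by (intro Bochner_Integration.integral_nonneg) (auto simp: indicator_def)

text \<open>The face itself is a null set, so the argument takes place in the prism. If
  \<open>f x\<close> is nonzero, the points strictly between the two ends that project to points of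
  \<open>e\<close> where \<open>f\<close> is nonzero form an open set, and \<open>x\<close> lifted
  by height 1/2 belongs to it.\<close>

lemma face_integral_eq_0:
  assumes f: "continuous_on UNIV f" and nonneg: "\<And>x. x \<in> e \<Longrightarrow> 0 \<le> f x"
    and 0: "face_integral e n f = 0" and x: "x \<in> e"
  shows "f x = 0"
proof (rule ccontr)
  assume "f x \<noteq> 0"
  have base: "base \<in> e" by (rule prism_iff(3)[OF n ne])
  have "e = rel_interior (closure e)" using e by (auto simp: polytope_face_def open_polytope_def)
  then have "openin (top_of_set (affine hull e)) e" using openin_rel_interior[of "closure e"] by simp
  then obtain T where T: "open T" "e = affine hull e \<inter> T" by (auto simp: openin_open)
  have e_iff: "z \<in> e \<longleftrightarrow> n \<bullet> z = n \<bullet> base \<and> z \<in> T" for z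
    using T(2) affine_hull_polytope_face[OF e n base] by blast
  have proj: "oblique_proj base n n y \<in> e \<longleftrightarrow> oblique_proj base n n y \<in> T" for y
    unfolding e_iff[of "oblique_proj base n n y"] by (simp add: oblique_proj_def nn inner_diff_right)
  have cont: "continuous_on UNIV (oblique_proj base n n)"
    unfolding oblique_proj_def[abs_def] nn by (intro continuous_intros) simp
  define S where "S = {y. n \<bullet> y > n \<bullet> base} \<inter> {y. n \<bullet> y < n \<bullet> base + 1}
     \<inter> oblique_proj base n n -` (T \<inter> f -` (- {0}))"
  have "AE y in lborel. integrand f y = 0"
    using integral_nonneg_eq_0_iff_AE[OF face_integral_integrable[OF f]] nonneg 0
    unfolding face_integral_eq[OF n ne] by (auto simp: indicator_def)
  moreover have "open S" unfolding S_def
    using continuous_on_open_vimage[of UNIV] cont f T(1)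
    by (intro open_Int open_halfspace_gt open_halfspace_lt open_vimage) auto
  moreover have "x + (1/2) *\<^sub>R n \<in> S"
  proof -
    have "n \<bullet> x = n \<bullet> base" "x \<in> T" using x e_iff[of x] by auto
    then show ?thesis using \<open>f x \<noteq> 0\<close>
      by (simp add: S_def oblique_proj_def nn inner_add_right inner_diff_right)
  qed
  ultimately obtain y where y: "y \<in> S" "integrand f y = 0" using AE_imp_ex_in_open by blast
  have "y \<in> slab base n" using y(1) by (auto simp: S_def slab_def inner_diff_right)
  moreover have "oblique_proj base n n y \<in> e" "f (oblique_proj base n n y) \<noteq> 0"
    using y(1) by (auto simp: proj) (auto simp: S_def)
  ultimately show False using y(2) by simp
qed

text \<open>The prism in direction \<open>- n\<close> is the prism in direction \<open>n\<close>
  translated by \<open>- n\<close>. The two elements at an interior face see opposite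
  normals.\<close>

lemma face_integral_uminus:
  assumes n': "outward_unit_normal K' e (- n)" and f: "continuous_on UNIV f"
  shows "face_integral e (- n) f = face_integral e n f"
proof -
  have [measurable]: "e \<in> sets borel" "f \<in> borel_measurable borel"
    using polytope_face_borel[OF e] f by (auto intro: borel_measurable_continuous_onI)
  have "(\<lambda>x. integrand f x) \<in> borel_measurable borel" by measurable
  from lborel_integral_translate[OF this, of n]
  have "(LINT x|lborel. integrand f x) = (LINT x|lborel. integrand f (x + n))" by simp
  moreover have "oblique_proj base n n (x + n) = oblique_proj base n n x" for x
    using oblique_proj_line[of n n base x 1] nn by simp
  moreover have "oblique_proj base (- n) (- n) x = oblique_proj base n n x" for x
    by (simp add: oblique_proj_def)
  moreover have "x + n \<in> slab base n \<longleftrightarrow> x \<in> slab base (- n)" for x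
    using nn by (auto simp: slab_def inner_diff_right inner_add_right)
  then have "indicator (slab base n) (x + n) = (indicator (slab base (- n)) x :: real)" for x
    by (simp add: indicator_def)
  ultimately show ?thesis
    unfolding face_integral_eq[OF n ne] face_integral_eq[OF n' ne] by simp
qed

end

section \<open>The upwind transport form\<close>

locale polytopal_mesh =
  fixes M :: "'d::finite mesh" and p :: nat
  assumes mesh: "transport_mesh M"
begin

abbreviation (input) "V \<equiv> Vh M p"

lemma finite_elems: "finite (elems M)"
  and elem_lipschitz: "K \<in> elems M \<Longrightarrow> lipschitz_polytope K"
  and disjoint_elems: "pairwise disjnt (elems M)"
  and elems_subset: "\<Union>(elems M) \<subseteq> Omega M"
  and closure_Omega: "closure (Omega M) = (\<Union>K\<in>elems M. closure K)"
  and finite_elem_faces: "K \<in> elems M \<Longrightarrow> finite (elem_faces M K)"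
  and elem_face_polytope: "K \<in> elems M \<Longrightarrow> e \<in> elem_faces M K \<Longrightarrow> polytope_face e"
  and frontier_elem: "K \<in> elems M \<Longrightarrow> frontier K = (\<Union>e\<in>elem_faces M K. closure e)"
  using mesh unfolding transport_mesh_def polytopal_partition_def by auto

lemma elem_open: "K \<in> elems M \<Longrightarrow> open K" and elem_bounded: "K \<in> elems M \<Longrightarrow> bounded K"
  using elem_lipschitz[of K] by (simp_all add: lipschitz_polytope_def lipschitz_domain_def)

lemma elem_nonempty: "K \<in> elems M \<Longrightarrow> K \<noteq> {}"
  using elem_lipschitz[of K] unfolding lipschitz_polytope_def open_polytope_def by blast

lemma elem_borel: "K \<in> elems M \<Longrightarrow> K \<in> sets borel"
  by (rule borel_open[OF elem_open])

lemma Omega_nonempty: "Omega M \<noteq> {}"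
  using mesh unfolding transport_mesh_def lipschitz_polytope_def open_polytope_def by blast

lemma elems_nonempty: "elems M \<noteq> {}"
  using closure_Omega Omega_nonempty by auto

lemma elem_eqI: "K \<in> elems M \<Longrightarrow> K' \<in> elems M \<Longrightarrow> x \<in> K \<Longrightarrow> x \<in> K' \<Longrightarrow> K = K'"
  using disjoint_elems unfolding pairwise_def disjnt_def by blast

lemma finite_faces: "finite (faces M)"
  unfolding faces_def using finite_elems finite_elem_faces by auto

lemma elem_face_in_faces: "K \<in> elems M \<Longrightarrow> e \<in> elem_faces M K \<Longrightarrow> e \<in> faces M"
  unfolding faces_def by auto

lemma face_polytope: "e \<in> faces M \<Longrightarrow> polytope_face e"
  unfolding faces_def using elem_face_polytope by auto

lemma face_nonempty: "e \<in> faces M \<Longrightarrow> e \<noteq> {}"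
  using face_polytope unfolding polytope_face_def open_polytope_def by auto

lemma disjoint_faces: "pairwise disjnt (faces M)"
  using mesh unfolding transport_mesh_def face_to_face_def by auto

lemma face_cases:
  assumes "e \<in> faces M"
  obtains (interior) "e \<in> interior_faces M" "plus_elem M e \<noteq> minus_elem M e"
      "adjacent_elems M e = {plus_elem M e, minus_elem M e}"
      "outward_unit_normal (plus_elem M e) e (face_normal M e)"
      "outward_unit_normal (minus_elem M e) e (- face_normal M e)"
  | (boundary) "e \<notin> interior_faces M" "adjacent_elems M e = {plus_elem M e}"
      "outward_unit_normal (plus_elem M e) e (face_normal M e)"
proof (cases "e \<in> interior_faces M")
  case True
  then have "card (adjacent_elems M e) = 2" "adjacent_elems M e = {plus_elem M e, minus_elem M e}"
    "outward_unit_normal (plus_elem M e) e (face_normal M e)"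
    "outward_unit_normal (minus_elem M e) e (- face_normal M e)"
    using mesh unfolding transport_mesh_def face_to_face_def oriented_faces_def by auto
  moreover from this(1,2) have "plus_elem M e \<noteq> minus_elem M e" by auto
  ultimately show thesis using interior True by blast
next
  case False
  then have "e \<in> boundary_faces M"
    using assms mesh unfolding transport_mesh_def face_to_face_def by auto
  then show thesis
    using boundary False mesh unfolding transport_mesh_def oriented_faces_def by auto
qed

lemma plus_elem: "e \<in> faces M \<Longrightarrow> plus_elem M e \<in> elems M \<and> e \<in> elem_faces M (plus_elem M e)"
  by (erule face_cases) (auto simp: adjacent_elems_def)

lemma minus_elem: "e \<in> interior_faces M \<Longrightarrow> minus_elem M e \<in> elems M \<and> e \<in> elem_faces M (minus_elem M e)"
proof -
  assume e: "e \<in> interior_faces M"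
  then have "e \<in> faces M" by (simp add: interior_faces_def)
  then show ?thesis by (rule face_cases) (use e in \<open>auto simp: adjacent_elems_def\<close>)
qed

lemma face_normal_outward: "e \<in> faces M \<Longrightarrow> outward_unit_normal (plus_elem M e) e (face_normal M e)"
  by (erule face_cases) auto

lemma adjacent_cases:
  assumes "K \<in> elems M" "e \<in> elem_faces M K"
  shows "K = plus_elem M e \<or> (e \<in> interior_faces M \<and> K = minus_elem M e)"
proof -
  have "K \<in> adjacent_elems M e" using assms by (simp add: adjacent_elems_def)
  with elem_face_in_faces[OF assms] show ?thesis by (elim face_cases) auto
qed

definition elem_normal :: "(real ^ 'd) set \<Rightarrow> (real ^ 'd) set \<Rightarrow> real ^ 'd" where
  "elem_normal K e = (if K = plus_elem M e then face_normal M e else - face_normal M e)"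

lemma elem_normal_outward:
  assumes "K \<in> elems M" "e \<in> elem_faces M K"
  shows "outward_unit_normal K e (elem_normal K e)"
  using elem_face_in_faces[OF assms]
  by (rule face_cases) (use adjacent_cases[OF assms] in \<open>auto simp: elem_normal_def\<close>)

subsection \<open>Local polynomials\<close>

text \<open>The restriction to \<open>K\<close>, continued to the whole space as a polynomial; it is
  unique because an element is open and nonempty. Traces become point evaluations and integrands
  become continuous.\<close>

definition local_poly :: "(real ^ 'd \<Rightarrow> real) \<Rightarrow> (real ^ 'd) set \<Rightarrow> real ^ 'd \<Rightarrow> real" where
  "local_poly u K = (SOME q. q \<in> poly_space p \<and> (\<forall>x\<in>K. u x = q x))"

definition local_deriv :: "(real ^ 'd \<Rightarrow> real) \<Rightarrow> (real ^ 'd) set \<Rightarrow> real ^ 'd \<Rightarrow> real ^ 'd \<Rightarrow> real" where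
  "local_deriv u K \<omega> x = frechet_derivative (local_poly u K) (at x) \<omega>"

lemma local_poly:
  assumes "u \<in> V" "K \<in> elems M"
  shows "local_poly u K \<in> poly_space p" and "x \<in> K \<Longrightarrow> u x = local_poly u K x"
proof -
  have "\<exists>q. q \<in> poly_space p \<and> (\<forall>x\<in>K. u x = q x)" using assms by (auto simp: Vh_def)
  from someI_ex[OF this] show "local_poly u K \<in> poly_space p" "x \<in> K \<Longrightarrow> u x = local_poly u K x"
    unfolding local_poly_def by auto
qed

lemma local_poly_unique:
  assumes "u \<in> V" "K \<in> elems M" "q \<in> poly_space p" "\<And>x. x \<in> K \<Longrightarrow> u x = q x"
  shows "local_poly u K = q"
proof
  fix x
  have "(\<lambda>x. local_poly u K x + (-1) * q x) \<in> poly_space p"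
    by (intro poly_space_add poly_space_scale local_poly(1) assms)
  moreover obtain a where "a \<in> K" using elem_nonempty assms(2) by blast
  moreover have "local_poly u K x + (-1) * q x = 0" if "x \<in> K" for x
    using assms(4) local_poly(2)[OF assms(1,2)] that by simp
  ultimately have "local_poly u K x + (-1) * q x = 0"
    using poly_space_eq_0_if_open elem_open[OF assms(2)] by blast
  then show "local_poly u K x = q x" by simp
qed

lemma subspace_Vh: "subspace V"
proof (rule subspaceI)
  show "0 \<in> V" unfolding Vh_def using poly_space_zero by force
  show "u + v \<in> V" if "u \<in> V" "v \<in> V" for u v
  proof -
    have "\<exists>q\<in>poly_space p. \<forall>x\<in>K. (u + v) x = q x" if K: "K \<in> elems M" for K
      using poly_space_add[OF local_poly(1)[OF \<open>u \<in> V\<close> K] local_poly(1)[OF \<open>v \<in> V\<close> K]]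
        local_poly(2)[OF \<open>u \<in> V\<close> K] local_poly(2)[OF \<open>v \<in> V\<close> K] by force
    then show ?thesis using that by (auto simp: Vh_def)
  qed
  show "c *\<^sub>R u \<in> V" if "u \<in> V" for c u
  proof -
    have "\<exists>q\<in>poly_space p. \<forall>x\<in>K. (c *\<^sub>R u) x = q x" if K: "K \<in> elems M" for K
      using poly_space_scale[OF local_poly(1)[OF \<open>u \<in> V\<close> K], of c]
        local_poly(2)[OF \<open>u \<in> V\<close> K] by force
    then show ?thesis using that by (auto simp: Vh_def)
  qed
qed

lemma local_poly_add:
  assumes "u \<in> V" "v \<in> V" "K \<in> elems M"
  shows "local_poly (u + v) K = (\<lambda>x. local_poly u K x + local_poly v K x)"
  using assms subspace_add[OF subspace_Vh]
  by (intro local_poly_unique poly_space_add local_poly(1)) (auto simp: local_poly(2))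

lemma local_poly_scale:
  assumes "u \<in> V" "K \<in> elems M"
  shows "local_poly (c *\<^sub>R u) K = (\<lambda>x. c * local_poly u K x)"
  using assms subspace_scale[OF subspace_Vh]
  by (intro local_poly_unique poly_space_scale local_poly(1)) (auto simp: local_poly(2))

lemma local_poly_has_derivative:
  assumes "u \<in> V" "K \<in> elems M"
  shows "(local_poly u K has_derivative (\<lambda>\<omega>. local_deriv u K \<omega> x)) (at x)"
  unfolding local_deriv_def using poly_space_frechet(1)[OF local_poly(1)[OF assms]] .

lemma local_deriv_unique:
  assumes "u \<in> V" "K \<in> elems M" "(local_poly u K has_derivative f) (at x)"
  shows "local_deriv u K \<omega> x = f \<omega>"
  unfolding local_deriv_def using frechet_derivative_at[OF assms(3)] by metis

lemma local_deriv_uminus: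
  assumes "u \<in> V" "K \<in> elems M"
  shows "local_deriv u K (- \<omega>) x = - local_deriv u K \<omega> x"
  using has_derivative_linear[OF local_poly_has_derivative[OF assms], of x] by (rule linear_neg)

lemma local_deriv_poly: "u \<in> V \<Longrightarrow> K \<in> elems M \<Longrightarrow> local_deriv u K \<omega> \<in> poly_space p"
  using poly_space_frechet(2)[OF local_poly(1)] unfolding local_deriv_def[abs_def] .

lemma continuous_local_poly: "u \<in> V \<Longrightarrow> K \<in> elems M \<Longrightarrow> continuous_on UNIV (local_poly u K)"
  by (rule poly_space_continuous_on[OF local_poly(1)])

lemma continuous_local_deriv: "u \<in> V \<Longrightarrow> K \<in> elems M \<Longrightarrow> continuous_on UNIV (local_deriv u K \<omega>)"
  by (rule poly_space_continuous_on[OF local_deriv_poly])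

lemma grad_eq:
  assumes "u \<in> V" "K \<in> elems M" "x \<in> K"
  shows "\<omega> \<bullet> grad u x = local_deriv u K \<omega> x"
proof -
  have "(u has_derivative (\<lambda>\<omega>. local_deriv u K \<omega> x)) (at x)"
    using local_poly_has_derivative[OF assms(1,2)] elem_open[OF assms(2)] assms(3)
    by (rule has_derivative_transform_within_open) (simp add: local_poly(2)[OF assms(1,2)])
  then have "frechet_derivative u (at x) = (\<lambda>\<omega>. local_deriv u K \<omega> x)"
    by (rule frechet_derivative_at[symmetric])
  note lin = has_derivative_linear[OF local_poly_has_derivative[OF assms(1,2)], of x]
  from \<open>frechet_derivative u (at x) = _\<close> have "\<omega> \<bullet> grad u x = (\<Sum>i\<in>UNIV. \<omega> $ i * local_deriv u K (axis i 1) x)"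
    by (simp add: inner_vec_def grad_def)
  also have "\<dots> = local_deriv u K (\<Sum>i\<in>UNIV. \<omega> $ i *\<^sub>R axis i 1) x"
    by (simp add: linear_sum[OF lin] linear_scale[OF lin])
  also have "(\<Sum>i\<in>UNIV. \<omega> $ i *\<^sub>R axis i 1) = \<omega>"
    using basis_expansion[of \<omega>] by (simp add: scalar_mult_eq_scaleR)
  finally show ?thesis .
qed

text \<open>A point of a face is in the closure of the open set \<open>K\<close> but not in
  \<open>K\<close>, hence a limit point of \<open>K\<close>; this is what determines the
  \<open>Lim\<close> in the trace.\<close>

lemma elem_trace_eq:
  assumes u: "u \<in> V" and K: "K \<in> elems M" "e \<in> elem_faces M K" and x: "x \<in> e"
  shows "elem_trace K u x = local_poly u K x"
proof -
  have "x \<in> frontier K" using frontier_elem[OF K(1)] K(2) x closure_subset by blast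
  then have "x \<in> closure K" "x \<notin> K" using elem_open[OF K(1)] by (auto simp: frontier_def interior_open)
  then have "x islimpt K" by (auto simp: closure_def)
  then have nt: "at x within K \<noteq> bot" by (simp add: trivial_limit_within)
  have "(local_poly u K \<longlongrightarrow> local_poly u K x) (at x within K)"
    using continuous_local_poly[OF u K(1)] by (meson UNIV_I continuous_on_def tendsto_within_subset subset_UNIV)
  then have "(u \<longlongrightarrow> local_poly u K x) (at x within K)"
    by (rule Lim_transform_within[OF _ zero_less_one]) (simp add: local_poly(2)[OF u K(1)])
  then show ?thesis unfolding elem_trace_def by (rule tendsto_Lim[OF nt])
qed

lemma l2_inner_elem:
  assumes "\<And>x. x \<in> K \<Longrightarrow> f x = f' x" "\<And>x. x \<in> K \<Longrightarrow> g x = g' x" "K \<in> sets borel"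
  shows "l2_inner K f g = (LINT x:K|lborel. f' x * g' x)"
  unfolding l2_inner_def by (rule set_lebesgue_integral_cong) (use assms in auto)

text \<open>Members of \<open>Vh\<close> vanish off the elements by convention, so the skeleton
  drops out pointwise and not merely as a null set.\<close>

lemma l2_inner_Omega:
  assumes "u \<in> V" "v \<in> V"
  shows "l2_inner (Omega M) u v = (\<Sum>K\<in>elems M. LINT x:K|lborel. local_poly u K x * local_poly v K x)"
proof -
  have "indicator (Omega M) x * (u x * v x) = (\<Sum>K\<in>elems M. indicator K x * (local_poly u K x * local_poly v K x))" for x
  proof (cases "x \<in> \<Union>(elems M)")
    case True
    then obtain K where K: "K \<in> elems M" "x \<in> K" by blast
    then have "x \<in> Omega M" using elems_subset by blast
    have "(\<Sum>K\<in>elems M. indicator K x * (local_poly u K x * local_poly v K x))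
        = (\<Sum>K'\<in>elems M. if K' = K then local_poly u K x * local_poly v K x else 0)"
      by (intro sum.cong) (use K elem_eqI in \<open>auto simp: indicator_def\<close>)
    also have "\<dots> = u x * v x"
      using K finite_elems local_poly(2)[OF assms(1) K] local_poly(2)[OF assms(2) K] by simp
    finally show ?thesis using \<open>x \<in> Omega M\<close> by simp
  next
    case False
    then have "u x = 0" using assms(1) unfolding Vh_def by blast
    then show ?thesis using False by (auto simp: indicator_def intro!: sum.neutral)
  qed
  then have "l2_inner (Omega M) u v = (LINT x|lborel. (\<Sum>K\<in>elems M. indicator K x * (local_poly u K x * local_poly v K x)))"
    by (simp add: l2_inner_def set_lebesgue_integral_def)
  also have "\<dots> = (\<Sum>K\<in>elems M. LINT x|lborel. indicator K x * (local_poly u K x * local_poly v K x))"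
  proof (rule Bochner_Integration.integral_sum)
    fix K assume K: "K \<in> elems M"
    then have "set_integrable lborel K (\<lambda>x. local_poly u K x * local_poly v K x)"
      using assms by (intro set_integrable_bounded_continuous continuous_on_mult continuous_local_poly elem_bounded elem_borel)
    then show "integrable lborel (\<lambda>x. indicator K x * (local_poly u K x * local_poly v K x))"
      by (simp add: set_integrable_def)
  qed
  finally show ?thesis by (simp add: set_lebesgue_integral_def)
qed

subsection \<open>The transport form\<close>

abbreviation (input) "face_int e \<equiv> face_integral e (face_normal M e)"

definition plus_poly :: "(real ^ 'd) set \<Rightarrow> (real ^ 'd \<Rightarrow> real) \<Rightarrow> real ^ 'd \<Rightarrow> real" where
  "plus_poly e u = local_poly u (plus_elem M e)"

definition minus_poly :: "(real ^ 'd) set \<Rightarrow> (real ^ 'd \<Rightarrow> real) \<Rightarrow> real ^ 'd \<Rightarrow> real" where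
  "minus_poly e u = (if e \<in> interior_faces M then local_poly u (minus_elem M e) else (\<lambda>x. 0))"

definition upwind_poly :: "real ^ 'd \<Rightarrow> (real ^ 'd) set \<Rightarrow> (real ^ 'd \<Rightarrow> real) \<Rightarrow> real ^ 'd \<Rightarrow> real" where
  "upwind_poly \<omega> e u = (if \<omega> \<bullet> face_normal M e \<ge> 0 then plus_poly e u else minus_poly e u)"

abbreviation (input) "volume_term \<omega> u v \<equiv> \<Sum>K\<in>elems M. LINT x:K|lborel. local_poly u K x * local_deriv v K \<omega> x"
abbreviation (input) "face_jump e u x \<equiv> plus_poly e u x - minus_poly e u x"
abbreviation (input) "upwind_flux \<omega> e u v \<equiv> face_int e (\<lambda>x. upwind_poly \<omega> e u x * face_jump e v x)"
abbreviation (input) "product_jump e u v x \<equiv> plus_poly e u x * plus_poly e v x - minus_poly e u x * minus_poly e v x"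

lemma face_poly_continuous:
  assumes "u \<in> V" "e \<in> faces M"
  shows "continuous_on UNIV (plus_poly e u)" "continuous_on UNIV (minus_poly e u)" "continuous_on UNIV (upwind_poly \<omega> e u)"
  using assms plus_elem[of e] minus_elem[of e] continuous_local_poly
  by (auto simp: plus_poly_def minus_poly_def upwind_poly_def)

lemma plus_poly_add: "u \<in> V \<Longrightarrow> v \<in> V \<Longrightarrow> e \<in> faces M \<Longrightarrow> plus_poly e (u + v) x = plus_poly e u x + plus_poly e v x"
  and minus_poly_add: "u \<in> V \<Longrightarrow> v \<in> V \<Longrightarrow> e \<in> faces M \<Longrightarrow> minus_poly e (u + v) x = minus_poly e u x + minus_poly e v x"
  and plus_poly_scale: "u \<in> V \<Longrightarrow> e \<in> faces M \<Longrightarrow> plus_poly e (c *\<^sub>R u) x = c * plus_poly e u x"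
  and minus_poly_scale: "u \<in> V \<Longrightarrow> e \<in> faces M \<Longrightarrow> minus_poly e (c *\<^sub>R u) x = c * minus_poly e u x"
  using plus_elem[of e] minus_elem[of e]
  by (auto simp: plus_poly_def minus_poly_def local_poly_add local_poly_scale)

lemma traces_eq:
  assumes "u \<in> V" "e \<in> faces M" "x \<in> e"
  shows "plus_trace M e u x = plus_poly e u x" "minus_trace M e u x = minus_poly e u x"
    "upwind M \<omega> e u x = upwind_poly \<omega> e u x" "jump M e u x = plus_poly e u x - minus_poly e u x"
  using assms plus_elem[of e] minus_elem[of e] elem_trace_eq[OF assms(1) _ _ assms(3)]
  by (auto simp: plus_trace_def minus_trace_def plus_poly_def minus_poly_def upwind_poly_def upwind_def jump_def)

definition transport_form :: "real \<Rightarrow> real ^ 'd \<Rightarrow> (real ^ 'd \<Rightarrow> real) \<Rightarrow> (real ^ 'd \<Rightarrow> real) \<Rightarrow> real" where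
  "transport_form s \<omega> u v =
     - (volume_term \<omega> u v)
     + (\<Sum>e\<in>faces M. (\<omega> \<bullet> face_normal M e) * upwind_flux \<omega> e u v)
     + s * l2_inner (Omega M) u v"

text \<open>On \<open>Vh\<close> all traces, jumps and gradients are those of the local polynomials;
  after this step \<open>Lim\<close> and \<open>grad\<close> no longer occur.\<close>

lemma bform_eq:
  assumes "u \<in> V" "v \<in> V"
  shows "bform M Q st \<epsilon> m u v = transport_form (sigma_t st \<epsilon>) (dir Q m) u v"
proof -
  have "l2_inner K u (\<lambda>x. dir Q m \<bullet> grad v x) = (LINT x:K|lborel. local_poly u K x * local_deriv v K (dir Q m) x)"
    if "K \<in> elems M" for K
    by (intro l2_inner_elem local_poly(2) grad_eq assms that elem_borel)
  moreover have "face_inner e (face_normal M e) (\<lambda>x. (dir Q m \<bullet> face_normal M e) * upwind M (dir Q m) e u x) (jump M e v)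
      = (dir Q m \<bullet> face_normal M e) * upwind_flux (dir Q m) e u v"
    if e: "e \<in> faces M" for e
  proof -
    note f = face_polytope[OF e] face_normal_outward[OF e]
    have "face_inner e (face_normal M e) (\<lambda>x. (dir Q m \<bullet> face_normal M e) * upwind M (dir Q m) e u x) (jump M e v)
      = face_int e (\<lambda>x. (dir Q m \<bullet> face_normal M e) * upwind M (dir Q m) e u x * jump M e v x)"
      by (simp add: face_inner_def face_integral_def)
    also have "\<dots> = face_int e (\<lambda>x. (dir Q m \<bullet> face_normal M e) * (upwind_poly (dir Q m) e u x * (face_jump e v x)))"
      by (rule face_integral_cong[OF f]) (simp add: traces_eq[OF assms(1) e] traces_eq[OF assms(2) e] mult.assoc)
    also have "\<dots> = (dir Q m \<bullet> face_normal M e) * upwind_flux (dir Q m) e u v"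
      by (rule face_integral_scale[OF f])
    finally show ?thesis .
  qed
  moreover have "l2_inner (Omega M) (\<lambda>x. sigma_t st \<epsilon> * u x) v = sigma_t st \<epsilon> * l2_inner (Omega M) u v"
    by (simp add: l2_inner_def mult.assoc)
  ultimately show ?thesis unfolding bform_def transport_form_def by simp
qed

text \<open>The divergence theorem for the product of the two local polynomials, combined with the
  product rule.\<close>

lemma elem_integration_by_parts:
  assumes K: "K \<in> elems M" and u: "u \<in> V" and v: "v \<in> V" and \<omega>: "norm \<omega> = 1"
  shows "(LINT x:K|lborel. local_poly u K x * local_deriv v K \<omega> x) + (LINT x:K|lborel. local_poly v K x * local_deriv u K \<omega> x)
    = (\<Sum>e\<in>elem_faces M K. (\<omega> \<bullet> elem_normal K e) * face_integral e (elem_normal K e) (\<lambda>x. local_poly u K x * local_poly v K x))"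
proof -
  note c = continuous_local_poly[OF u K] continuous_local_poly[OF v K] continuous_local_deriv[OF u K] continuous_local_deriv[OF v K]
  have "(LINT x:K|lborel. local_poly u K x * local_deriv v K \<omega> x) + (LINT x:K|lborel. local_poly v K x * local_deriv u K \<omega> x)
      = (LINT x:K|lborel. local_poly u K x * local_deriv v K \<omega> x + local_poly v K x * local_deriv u K \<omega> x)"
    by (intro set_integral_add_continuous[symmetric] continuous_on_mult c elem_bounded elem_borel K)
  also have "\<dots> = (\<Sum>e\<in>elem_faces M K. (\<omega> \<bullet> elem_normal K e) * face_integral e (elem_normal K e) (\<lambda>x. local_poly u K x * local_poly v K x))"
  proof (rule directional_divergence)
    show "pairwise disjnt (elem_faces M K)"
      using disjoint_faces by (rule pairwise_subset) (use elem_face_in_faces[OF K] in blast)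
    fix x t
    have l: "((\<lambda>t. x + t *\<^sub>R \<omega>) has_derivative (\<lambda>h. h *\<^sub>R \<omega>)) (at t)"
      by (auto intro!: derivative_eq_intros)
    have d: "((\<lambda>t. local_poly w K (x + t *\<^sub>R \<omega>)) has_real_derivative local_deriv w K \<omega> (x + t *\<^sub>R \<omega>)) (at t)" if w: "w \<in> V" for w
    proof -
      have "((\<lambda>t. local_poly w K (x + t *\<^sub>R \<omega>)) has_derivative (\<lambda>h. local_deriv w K (h *\<^sub>R \<omega>) (x + t *\<^sub>R \<omega>))) (at t)"
        using has_derivative_compose[OF l local_poly_has_derivative[OF w K]] .
      moreover have "local_deriv w K (h *\<^sub>R \<omega>) y = local_deriv w K \<omega> y * h" for h y
        using linear_scale[OF has_derivative_linear[OF local_poly_has_derivative[OF w K]]] by simp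
      ultimately show ?thesis by (simp add: has_field_derivative_def)
    qed
    show "((\<lambda>t. local_poly u K (x + t *\<^sub>R \<omega>) * local_poly v K (x + t *\<^sub>R \<omega>)) has_real_derivative
       local_poly u K (x + t *\<^sub>R \<omega>) * local_deriv v K \<omega> (x + t *\<^sub>R \<omega>)
       + local_poly v K (x + t *\<^sub>R \<omega>) * local_deriv u K \<omega> (x + t *\<^sub>R \<omega>)) (at t)"
      using DERIV_mult[OF d[OF u] d[OF v]] by (simp add: algebra_simps)
    show "continuous_on UNIV (\<lambda>x. local_poly u K x * local_deriv v K \<omega> x + local_poly v K x * local_deriv u K \<omega> x)"
      "continuous_on UNIV (\<lambda>x. local_poly u K x * local_poly v K x)"
      by (intro continuous_on_add continuous_on_mult c)+
  qed (use K \<omega> elem_open elem_bounded finite_elem_faces elem_face_polytope frontier_elem elem_normal_outward in auto)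
  finally show ?thesis .
qed

lemma sum_elem_faces_swap:
  "(\<Sum>K\<in>elems M. \<Sum>e\<in>elem_faces M K. \<phi> K e) = (\<Sum>e\<in>faces M. \<Sum>K\<in>adjacent_elems M e. \<phi> K e)"
proof -
  have "elem_faces M K = {e \<in> faces M. e \<in> elem_faces M K}" if "K \<in> elems M" for K
    using elem_face_in_faces[OF that] by blast
  then have "(\<Sum>K\<in>elems M. \<Sum>e\<in>elem_faces M K. \<phi> K e) = (\<Sum>K\<in>elems M. \<Sum>e | e \<in> faces M \<and> e \<in> elem_faces M K. \<phi> K e)"
    by (intro sum.cong) auto
  also have "\<dots> = (\<Sum>e\<in>faces M. \<Sum>K | K \<in> elems M \<and> e \<in> elem_faces M K. \<phi> K e)"
    by (rule sum.swap_restrict[OF finite_elems finite_faces])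
  finally show ?thesis by (simp add: adjacent_elems_def)
qed

text \<open>Each interior face is counted from both sides with opposite normals, which produces the
  jump of the product of \<open>u\<close> and \<open>v\<close>; on a boundary face the exterior term
  is zero.\<close>

lemma integration_by_parts:
  assumes u: "u \<in> V" and v: "v \<in> V" and \<omega>: "norm \<omega> = 1"
  shows "(volume_term \<omega> u v)
       + (volume_term \<omega> v u)
    = (\<Sum>e\<in>faces M. (\<omega> \<bullet> face_normal M e) * face_int e (\<lambda>x. product_jump e u v x))"
proof -
  define \<phi> where "\<phi> K e = (\<omega> \<bullet> elem_normal K e) * face_integral e (elem_normal K e) (\<lambda>x. local_poly u K x * local_poly v K x)" for K e
  have "(volume_term \<omega> u v)
       + (volume_term \<omega> v u) = (\<Sum>K\<in>elems M. \<Sum>e\<in>elem_faces M K. \<phi> K e)"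
    unfolding sum.distrib[symmetric] \<phi>_def by (intro sum.cong refl elem_integration_by_parts u v \<omega>)
  also have "\<dots> = (\<Sum>e\<in>faces M. \<Sum>K\<in>adjacent_elems M e. \<phi> K e)" by (rule sum_elem_faces_swap)
  also have "\<dots> = (\<Sum>e\<in>faces M. (\<omega> \<bullet> face_normal M e) * face_int e (\<lambda>x. product_jump e u v x))"
  proof (rule sum.cong[OF refl])
    fix e assume e: "e \<in> faces M"
    note f = face_polytope[OF e] face_normal_outward[OF e]
    note c = face_poly_continuous[OF u e] face_poly_continuous[OF v e]
    have diff: "face_int e (\<lambda>x. product_jump e u v x)
       = face_int e (\<lambda>x. plus_poly e u x * plus_poly e v x) - face_int e (\<lambda>x. minus_poly e u x * minus_poly e v x)"
      using face_integral_add[OF f, of "\<lambda>x. plus_poly e u x * plus_poly e v x" "\<lambda>x. (-1) * (minus_poly e u x * minus_poly e v x)"] c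
        face_integral_scale[OF f, of "-1" "\<lambda>x. minus_poly e u x * minus_poly e v x"]
      by (simp add: continuous_on_mult continuous_on_minus)
    have plus: "\<phi> (plus_elem M e) e = (\<omega> \<bullet> face_normal M e) * face_int e (\<lambda>x. plus_poly e u x * plus_poly e v x)"
      by (simp add: \<phi>_def elem_normal_def plus_poly_def)
    show "(\<Sum>K\<in>adjacent_elems M e. \<phi> K e) = (\<omega> \<bullet> face_normal M e) * face_int e (\<lambda>x. product_jump e u v x)"
      using e
    proof (cases rule: face_cases)
      case interior
      have "face_integral e (- face_normal M e) (\<lambda>x. local_poly u (minus_elem M e) x * local_poly v (minus_elem M e) x)
          = face_int e (\<lambda>x. minus_poly e u x * minus_poly e v x)"
        using face_integral_uminus[OF f interior(5)] c interior(1) by (simp add: minus_poly_def continuous_on_mult)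
      then have "\<phi> (minus_elem M e) e = - (\<omega> \<bullet> face_normal M e) * face_int e (\<lambda>x. minus_poly e u x * minus_poly e v x)"
        using interior(2) by (simp add: \<phi>_def elem_normal_def)
      then show ?thesis using interior(2,3) plus by (simp add: diff algebra_simps)
    next
      case boundary
      then show ?thesis using plus by (simp add: minus_poly_def)
    qed
  qed
  finally show ?thesis .
qed

lemma face_int_add:
  assumes "e \<in> faces M" "continuous_on UNIV f" "continuous_on UNIV g"
  shows "face_int e (\<lambda>x. f x + g x) = face_int e f + face_int e g"
  by (rule face_integral_add[OF face_polytope face_normal_outward]) (use assms in auto)

lemma transport_form_adjoint:
  assumes u: "u \<in> V" and v: "v \<in> V" and \<omega>: "norm \<omega> = 1"
  shows "transport_form s \<omega> u v = transport_form s (- \<omega>) v u"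
proof -
  have face: "(\<omega> \<bullet> face_normal M e) * upwind_flux \<omega> e u v
      + (\<omega> \<bullet> face_normal M e) * upwind_flux (- \<omega>) e v u
      = (\<omega> \<bullet> face_normal M e) * face_int e (\<lambda>x. product_jump e u v x)"
    if e: "e \<in> faces M" for e
  \<comment> \<open>At a transversal face, \<open>\<omega>\<close> and \<open>- \<omega>\<close>
    take their upwind values from opposite sides, and the two fluxes add up to the jump of the
    product. At a tangential face both choose the plus side, but the factor vanishes.\<close>
  proof (cases "\<omega> \<bullet> face_normal M e = 0")
    case False
    note c = face_poly_continuous[OF u e] face_poly_continuous[OF v e]
    have "upwind_flux \<omega> e u v
        + upwind_flux (- \<omega>) e v u
        = face_int e (\<lambda>x. upwind_poly \<omega> e u x * (face_jump e v x)
            + upwind_poly (- \<omega>) e v x * (face_jump e u x))"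
      by (intro face_int_add[symmetric] e continuous_on_mult continuous_on_diff c)
    also have "(\<lambda>x. upwind_poly \<omega> e u x * (face_jump e v x)
            + upwind_poly (- \<omega>) e v x * (face_jump e u x))
        = (\<lambda>x. product_jump e u v x)"
      using False by (auto simp: upwind_poly_def algebra_simps)
    finally show ?thesis by (simp only: distrib_left[symmetric])
  qed simp
  have "transport_form s (- \<omega>) v u
    = (volume_term \<omega> v u)
      - (\<Sum>e\<in>faces M. (\<omega> \<bullet> face_normal M e) * upwind_flux (- \<omega>) e v u)
      + s * l2_inner (Omega M) v u"
    using u by (simp add: transport_form_def local_deriv_uminus set_lebesgue_integral_def sum_negf)
  moreover have "(\<Sum>e\<in>faces M. (\<omega> \<bullet> face_normal M e) * upwind_flux \<omega> e u v)
      + (\<Sum>e\<in>faces M. (\<omega> \<bullet> face_normal M e) * upwind_flux (- \<omega>) e v u)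
      = (\<Sum>e\<in>faces M. (\<omega> \<bullet> face_normal M e) * face_int e (\<lambda>x. product_jump e u v x))"
    unfolding sum.distrib[symmetric] by (intro sum.cong refl face)
  moreover have "l2_inner (Omega M) v u = l2_inner (Omega M) u v" by (simp add: l2_inner_def mult.commute)
  ultimately show ?thesis using integration_by_parts[OF u v \<omega>] by (simp add: transport_form_def)
qed

lemma transport_form_energy:
  assumes u: "u \<in> V" and \<omega>: "norm \<omega> = 1"
  shows "transport_form s \<omega> u u = (\<Sum>e\<in>faces M. \<bar>\<omega> \<bullet> face_normal M e\<bar> / 2 * face_int e (\<lambda>x. (face_jump e u x)\<^sup>2))
     + s * l2_inner (Omega M) u u"
proof -
  have face: "(\<omega> \<bullet> face_normal M e) * upwind_flux \<omega> e u u
     = (\<omega> \<bullet> face_normal M e) * face_int e (\<lambda>x. product_jump e u u x) / 2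
      + \<bar>\<omega> \<bullet> face_normal M e\<bar> / 2 * face_int e (\<lambda>x. (face_jump e u x)\<^sup>2)"
    if e: "e \<in> faces M" for e
  proof -
    note c = face_poly_continuous[OF u e]
    let ?\<sigma> = "if \<omega> \<bullet> face_normal M e \<ge> 0 then 1 else - 1 :: real"
    let ?s = "\<lambda>x. (face_jump e u x)\<^sup>2"
    let ?d = "\<lambda>x. product_jump e u u x"
    \<comment> \<open>The upwind value is the mean of the two traces plus or minus half the jump.
      The mean yields half the jump of the square, and the sign turns the normal component into its
      modulus.\<close>
    have "(\<lambda>x. upwind_poly \<omega> e u x * (face_jump e u x)) = (\<lambda>x. (1/2) * ?d x + (?\<sigma> / 2) * ?s x)"
      by (auto simp: upwind_poly_def power2_eq_square field_simps)
    then have "upwind_flux \<omega> e u u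
        = face_int e (\<lambda>x. (1/2) * ?d x) + face_int e (\<lambda>x. (?\<sigma> / 2) * ?s x)"
      using c by (simp only:) (intro face_int_add e continuous_intros)
    also have "\<dots> = (1/2) * face_int e ?d + (?\<sigma> / 2) * face_int e ?s"
      by (intro arg_cong2[of _ _ _ _ "(+)"] face_integral_scale[OF face_polytope[OF e] face_normal_outward[OF e]])
    finally show ?thesis by (auto simp: algebra_simps)
  qed
  have "(\<Sum>e\<in>faces M. (\<omega> \<bullet> face_normal M e) * upwind_flux \<omega> e u u)
    = (\<Sum>e\<in>faces M. (\<omega> \<bullet> face_normal M e) * face_int e (\<lambda>x. product_jump e u u x)) / 2
     + (\<Sum>e\<in>faces M. \<bar>\<omega> \<bullet> face_normal M e\<bar> / 2 * face_int e (\<lambda>x. (face_jump e u x)\<^sup>2))"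
    unfolding sum_divide_distrib sum.distrib[symmetric] by (intro sum.cong refl face)
  then show ?thesis using integration_by_parts[OF u u \<omega>] by (simp add: transport_form_def)
qed

end

section \<open>The broken space as an inner product space; unique solvability of the directional
  problems\<close>

context polytopal_mesh
begin

text \<open>Assembles test functions element by element; a constant, a coordinate and a derivative
  of a member of \<open>Vh\<close> are obtained this way.\<close>

definition broken :: "((real ^ 'd) set \<Rightarrow> real ^ 'd \<Rightarrow> real) \<Rightarrow> real ^ 'd \<Rightarrow> real" where
  "broken r x = (\<Sum>K\<in>elems M. indicator K x * r K x)"

lemma broken_eq:
  assumes "K \<in> elems M" "x \<in> K" shows "broken r x = r K x"
proof -
  have "broken r x = (\<Sum>K'\<in>elems M. if K' = K then r K x else 0)"
    unfolding broken_def by (intro sum.cong) (use assms elem_eqI in \<open>auto simp: indicator_def\<close>)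
  then show ?thesis using assms finite_elems by simp
qed

lemma broken_in_Vh:
  assumes "\<And>K. K \<in> elems M \<Longrightarrow> r K \<in> poly_space p" shows "broken r \<in> V"
proof -
  have "broken r x = 0" if "x \<notin> \<Union>(elems M)" for x
    unfolding broken_def using that by (intro sum.neutral) (auto simp: indicator_def)
  then show ?thesis using assms broken_eq unfolding Vh_def by blast
qed

lemma local_poly_broken:
  assumes "\<And>K. K \<in> elems M \<Longrightarrow> r K \<in> poly_space p" "K \<in> elems M"
  shows "local_poly (broken r) K = r K"
  by (rule local_poly_unique) (use assms broken_in_Vh broken_eq in auto)

lemma finite_spanning_Vh: "\<exists>B. finite B \<and> V \<subseteq> span B"
proof -
  define I where "I = {\<alpha> :: 'd \<Rightarrow> nat. (\<Sum>i\<in>UNIV. \<alpha> i) \<le> p}"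
  define b where "b K \<alpha> x = indicator K x * monomial \<alpha> x" for K :: "(real ^ 'd) set" and \<alpha> and x :: "real ^ 'd"
  define B where "B = (\<lambda>(K, \<alpha>). b K \<alpha>) ` (elems M \<times> I)"
  have "finite B" unfolding B_def I_def using finite_elems finite_exponents by blast
  moreover have "V \<subseteq> span B"
  proof
    fix v assume v: "v \<in> V"
    have "\<forall>K\<in>elems M. \<exists>c. local_poly v K = (\<lambda>x. \<Sum>\<alpha>\<in>I. c \<alpha> * monomial \<alpha> x)"
      using local_poly(1)[OF v] unfolding poly_space_eq I_def by blast
    then obtain c where c: "\<And>K. K \<in> elems M \<Longrightarrow> local_poly v K = (\<lambda>x. \<Sum>\<alpha>\<in>I. c K \<alpha> * monomial \<alpha> x)"
      by metis
    have v_eq: "v = broken (local_poly v)"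
    proof
      fix x
      show "v x = broken (local_poly v) x"
      proof (cases "x \<in> \<Union>(elems M)")
        case True
        then show ?thesis using broken_eq local_poly(2)[OF v] by auto
      next
        case False
        then show ?thesis using v broken_in_Vh[of "local_poly v"] local_poly(1)[OF v] unfolding Vh_def by auto
      qed
    qed
    also have "broken (local_poly v) = (\<Sum>K\<in>elems M. \<Sum>\<alpha>\<in>I. c K \<alpha> *\<^sub>R b K \<alpha>)"
      by (simp add: fun_eq_iff broken_def sum_fun_apply b_def c sum_distrib_left mult.left_commute)
    finally have "v = (\<Sum>K\<in>elems M. \<Sum>\<alpha>\<in>I. c K \<alpha> *\<^sub>R b K \<alpha>)" .
    moreover have "b K \<alpha> \<in> span B" if "K \<in> elems M" "\<alpha> \<in> I" for K \<alpha>
      using that by (intro span_base) (auto simp: B_def)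
    then have "(\<Sum>K\<in>elems M. \<Sum>\<alpha>\<in>I. c K \<alpha> *\<^sub>R b K \<alpha>) \<in> span B"
      by (intro span_sum span_scale)
    ultimately show "v \<in> span B" by simp
  qed
  ultimately show ?thesis by blast
qed

abbreviation (input) "ip \<equiv> l2_inner (Omega M)"

lemma elem_int_add:
  fixes f g :: "real ^ 'd \<Rightarrow> real"
  assumes "K \<in> elems M" "continuous_on UNIV f" "continuous_on UNIV g"
  shows "(LINT x:K|lborel. f x + g x) = (LINT x:K|lborel. f x) + (LINT x:K|lborel. g x)"
  by (rule set_integral_add_continuous[OF assms(2,3) elem_bounded[OF assms(1)] elem_borel[OF assms(1)]])

text \<open>Definiteness holds literally, not only up to null sets: the representatives are
  polynomial on each open element and zero elsewhere, so a nonzero one has a positive integral on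
  some element.\<close>

lemma l2_inner_form: "inner_form V ip"
proof unfold_locales
  show "subspace V" by (rule subspace_Vh)
  show "ip (u + v) w = ip u w + ip v w" if "u \<in> V" "v \<in> V" "w \<in> V" for u v w
  proof -
    have "(LINT x:K|lborel. local_poly (u + v) K x * local_poly w K x)
      = (LINT x:K|lborel. local_poly u K x * local_poly w K x) + (LINT x:K|lborel. local_poly v K x * local_poly w K x)"
      if K: "K \<in> elems M" for K
      using elem_int_add[OF K, of "\<lambda>x. local_poly u K x * local_poly w K x" "\<lambda>x. local_poly v K x * local_poly w K x"]
        continuous_local_poly[OF \<open>u \<in> V\<close> K] continuous_local_poly[OF \<open>v \<in> V\<close> K] continuous_local_poly[OF \<open>w \<in> V\<close> K]
      by (simp add: local_poly_add[OF \<open>u \<in> V\<close> \<open>v \<in> V\<close> K] distrib_right continuous_on_mult)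
    then show ?thesis using that subspace_add[OF subspace_Vh] by (simp add: l2_inner_Omega sum.distrib)
  qed
  show "ip (a *\<^sub>R u) w = a * ip u w" for a u w by (simp add: l2_inner_def mult.assoc)
  show "ip u v = ip v u" for u v by (simp add: l2_inner_def mult.commute)
  show "\<exists>B. finite B \<and> V \<subseteq> span B" by (rule finite_spanning_Vh)
  show "0 < ip u u" if u: "u \<in> V" "u \<noteq> 0" for u
  proof -
    have "\<exists>K\<in>elems M. \<exists>x\<in>K. u x \<noteq> 0"
    proof (rule ccontr)
      assume "\<not> ?thesis"
      then have "u x = 0" for x using u(1) unfolding Vh_def by (cases "x \<in> \<Union>(elems M)") auto
      then show False using u(2) by (auto simp: fun_eq_iff)
    qed
    then obtain K x where K: "K \<in> elems M" "x \<in> K" "u x \<noteq> 0" by blast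
    have nn: "0 \<le> (LINT x:K'|lborel. local_poly u K' x * local_poly u K' x)" for K'
      unfolding set_lebesgue_integral_def by (intro Bochner_Integration.integral_nonneg) simp
    have "(LINT x:K|lborel. local_poly u K x * local_poly u K x) \<noteq> 0"
    proof
      assume "(LINT x:K|lborel. local_poly u K x * local_poly u K x) = 0"
      from set_integral_continuous_eq_0[OF _ elem_bounded[OF K(1)] elem_open[OF K(1)] _ this K(2)]
      show False using K(3) local_poly(2)[OF u(1) K(1,2)] continuous_local_poly[OF u(1) K(1)]
        by (simp add: continuous_on_mult)
    qed
    then have "0 < (LINT x:K|lborel. local_poly u K x * local_poly u K x)" using nn[of K] by linarith
    then show ?thesis unfolding l2_inner_Omega[OF u(1) u(1)]
      by (rule sum_pos2[OF finite_elems K(1)]) (rule nn)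
  qed
qed

sublocale ip: inner_form V ip by (rule l2_inner_form)

lemma face_poly_linear:
  assumes "u \<in> V" "v \<in> V" "e \<in> faces M"
  shows "upwind_poly \<omega> e (u + v) x = upwind_poly \<omega> e u x + upwind_poly \<omega> e v x"
    and "upwind_poly \<omega> e (c *\<^sub>R u) x = c * upwind_poly \<omega> e u x"
  using assms by (auto simp: upwind_poly_def plus_poly_add minus_poly_add plus_poly_scale minus_poly_scale)

lemma face_int_scale: "e \<in> faces M \<Longrightarrow> face_int e (\<lambda>x. c * f x) = c * face_int e f"
  by (rule face_integral_scale[OF face_polytope face_normal_outward])

lemma transport_form_add_left:
  assumes u: "u \<in> V" and v: "v \<in> V" and w: "w \<in> V"
  shows "transport_form s \<omega> (u + v) w = transport_form s \<omega> u w + transport_form s \<omega> v w"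
proof -
  have "(LINT x:K|lborel. local_poly (u + v) K x * local_deriv w K \<omega> x)
    = (LINT x:K|lborel. local_poly u K x * local_deriv w K \<omega> x) + (LINT x:K|lborel. local_poly v K x * local_deriv w K \<omega> x)"
    if K: "K \<in> elems M" for K
    using elem_int_add[OF K, of "\<lambda>x. local_poly u K x * local_deriv w K \<omega> x" "\<lambda>x. local_poly v K x * local_deriv w K \<omega> x"]
      continuous_local_poly[OF u K] continuous_local_poly[OF v K] continuous_local_deriv[OF w K]
    by (simp add: local_poly_add[OF u v K] distrib_right continuous_on_mult)
  moreover have "upwind_flux \<omega> e (u + v) w
      = upwind_flux \<omega> e u w
       + upwind_flux \<omega> e v w" if e: "e \<in> faces M" for e
    unfolding face_poly_linear[OF u v e] distrib_right
    by (intro face_int_add e continuous_on_mult continuous_on_diff face_poly_continuous u v w)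
  moreover have "ip (u + v) w = ip u w + ip v w" by (rule ip.add_left[OF u v w])
  ultimately show ?thesis
    by (simp add: transport_form_def sum.distrib distrib_left)
qed

lemma transport_form_scale_left:
  assumes u: "u \<in> V" and w: "w \<in> V"
  shows "transport_form s \<omega> (c *\<^sub>R u) w = c * transport_form s \<omega> u w"
proof -
  have "(LINT x:K|lborel. local_poly (c *\<^sub>R u) K x * local_deriv w K \<omega> x)
    = c * (LINT x:K|lborel. local_poly u K x * local_deriv w K \<omega> x)" if K: "K \<in> elems M" for K
    by (simp add: local_poly_scale[OF u K] mult.assoc)
  moreover have "upwind_flux \<omega> e (c *\<^sub>R u) w
      = c * upwind_flux \<omega> e u w" if e: "e \<in> faces M" for e
    unfolding face_poly_linear(2)[OF u u e] mult.assoc by (rule face_int_scale[OF e])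
  moreover have "ip (c *\<^sub>R u) w = c * ip u w" by (rule ip.scale_left[OF u w])
  ultimately show ?thesis
    by (simp add: transport_form_def sum_distrib_left algebra_simps)
qed

text \<open>The adjoint identity moves the second argument into the first slot, where additivity is
  known; this is why the direction has to be a unit vector here.\<close>

lemma transport_form_add_right:
  assumes "u \<in> V" "v \<in> V" "w \<in> V" "norm \<omega> = 1"
  shows "transport_form s \<omega> w (u + v) = transport_form s \<omega> w u + transport_form s \<omega> w v"
  using assms subspace_add[OF subspace_Vh] by (simp add: transport_form_adjoint[of w] transport_form_add_left)

lemma transport_form_scale_right:
  assumes "u \<in> V" "w \<in> V" "norm \<omega> = 1"
  shows "transport_form s \<omega> w (c *\<^sub>R u) = c * transport_form s \<omega> w u"
proof -
  have "c *\<^sub>R u \<in> V" using assms subspace_scale[OF subspace_Vh] by blast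
  then show ?thesis using assms by (simp add: transport_form_adjoint[of w] transport_form_scale_left del: scaleR_fun_apply)
qed

lemma jump_energy_nonneg:
  "0 \<le> (\<Sum>e\<in>faces M. \<bar>\<omega> \<bullet> face_normal M e\<bar> / 2 * face_int e (\<lambda>x. (face_jump e u x)\<^sup>2))"
  by (intro sum_nonneg mult_nonneg_nonneg face_integral_nonneg[OF face_polytope face_normal_outward]) auto

lemma transport_form_pos:
  assumes "u \<in> V" "u \<noteq> 0" "norm \<omega> = 1" "s > 0"
  shows "0 < transport_form s \<omega> u u"
  using jump_energy_nonneg[of \<omega> u] ip.pos[OF assms(1,2)] assms
  by (simp add: transport_form_energy add_nonneg_pos)

text \<open>In finite dimension positivity of the energy suffices: it gives existence through
  \<open>definite_form_solvable\<close> and uniqueness by testing with the difference of two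
  solutions.\<close>

lemma transport_form_solvable:
  assumes \<omega>: "norm \<omega> = 1" and s: "s > 0"
    and l: "\<And>u v. u \<in> V \<Longrightarrow> v \<in> V \<Longrightarrow> l (u + v) = l u + l v" "\<And>a u. u \<in> V \<Longrightarrow> l (a *\<^sub>R u) = a * l u"
  shows "\<exists>!u. u \<in> V \<and> (\<forall>v\<in>V. transport_form s \<omega> u v = l v)"
proof -
  obtain S where S: "ip.orthonormal S" and ex: "\<And>v. v \<in> V \<Longrightarrow> v = (\<Sum>e\<in>S. ip v e *\<^sub>R e)"
    by (rule ip.orthonormal_basis) blast
  have fS: "finite S" "S \<subseteq> V" using S unfolding ip.orthonormal_def by auto
  have "v \<in> span S" if "v \<in> V" for v
    by (subst ex[OF that]) (intro span_sum span_scale span_base)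
  then have VS: "span S = V" using span_minimal[OF fS(2) subspace_Vh] by blast
  have "\<exists>u\<in>span S. \<forall>v\<in>span S. transport_form s \<omega> u v = l v"
    by (rule definite_form_solvable[OF subspace_Vh])
       (use transport_form_add_left transport_form_scale_left transport_form_add_right[OF _ _ _ \<omega>]
         transport_form_scale_right[OF _ _ \<omega>] transport_form_pos[OF _ _ \<omega> s] fS l in auto)
  then obtain u where u: "u \<in> V" "\<forall>v\<in>V. transport_form s \<omega> u v = l v" unfolding VS by blast
  show ?thesis
  proof (rule ex1I[of _ u])
    fix u' assume u': "u' \<in> V \<and> (\<forall>v\<in>V. transport_form s \<omega> u' v = l v)"
    have d: "u' - u \<in> V" using u u' subspace_diff[OF subspace_Vh] by blast
    have "transport_form s \<omega> u' (u' - u) = transport_form s \<omega> ((u' - u) + u) (u' - u)" by simp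
    also have "\<dots> = transport_form s \<omega> (u' - u) (u' - u) + transport_form s \<omega> u (u' - u)"
      by (rule transport_form_add_left[OF d u(1) d])
    finally have "transport_form s \<omega> (u' - u) (u' - u) = 0" using u u' d by simp
    then have "u' - u = 0" using transport_form_pos[OF d _ \<omega> s] by force
    then show "u' = u" by simp
  qed (use u in blast)
qed

end

section \<open>Scalar response and source iteration\<close>

locale transport_problem = polytopal_mesh M p
  for M :: "'d::finite mesh" and p :: nat +
  fixes Q :: "'d quadrature" and st sa \<epsilon> :: real
  assumes quad: "angular_quadrature Q" and p1: "p \<ge> 1" and st: "st > 0" and sa: "sa > 0"
    and eps: "0 < \<epsilon>" "\<epsilon> < sqrt (st / sa)"
begin

section \<open>Moments and symmetry of the quadrature; scaling of the coefficients\<close>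

lemma norm_dir: "m \<in> {1..npts Q} \<Longrightarrow> norm (dir Q m) = 1"
  and wt_pos: "m \<in> {1..npts Q} \<Longrightarrow> 0 < wt Q m"
  and sum_wt: "(\<Sum>m=1..npts Q. wt Q m) = 1"
  using quad unfolding angular_quadrature_def by auto

text \<open>The second-moment tensor applied to a vector \<open>h\<close>. It expresses
  \<open>h\<close> through the quadrature directions, so they detect every nonzero vector and
  determine every derivative.\<close>

lemma sum_wt_dir: "(\<Sum>m=1..npts Q. (wt Q m * (dir Q m \<bullet> h)) *\<^sub>R dir Q m) = (1 / real CARD('d)) *\<^sub>R h"
proof (rule vec_eq_iff[THEN iffD2], rule allI)
  fix i
  have T: "(\<Sum>m=1..npts Q. wt Q m *\<^sub>R (\<chi> i j. dir Q m $ i * dir Q m $ j)) = (1 / real CARD('d)) *\<^sub>R (mat 1 :: real ^ 'd ^ 'd)"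
    using quad unfolding angular_quadrature_def by blast
  have entry: "(\<Sum>m=1..npts Q. wt Q m * (dir Q m $ i * dir Q m $ j)) = (1 / real CARD('d)) * (if i = j then 1 else 0)" for j
    using arg_cong[OF T, of "\<lambda>A. A $ i $ j"] by (simp add: mat_def)
  have "(\<Sum>m=1..npts Q. (wt Q m * (dir Q m \<bullet> h)) *\<^sub>R dir Q m) $ i
      = (\<Sum>m=1..npts Q. \<Sum>j\<in>UNIV. wt Q m * (dir Q m $ i * dir Q m $ j) * h $ j)"
    by (simp add: inner_vec_def sum_distrib_left sum_distrib_right algebra_simps)
  also have "\<dots> = (\<Sum>j\<in>UNIV. (\<Sum>m=1..npts Q. wt Q m * (dir Q m $ i * dir Q m $ j)) * h $ j)"
    by (subst sum.swap) (simp add: sum_distrib_right)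
  also have "\<dots> = (\<Sum>j\<in>UNIV. if i = j then (1 / real CARD('d)) * h $ j else 0)"
    unfolding entry by (intro sum.cong) auto
  also have "\<dots> = ((1 / real CARD('d)) *\<^sub>R h) $ i" by simp
  finally show "(\<Sum>m=1..npts Q. (wt Q m * (dir Q m \<bullet> h)) *\<^sub>R dir Q m) $ i = ((1 / real CARD('d)) *\<^sub>R h) $ i" .
qed

lemma exists_dir_not_orthogonal:
  assumes "h \<noteq> 0" obtains m where "m \<in> {1..npts Q}" "dir Q m \<bullet> h \<noteq> 0"
proof -
  have "\<exists>m\<in>{1..npts Q}. dir Q m \<bullet> h \<noteq> 0"
  proof (rule ccontr)
    assume "\<not> ?thesis"
    then have "(\<Sum>m=1..npts Q. (wt Q m * (dir Q m \<bullet> h)) *\<^sub>R dir Q m) = 0" by (intro sum.neutral) auto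
    then show False using sum_wt_dir[of h] assms by simp
  qed
  then show thesis using that by blast
qed

text \<open>Since the pairs of direction and weight are distinct, choosing an opposite index is
  injective, hence a permutation of the index set by which sums can be reindexed.\<close>

lemma opposite_index:
  obtains opp where "bij_betw opp {1..npts Q} {1..npts Q}"
    "\<And>m. m \<in> {1..npts Q} \<Longrightarrow> dir Q (opp m) = - dir Q m \<and> wt Q (opp m) = wt Q m"
proof -
  have "\<forall>m\<in>{1..npts Q}. \<exists>m'\<in>{1..npts Q}. dir Q m' = - dir Q m \<and> wt Q m' = wt Q m"
    using quad unfolding angular_quadrature_def by blast
  then obtain opp where opp: "\<And>m. m \<in> {1..npts Q} \<Longrightarrow> opp m \<in> {1..npts Q} \<and> dir Q (opp m) = - dir Q m \<and> wt Q (opp m) = wt Q m"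
    by metis
  have inj: "inj_on (\<lambda>m. (dir Q m, wt Q m)) {1..npts Q}" using quad unfolding angular_quadrature_def by blast
  have "inj_on opp {1..npts Q}"
  proof (rule inj_onI)
    fix m m' assume m: "m \<in> {1..npts Q}" "m' \<in> {1..npts Q}" "opp m = opp m'"
    then have "(dir Q m, wt Q m) = (dir Q m', wt Q m')" using opp[of m] opp[of m'] by auto
    then show "m = m'" using inj m(1,2) by (meson inj_onD)
  qed
  moreover have "opp ` {1..npts Q} \<subseteq> {1..npts Q}" using opp by blast
  ultimately have "bij_betw opp {1..npts Q} {1..npts Q}"
    unfolding bij_betw_def using endo_inj_surj[of "{1..npts Q}" opp] by blast
  then show thesis using that opp by blast
qed

lemma st_sigma: "\<epsilon> * sigma_t st \<epsilon> = st" and sigma_t_pos: "sigma_t st \<epsilon> > 0"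
  using eps st by (auto simp: sigma_t_def)

abbreviation (input) "c \<equiv> c_eps st sa \<epsilon>"

lemma sigma_s_eq: "\<epsilon> * sigma_s st sa \<epsilon> = st * c"
  using eps st by (simp add: c_eps_def sigma_t_def field_simps)

text \<open>The upper bound on \<open>\<epsilon>\<close> makes \<open>c\<close> positive, the
  absorption makes it less than 1.\<close>

lemma c_bounds: "0 < c" "c < 1"
proof -
  have "\<epsilon>\<^sup>2 < (sqrt (st / sa))\<^sup>2" using eps by (intro power_strict_mono) auto
  then have "\<epsilon>\<^sup>2 < st / sa" using st sa by simp
  then have "\<epsilon> * (\<epsilon> * sa) < st" using sa by (simp add: field_simps power2_eq_square)
  then have "\<epsilon> * sa < st / \<epsilon>" using eps by (simp add: field_simps)
  then show "0 < c" using eps st by (simp add: c_eps_def sigma_s_def sigma_t_def)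
  have "sigma_s st sa \<epsilon> < sigma_t st \<epsilon>" using eps sa by (simp add: sigma_s_def sigma_t_def)
  then show "c < 1" using sigma_t_pos by (simp add: c_eps_def)
qed

abbreviation (input) "tf m \<equiv> transport_form (sigma_t st \<epsilon>) (dir Q m)"
abbreviation (input) "Psi \<equiv> Psi_hat M Q p st \<epsilon>"
abbreviation (input) "H \<equiv> H_op M Q p st \<epsilon>"
abbreviation (input) "bf \<equiv> bform M Q st \<epsilon>"
abbreviation (input) "aex \<equiv> a_ex M Q p st sa \<epsilon>"
abbreviation (input) "nex \<equiv> norm_ex M Q p st sa \<epsilon>"
abbreviation (input) "star \<equiv> phi_star M Q p st sa \<epsilon>"
abbreviation (input) "error \<equiv> err M Q p st sa \<epsilon>"
abbreviation (input) "half_error \<equiv> err_half M Q p st sa \<epsilon>"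
abbreviation (input) "ang \<equiv> {1..npts Q}"
abbreviation (input) "rhs f \<phi> x \<equiv> sigma_s st sa \<epsilon> * \<phi> x + f x"

section \<open>The scalar response as a linear, symmetric and positive operator\<close>

lemma ip_scale_fun: "ip (\<lambda>x. a * u x) v = a * ip u v"
  by (simp add: l2_inner_def mult.assoc)

text \<open>Unpacks the definite description. Uniqueness, the third fact, is the tool behind
  linearity and behind the identification of the fluxes of the source iteration.\<close>

lemma Psi_hat:
  assumes m: "m \<in> ang" and g: "g \<in> V"
  shows "Psi m g \<in> V" and "v \<in> V \<Longrightarrow> \<epsilon> * tf m (Psi m g) v = st * ip g v"
    and "u \<in> V \<Longrightarrow> (\<And>v. v \<in> V \<Longrightarrow> \<epsilon> * tf m u v = st * ip g v) \<Longrightarrow> u = Psi m g"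
proof -
  have "\<exists>!u. u \<in> V \<and> (\<forall>v\<in>V. tf m u v = (st / \<epsilon>) * ip g v)"
    by (rule transport_form_solvable[OF norm_dir[OF m] sigma_t_pos])
       (simp_all add: ip.add_right ip.scale_right g distrib_left del: scaleR_fun_apply)
  moreover have "\<epsilon> * bf m u v = ip (\<lambda>x. st * g x) v \<longleftrightarrow> tf m u v = (st / \<epsilon>) * ip g v"
    if "u \<in> V" "v \<in> V" for u v
    using that eps by (simp add: bform_eq ip_scale_fun field_simps)
  ultimately have ex1: "\<exists>!u. u \<in> V \<and> (\<forall>v\<in>V. \<epsilon> * bf m u v = ip (\<lambda>x. st * g x) v)"
    by (metis (no_types, lifting))
  from theI'[OF ex1] have *: "Psi m g \<in> V" "\<And>v. v \<in> V \<Longrightarrow> \<epsilon> * bf m (Psi m g) v = ip (\<lambda>x. st * g x) v"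
    unfolding Psi_hat_def by auto
  then show "Psi m g \<in> V" "v \<in> V \<Longrightarrow> \<epsilon> * tf m (Psi m g) v = st * ip g v"
    by (auto simp: bform_eq ip_scale_fun)
  assume "u \<in> V" "\<And>v. v \<in> V \<Longrightarrow> \<epsilon> * tf m u v = st * ip g v"
  then have "u \<in> V \<and> (\<forall>v\<in>V. \<epsilon> * bf m u v = ip (\<lambda>x. st * g x) v)"
    by (auto simp: bform_eq ip_scale_fun)
  then show "u = Psi m g" using ex1 * by blast
qed

lemma Psi_add:
  assumes "m \<in> ang" "g \<in> V" "h \<in> V"
  shows "Psi m (g + h) = Psi m g + Psi m h"
proof (rule Psi_hat(3)[OF assms(1), symmetric])
  note P = Psi_hat[OF assms(1,2)] Psi_hat[OF assms(1,3)]
  show "g + h \<in> V" "Psi m g + Psi m h \<in> V"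
    using assms P(1,4) subspace_add[OF subspace_Vh] by auto
  fix v assume v: "v \<in> V"
  then show "\<epsilon> * tf m (Psi m g + Psi m h) v = st * ip (g + h) v"
    unfolding transport_form_add_left[OF P(1,4) v] ip.add_left[OF assms(2,3) v] distrib_left
    by (simp only: P(2,5))
qed

lemma Psi_scale:
  assumes "m \<in> ang" "g \<in> V"
  shows "Psi m (a *\<^sub>R g) = a *\<^sub>R Psi m g"
proof (rule Psi_hat(3)[OF assms(1), symmetric])
  note P = Psi_hat[OF assms]
  show "a *\<^sub>R g \<in> V" "a *\<^sub>R Psi m g \<in> V"
    using assms P(1) subspace_scale[OF subspace_Vh] by auto
  fix v assume v: "v \<in> V"
  have "\<epsilon> * tf m (a *\<^sub>R Psi m g) v = a * (\<epsilon> * tf m (Psi m g) v)"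
    unfolding transport_form_scale_left[OF P(1) v] by (rule mult.left_commute)
  then show "\<epsilon> * tf m (a *\<^sub>R Psi m g) v = st * ip (a *\<^sub>R g) v"
    unfolding P(2)[OF v] ip.scale_left[OF assms(2) v] by (simp only: mult.left_commute)
qed

lemma H_eq: "H g = (\<Sum>m=1..npts Q. wt Q m *\<^sub>R Psi m g)"
  by (rule ext) (simp add: H_op_def sum_fun_apply)

lemma H_in_Vh: "g \<in> V \<Longrightarrow> H g \<in> V"
  unfolding H_eq by (intro subspace_sum[OF subspace_Vh] subspace_scale[OF subspace_Vh] Psi_hat(1))

lemma H_add: "g \<in> V \<Longrightarrow> h \<in> V \<Longrightarrow> H (g + h) = H g + H h"
  unfolding H_eq sum.distrib[symmetric] by (intro sum.cong refl) (simp add: Psi_add scaleR_add_right del: scaleR_fun_apply)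

lemma H_scale: "g \<in> V \<Longrightarrow> H (a *\<^sub>R g) = a *\<^sub>R H g"
  unfolding H_eq scaleR_sum_right by (intro sum.cong refl) (simp add: Psi_scale mult.commute del: scaleR_fun_apply)

lemma ip_H:
  assumes "g \<in> V" "h \<in> V"
  shows "ip (H g) h = (\<Sum>m=1..npts Q. wt Q m * ip (Psi m g) h)"
proof -
  have "wt Q m *\<^sub>R Psi m g \<in> V" if "m \<in> ang" for m
    using Psi_hat(1)[OF that assms(1)] subspace_scale[OF subspace_Vh] by blast
  then have "ip (H g) h = (\<Sum>m=1..npts Q. ip (wt Q m *\<^sub>R Psi m g) h)"
    unfolding H_eq by (intro ip.sum_left assms)
  also have "\<dots> = (\<Sum>m=1..npts Q. wt Q m * ip (Psi m g) h)"
    by (intro sum.cong refl ip.scale_left Psi_hat(1) assms)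
  finally show ?thesis .
qed

text \<open>Testing the response to \<open>g\<close> in direction \<open>m\<close> with the response
  to \<open>h\<close> in the opposite direction, and conversely, equates two pairings. The identity
  exchanges opposite directions, so symmetry appears once the sum is reindexed by
  \<open>opp\<close>.\<close>

lemma H_symmetric:
  assumes g: "g \<in> V" and h: "h \<in> V"
  shows "ip (H g) h = ip g (H h)"
proof -
  obtain opp where opp: "bij_betw opp {1..npts Q} {1..npts Q}"
    "\<And>m. m \<in> ang \<Longrightarrow> dir Q (opp m) = - dir Q m \<and> wt Q (opp m) = wt Q m"
    by (rule opposite_index) blast
  have "ip (Psi m g) h = ip (Psi (opp m) h) g" if m: "m \<in> ang" for m
  proof -
    have m': "opp m \<in> ang" using opp(1) m by (auto simp: bij_betw_def)
    note P = Psi_hat[OF m g] Psi_hat[OF m' h]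
    have "st * ip (Psi (opp m) h) g = \<epsilon> * tf m (Psi m g) (Psi (opp m) h)"
      using P(2)[OF P(4)] ip.sym[OF g P(4)] by simp
    also have "\<dots> = \<epsilon> * tf (opp m) (Psi (opp m) h) (Psi m g)"
      using transport_form_adjoint[OF P(1,4) norm_dir[OF m]] opp(2)[OF m] by simp
    also have "\<dots> = st * ip (Psi m g) h" using P(5)[OF P(1)] ip.sym[OF h P(1)] by simp
    finally show ?thesis using st by simp
  qed
  then have "ip (H g) h = (\<Sum>m=1..npts Q. wt Q (opp m) * ip (Psi (opp m) h) g)"
    unfolding ip_H[OF g h] using opp(2) by (intro sum.cong) auto
  also have "\<dots> = (\<Sum>m=1..npts Q. wt Q m * ip (Psi m h) g)"
    by (rule sum.reindex_bij_betw[OF opp(1)])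
  also have "\<dots> = ip (H h) g" by (rule ip_H[OF h g, symmetric])
  finally show ?thesis using ip.sym[OF H_in_Vh[OF h] g] by simp
qed

definition jump_energy :: "nat \<Rightarrow> (real ^ 'd \<Rightarrow> real) \<Rightarrow> real" where
  "jump_energy m u = (\<Sum>e\<in>faces M. \<bar>dir Q m \<bullet> face_normal M e\<bar> / 2 * face_int e (\<lambda>x. (face_jump e u x)\<^sup>2))"

lemma jump_energy_ge0: "0 \<le> jump_energy m u"
  unfolding jump_energy_def by (rule jump_energy_nonneg)

lemma Psi_energy:
  assumes m: "m \<in> ang" and g: "g \<in> V"
  shows "st * ip (Psi m g) g = \<epsilon> * jump_energy m (Psi m g) + st * ip (Psi m g) (Psi m g)"
proof -
  note P = Psi_hat[OF assms]
  have "st * ip (Psi m g) g = \<epsilon> * tf m (Psi m g) (Psi m g)" using P(2)[OF P(1)] ip.sym[OF g P(1)] by simp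
  also have "\<dots> = \<epsilon> * jump_energy m (Psi m g) + (\<epsilon> * sigma_t st \<epsilon>) * ip (Psi m g) (Psi m g)"
    unfolding transport_form_energy[OF P(1) norm_dir[OF m]] jump_energy_def by (simp add: distrib_left)
  finally show ?thesis by (simp add: st_sigma)
qed

lemma npts_pos: "1 \<in> ang"
  using sum_wt by (cases "npts Q = 0") auto

text \<open>A zero response would make \<open>g\<close> orthogonal to itself; for a nonzero response
  the energy identity makes the pairing with \<open>g\<close> positive in each direction.\<close>

lemma H_pos:
  assumes g: "g \<in> V" "g \<noteq> 0"
  shows "0 < ip (H g) g"
proof -
  have "0 < ip (Psi m g) g" if m: "m \<in> ang" for m
  proof -
    note P = Psi_hat[OF m g(1)]
    have "Psi m g \<noteq> 0"
    proof
      assume "Psi m g = 0"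
      then have "tf m (Psi m g) g = 0"
        using transport_form_scale_left[OF P(1) g(1), of "sigma_t st \<epsilon>" "dir Q m" 0] by simp
      then have "ip g g = 0" using P(2)[OF g(1)] st by simp
      then show False using ip.pos[OF g] by simp
    qed
    then have "0 < st * ip (Psi m g) g"
      using Psi_energy[OF m g(1)] ip.pos[OF P(1)] jump_energy_ge0[of m "Psi m g"] eps st
      by (simp add: add_nonneg_pos)
    then show ?thesis using st by (simp add: zero_less_mult_iff)
  qed
  then show ?thesis unfolding ip_H[OF g(1) g(1)] using wt_pos npts_pos by (intro sum_pos) auto
qed

text \<open>Expand the square: \<open>Psi_energy\<close> trades the squared norm of the flux and its
  jump energy for \<open>ip (Psi m g) g\<close>, so each direction contributes
  \<open>ip g g - ip (Psi m g) g\<close>. The weights sum to 1 and average the fluxes to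
  \<open>H g\<close>.\<close>

lemma eigenvalue_defect:
  assumes g: "g \<in> V" and ev: "H g = l *\<^sub>R g"
  shows "(\<Sum>m=1..npts Q. wt Q m * (ip (Psi m g - g) (Psi m g - g) + \<epsilon> / st * jump_energy m (Psi m g))) = (1 - l) * ip g g"
proof -
  have "ip (Psi m g - g) (Psi m g - g) + \<epsilon> / st * jump_energy m (Psi m g) = ip g g - ip (Psi m g) g"
    if m: "m \<in> ang" for m
  proof -
    note P = Psi_hat(1)[OF m g]
    have d: "Psi m g - g \<in> V" using P g subspace_diff[OF subspace_Vh] by blast
    have "ip (Psi m g - g) (Psi m g - g) = ip (Psi m g) (Psi m g) - 2 * ip (Psi m g) g + ip g g"
      unfolding ip.diff_left[OF P g d] ip.diff_right[OF P g P] ip.diff_right[OF P g g] ip.sym[OF g P] by simp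
    moreover have "ip (Psi m g) g = \<epsilon> / st * jump_energy m (Psi m g) + ip (Psi m g) (Psi m g)"
      using Psi_energy[OF m g] st by (simp add: field_simps)
    ultimately show ?thesis by simp
  qed
  then have "(\<Sum>m=1..npts Q. wt Q m * (ip (Psi m g - g) (Psi m g - g) + \<epsilon> / st * jump_energy m (Psi m g)))
      = (\<Sum>m=1..npts Q. wt Q m * ip g g - wt Q m * ip (Psi m g) g)"
    by (intro sum.cong) (simp_all add: right_diff_distrib)
  also have "\<dots> = ip g g - ip (H g) g"
    unfolding sum_subtractf sum_distrib_right[symmetric] sum_wt ip_H[OF g g] by simp
  also have "\<dots> = (1 - l) * ip g g" unfolding ev ip.scale_left[OF g g] by (simp add: algebra_simps)
  finally show ?thesis .
qed

lemma eigenvalue_less_1: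
  assumes g: "g \<in> V" "g \<noteq> 0" and ev: "H g = l *\<^sub>R g"
  shows "l < 1"
proof (rule ccontr)
  assume "\<not> l < 1"
  then have l: "1 \<le> l" by simp
  define t where "t m = wt Q m * (ip (Psi m g - g) (Psi m g - g) + \<epsilon> / st * jump_energy m (Psi m g))" for m
  have dV: "Psi m g - g \<in> V" if "m \<in> ang" for m
    using Psi_hat(1)[OF that g(1)] g subspace_diff[OF subspace_Vh] by blast
  have parts: "0 \<le> ip (Psi m g - g) (Psi m g - g)" "0 \<le> \<epsilon> / st * jump_energy m (Psi m g)"
    if "m \<in> ang" for m
    using ip.nonneg[OF dV[OF that]] jump_energy_ge0[of m "Psi m g"] eps st by auto
  have t0: "0 \<le> t m" if "m \<in> ang" for m
    unfolding t_def by (intro mult_nonneg_nonneg[OF less_imp_le[OF wt_pos]] add_nonneg_nonneg parts that)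
  have "(1 - l) * ip g g \<le> 0" using l ip.nonneg[OF g(1)] by (simp add: mult_nonpos_nonneg)
  then have "(\<Sum>m=1..npts Q. t m) \<le> 0" using eigenvalue_defect[OF g(1) ev] by (simp add: t_def)
  then have "(\<Sum>m=1..npts Q. t m) = 0" using sum_nonneg[of "{1..npts Q}" t] t0 by fastforce
  then have tz: "t m = 0" if "m \<in> ang" for m
    using sum_nonneg_eq_0_iff[of "{1..npts Q}" t] t0 that by blast
  have zero: "ip (Psi m g - g) (Psi m g - g) = 0" "jump_energy m (Psi m g) = 0" if m: "m \<in> ang" for m
  proof -
    have "ip (Psi m g - g) (Psi m g - g) + \<epsilon> / st * jump_energy m (Psi m g) = 0"
      using tz[OF m] wt_pos[OF m] by (simp add: t_def)
    then show "ip (Psi m g - g) (Psi m g - g) = 0" "jump_energy m (Psi m g) = 0"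
      using parts[OF m] eps st by (auto simp: add_nonneg_eq_0_iff)
  qed
  have Psi_g: "Psi m g = g" if "m \<in> ang" for m
    using zero(1)[OF that] ip.eq_0_iff[OF dV[OF that]] by simp
  \<comment> \<open>Some quadrature direction is transversal to the face, so its jump energy
    controls this jump. On boundary faces \<open>minus_poly\<close> is zero: the claim includes that
    \<open>g\<close> vanishes there, which is how vacuum inflow enters.\<close>
  have nojump: "plus_poly e g x = minus_poly e g x" if e: "e \<in> faces M" and x: "x \<in> e" for e x
  proof -
    note f = face_polytope[OF e] face_normal_outward[OF e]
    let ?s = "\<lambda>x. (face_jump e g x)\<^sup>2"
    have "face_normal M e \<noteq> 0" using f(2) by (auto simp: outward_unit_normal_def)
    then obtain m where m: "m \<in> ang" "dir Q m \<bullet> face_normal M e \<noteq> 0"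
      by (rule exists_dir_not_orthogonal)
    have "\<forall>e\<in>faces M. \<bar>dir Q m \<bullet> face_normal M e\<bar> / 2 * face_int e (\<lambda>x. (face_jump e g x)\<^sup>2) = 0"
      using zero(2)[OF m(1)] unfolding Psi_g[OF m(1)] jump_energy_def
      by (subst (asm) sum_nonneg_eq_0_iff[OF finite_faces])
         (auto intro!: mult_nonneg_nonneg face_integral_nonneg[OF face_polytope face_normal_outward])
    then have "face_int e ?s = 0" using e m(2) by auto
    from face_integral_eq_0[OF f _ _ this x] have "?s x = 0"
      using face_poly_continuous[OF g(1) e] by (simp add: continuous_on_power continuous_on_diff)
    then show ?thesis by simp
  qed
  have face0: "face_int e (\<lambda>x. w x * (face_jump e g x)) = 0" if e: "e \<in> faces M" for e w
    using face_integral_cong[OF face_polytope[OF e] face_normal_outward[OF e], of "\<lambda>x. w x * (face_jump e g x)" "\<lambda>x. 0 * 0"]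
      face_int_scale[OF e, of 0 "\<lambda>x. 0"] nojump[OF e] by simp
  \<comment> \<open>Passing to the reversed direction puts the jump and the derivative on
    \<open>g\<close>, so the face terms vanish; the mass terms cancel because the flux equals
    \<open>g\<close>.\<close>
  have volume: "(volume_term (dir Q m) v g) = 0"
    if m: "m \<in> ang" and v: "v \<in> V" for m v
  proof -
    have "st * ip g v = \<epsilon> * tf m g v" using Psi_hat(2)[OF m g(1) v] unfolding Psi_g[OF m] by simp
    also have "tf m g v = transport_form (sigma_t st \<epsilon>) (- dir Q m) v g"
      by (rule transport_form_adjoint[OF g(1) v norm_dir[OF m]])
    also have "\<dots> = (volume_term (dir Q m) v g)
        + sigma_t st \<epsilon> * ip v g"
      using g(1) by (simp add: transport_form_def face0 local_deriv_uminus set_lebesgue_integral_def sum_negf)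
    finally have "\<epsilon> * (volume_term (dir Q m) v g) = 0"
      using st_sigma ip.sym[OF g(1) v] by (simp add: distrib_left mult.assoc[symmetric])
    then show ?thesis using eps by simp
  qed
  \<comment> \<open>The test function is the broken directional derivative of \<open>g\<close>
    itself, which turns the volume identity into a sum of squares.\<close>
  have deriv0: "local_deriv g K (dir Q m) x = 0" if m: "m \<in> ang" and K: "K \<in> elems M" "x \<in> K" for m K x
  proof -
    define r where "r K = local_deriv g K (dir Q m)" for K
    have rp: "r K \<in> poly_space p" if "K \<in> elems M" for K unfolding r_def by (rule local_deriv_poly[OF g(1) that])
    have "(\<Sum>K\<in>elems M. LINT x:K|lborel. r K x * r K x) = 0"
      using volume[OF m broken_in_Vh[of r]] rp by (simp add: local_poly_broken) (simp add: r_def)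
    moreover have "0 \<le> (LINT x:K|lborel. r K x * r K x)" for K
      unfolding set_lebesgue_integral_def by (intro Bochner_Integration.integral_nonneg) simp
    ultimately have "(LINT x:K|lborel. r K x * r K x) = 0"
      using sum_nonneg_eq_0_iff[OF finite_elems, of "\<lambda>K. LINT x:K|lborel. r K x * r K x"] K by blast
    from set_integral_continuous_eq_0[OF _ elem_bounded[OF K(1)] elem_open[OF K(1)] _ this K(2)]
    have "r K x * r K x = 0" using poly_space_continuous_on[OF rp[OF K(1)]] by (simp add: continuous_on_mult)
    then show ?thesis by (simp add: r_def)
  qed
  \<comment> \<open>An arbitrary direction is, up to the factor \<open>CARD('d)\<close>, a
    combination of the quadrature directions.\<close>
  have grad0: "local_deriv g K h x = 0" if K: "K \<in> elems M" "x \<in> K" for K h x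
  proof -
    note lin = has_derivative_linear[OF local_poly_has_derivative[OF g(1) K(1)], of x]
    have "(1 / real CARD('d)) * local_deriv g K h x = local_deriv g K ((1 / real CARD('d)) *\<^sub>R h) x"
      using linear_scale[OF lin] by simp
    also have "\<dots> = (\<Sum>m=1..npts Q. (wt Q m * (dir Q m \<bullet> h)) * local_deriv g K (dir Q m) x)"
      unfolding sum_wt_dir[symmetric] linear_sum[OF lin] linear_scale[OF lin] by simp
    also have "\<dots> = 0" using deriv0 K by (intro sum.neutral) auto
    finally show ?thesis by simp
  qed
  have "\<exists>a. \<forall>x. local_poly g K x = a" if K: "K \<in> elems M" for K
  proof -
    obtain a where a: "a \<in> K" using elem_nonempty[OF K] by blast
    have "local_poly g K x = local_poly g K a" for x
      using poly_space_const_if_frechet_0[OF local_poly(1)[OF g(1) K] elem_open[OF K] a, of x]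
        grad0[OF K] unfolding local_deriv_def by blast
    then show ?thesis by blast
  qed
  then obtain a where a: "\<And>K x. K \<in> elems M \<Longrightarrow> local_poly g K x = a K" by metis
  \<comment> \<open>Two distinct elements with a common face are its plus and minus element, so the
    face is interior and the absence of a jump equates their constants.\<close>
  have shared: "a K = a K'" if K: "K \<in> elems M" "K' \<in> elems M" "elem_faces M K \<inter> elem_faces M K' \<noteq> {}" for K K'
  proof (cases "K = K'")
    case False
    obtain e where e: "e \<in> elem_faces M K" "e \<in> elem_faces M K'" using K(3) by blast
    have eF: "e \<in> faces M" by (rule elem_face_in_faces[OF K(1) e(1)])
    obtain x where x: "x \<in> e" using face_nonempty[OF eF] by blast
    have int: "e \<in> interior_faces M" and KK: "{K, K'} = {plus_elem M e, minus_elem M e}"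
      using adjacent_cases[OF K(1) e(1)] adjacent_cases[OF K(2) e(2)] False by auto
    have "a (plus_elem M e) = a (minus_elem M e)"
      using nojump[OF eF x] int plus_elem[OF eF] minus_elem[OF int] by (simp add: plus_poly_def minus_poly_def a)
    then show ?thesis using KK by (auto simp: doubleton_eq_iff)
  qed simp
  obtain K0 where K0: "K0 \<in> elems M" using elems_nonempty by blast
  have const: "a K = a K0" if K: "K \<in> elems M" for K
  proof -
    have "(K0, K) \<in> {(K1, K2). K1 \<in> elems M \<and> K2 \<in> elems M \<and> elem_faces M K1 \<inter> elem_faces M K2 \<noteq> {}}\<^sup>*"
      using mesh K K0 unfolding transport_mesh_def connected_mesh_def by blast
    then show ?thesis
    proof (induction rule: rtrancl_induct)
      case (step y z)
      then show ?case using shared[of y z] by simp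
    qed simp
  qed
  define m where "m = (1::nat)"
  have m: "m \<in> ang" using npts_pos by (simp add: m_def)
  \<comment> \<open>A coordinate function with derivative 1 along \<open>dir Q m\<close>, continuous
    across interior faces; testing with it isolates the integral of \<open>g\<close>.\<close>
  define r where "r K x = dir Q m \<bullet> x" for K :: "(real ^ 'd) set" and x :: "real ^ 'd"
  have rp: "r K \<in> poly_space p" for K unfolding r_def[abs_def] by (rule poly_space_inner[OF p1])
  define v where "v = broken r"
  have v: "v \<in> V" unfolding v_def using broken_in_Vh rp by blast
  have lv: "local_poly v K = r K" if "K \<in> elems M" for K unfolding v_def using local_poly_broken rp that by blast
  have dv: "local_deriv v K (dir Q m) x = 1" if K: "K \<in> elems M" for K x
  proof (rule local_deriv_unique[OF v K, where f = "\<lambda>h. dir Q m \<bullet> h", THEN trans])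
    show "(local_poly v K has_derivative (\<lambda>h. dir Q m \<bullet> h)) (at x)"
      unfolding lv[OF K] r_def[abs_def] by (auto intro!: derivative_eq_intros)
  qed (use norm_dir[OF m] in \<open>simp add: dot_square_norm\<close>)
  \<comment> \<open>On interior faces the coordinate has no jump; on boundary faces either upwind
    choice for \<open>g\<close> is zero.\<close>
  have faces0: "upwind_flux (dir Q m) e g v = 0"
    if e: "e \<in> faces M" for e
  proof -
    have "upwind_poly (dir Q m) e g x * (face_jump e v x) = 0" if x: "x \<in> e" for x
    proof (cases "e \<in> interior_faces M")
      case True
      then show ?thesis using plus_elem[OF e] minus_elem[OF True] by (simp add: plus_poly_def minus_poly_def lv r_def)
    next
      case False
      then have "minus_poly e g x = 0" by (simp add: minus_poly_def)
      then show ?thesis using nojump[OF e x] by (simp add: upwind_poly_def)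
    qed
    then show ?thesis
      using face_integral_cong[OF face_polytope[OF e] face_normal_outward[OF e],
          of "\<lambda>x. upwind_poly (dir Q m) e g x * (face_jump e v x)" "\<lambda>x. 0 * 0"]
        face_int_scale[OF e, of 0 "\<lambda>x. 0"] by simp
  qed
  have "st * ip g v = \<epsilon> * tf m g v" using Psi_hat(2)[OF m g(1) v] unfolding Psi_g[OF m] by simp
  also have "\<dots> = - \<epsilon> * (\<Sum>K\<in>elems M. LINT x:K|lborel. local_poly g K x) + (\<epsilon> * sigma_t st \<epsilon>) * ip g v"
    by (simp add: transport_form_def faces0 dv) (simp add: algebra_simps)
  finally have "(\<Sum>K\<in>elems M. LINT x:K|lborel. local_poly g K x) = 0" using st_sigma eps by simp
  \<comment> \<open>For a constant function, multiplying the vanishing integral by its value gives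
    the squared norm.\<close>
  then have "a K0 * (\<Sum>K\<in>elems M. LINT x:K|lborel. local_poly g K x) = 0" by simp
  moreover have "a K0 * (\<Sum>K\<in>elems M. LINT x:K|lborel. local_poly g K x)
      = (\<Sum>K\<in>elems M. LINT x:K|lborel. local_poly g K x * local_poly g K x)"
    unfolding sum_distrib_left
  proof (rule sum.cong[OF refl])
    fix K assume "K \<in> elems M"
    then have "local_poly g K = (\<lambda>x. a K0)" using a const by (simp add: fun_eq_iff)
    then show "a K0 * (LINT x:K|lborel. local_poly g K x) = (LINT x:K|lborel. local_poly g K x * local_poly g K x)"
      by simp
  qed
  ultimately have "ip g g = 0" unfolding l2_inner_Omega[OF g(1) g(1)] by simp
  then show False using ip.pos[OF g] by simp
qed


subsection \<open>Spectral consequences\<close>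

lemma Vh_nontrivial: "\<exists>v\<in>V. v \<noteq> 0"
proof -
  obtain K x where K: "K \<in> elems M" "x \<in> K" using elems_nonempty elem_nonempty by blast
  have "broken (\<lambda>K x. 1) \<in> V" by (intro broken_in_Vh poly_space_const)
  moreover have "broken (\<lambda>K x. 1) x = 1" by (rule broken_eq[OF K])
  ultimately show ?thesis by force
qed

lemma H_eigenbasis:
  obtains S l where "ip.orthonormal S" "S \<noteq> {}" "\<And>e. e \<in> S \<Longrightarrow> H e = l e *\<^sub>R e"
    "\<And>v. v \<in> V \<Longrightarrow> v = (\<Sum>e\<in>S. ip v e *\<^sub>R e)" "\<And>e. e \<in> S \<Longrightarrow> 0 < l e \<and> l e < 1"
proof -
  obtain S l where S: "ip.orthonormal S" "\<And>e. e \<in> S \<Longrightarrow> H e = l e *\<^sub>R e"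
    "\<And>v. v \<in> V \<Longrightarrow> v = (\<Sum>e\<in>S. ip v e *\<^sub>R e)"
    by (rule ip.symmetric_eigenbasis[of H]) (use H_in_Vh H_add H_scale H_symmetric in blast)+
  have "S \<noteq> {}"
  proof
    assume "S = {}"
    then have "v = 0" if "v \<in> V" for v using S(3)[OF that] by simp
    then show False using Vh_nontrivial by blast
  qed
  moreover have "0 < l e \<and> l e < 1" if e: "e \<in> S" for e
  proof -
    have eV: "e \<in> V" and ee: "ip e e = 1" using S(1) e unfolding ip.orthonormal_def by auto
    then have e0: "e \<noteq> 0" by auto
    have "ip (H e) e = l e" unfolding S(2)[OF e] ip.scale_left[OF eV eV] ee by simp
    then show ?thesis using H_pos[OF eV e0] eigenvalue_less_1[OF eV e0 S(2)[OF e]] by simp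
  qed
  ultimately show thesis using that S by blast
qed

end

section \<open>Operators and forms in coordinates of a fixed eigenbasis of the scalar
  response\<close>

locale transport_eigenbasis = transport_problem M p Q st sa \<epsilon>
  for M :: "'d::finite mesh" and p :: nat and Q :: "'d quadrature" and st sa \<epsilon> :: real +
  fixes S :: "(real ^ 'd \<Rightarrow> real) set" and l :: "(real ^ 'd \<Rightarrow> real) \<Rightarrow> real"
  assumes orth: "ip.orthonormal S" and S_ne: "S \<noteq> {}" and eig: "\<And>e. e \<in> S \<Longrightarrow> H_op M Q p st \<epsilon> e = l e *\<^sub>R e"
    and expand: "\<And>v. v \<in> Vh M p \<Longrightarrow> v = (\<Sum>e\<in>S. l2_inner (Omega M) v e *\<^sub>R e)"
    and l_pos: "\<And>e. e \<in> S \<Longrightarrow> 0 < l e" and l_less_1: "\<And>e. e \<in> S \<Longrightarrow> l e < 1"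
begin

lemma S_fin: "finite S" and S_V: "S \<subseteq> V" and S_orth: "e \<in> S \<Longrightarrow> f \<in> S \<Longrightarrow> ip e f = (if e = f then 1 else 0)"
  using orth unfolding ip.orthonormal_def by auto

lemma coord_ext:
  assumes "u \<in> V" "v \<in> V" "\<And>e. e \<in> S \<Longrightarrow> ip u e = ip v e" shows "u = v"
proof -
  have "u = (\<Sum>e\<in>S. ip u e *\<^sub>R e)" by (rule expand[OF assms(1)])
  also have "\<dots> = (\<Sum>e\<in>S. ip v e *\<^sub>R e)" using assms(3) by (intro sum.cong) auto
  also have "\<dots> = v" by (rule expand[OF assms(2), symmetric])
  finally show ?thesis .
qed

lemma nonzero_coord:
  assumes "v \<in> V" "v \<noteq> 0" obtains e where "e \<in> S" "ip v e \<noteq> 0"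
proof -
  have "\<exists>e\<in>S. ip v e \<noteq> 0"
  proof (rule ccontr)
    assume "\<not> ?thesis"
    then have "(\<Sum>e\<in>S. ip v e *\<^sub>R e) = 0" by (intro sum.neutral) auto
    then show False using expand[OF assms(1)] assms(2) by simp
  qed
  then show thesis using that by blast
qed

lemma comb_in_Vh: "(\<Sum>e\<in>S. k e *\<^sub>R e) \<in> V"
  using S_V by (intro subspace_sum[OF subspace_Vh] subspace_scale[OF subspace_Vh]) auto

lemma coord_comb: "e \<in> S \<Longrightarrow> ip (\<Sum>e\<in>S. k e *\<^sub>R e) e = k e"
  by (rule ip.orthonormal_sum_coord[OF orth])

lemma parseval:
  assumes "u \<in> V" "v \<in> V" shows "ip u v = (\<Sum>e\<in>S. ip u e * ip v e)"
proof -
  have "ip u v = ip (\<Sum>e\<in>S. ip u e *\<^sub>R e) v" using expand[OF assms(1)] by simp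
  also have "\<dots> = (\<Sum>e\<in>S. ip (ip u e *\<^sub>R e) v)"
    using S_V subspace_scale[OF subspace_Vh] assms by (intro ip.sum_left) auto
  also have "\<dots> = (\<Sum>e\<in>S. ip u e * ip v e)"
  proof (rule sum.cong[OF refl])
    fix e assume "e \<in> S"
    then have "e \<in> V" using S_V by blast
    then show "ip (ip u e *\<^sub>R e) v = ip u e * ip v e"
      using ip.scale_left[OF _ assms(2)] ip.sym[OF _ assms(2)] by metis
  qed
  finally show ?thesis .
qed

lemma coord_H: assumes "v \<in> V" "e \<in> S" shows "ip (H v) e = l e * ip v e"
proof -
  have eV: "e \<in> V" using assms(2) S_V by blast
  show ?thesis unfolding H_symmetric[OF assms(1) eV] eig[OF assms(2)] by (rule ip.scale_right[OF eV assms(1)])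
qed

text \<open>On coordinates \<open>H\<close> is multiplication by the positive numbers
  \<open>l e\<close>, so a preimage is found by division. Bijectivity on \<open>V\<close> makes
  \<open>inv_into V H\<close> a genuine two-sided inverse there.\<close>

lemma H_bij: "bij_betw H V V"
proof (rule bij_betwI')
  fix u v assume uv: "u \<in> V" "v \<in> V"
  show "H u = H v \<longleftrightarrow> u = v"
  proof
    assume eq: "H u = H v"
    show "u = v"
    proof (rule coord_ext[OF uv])
      fix e assume e: "e \<in> S"
      have "l e * ip u e = l e * ip v e" by (simp only: coord_H[OF uv(1) e, symmetric] coord_H[OF uv(2) e, symmetric] eq)
      then show "ip u e = ip v e" using l_pos[OF e] by simp
    qed
  qed simp
next
  fix v assume v: "v \<in> V"
  let ?u = "\<Sum>e\<in>S. (ip v e / l e) *\<^sub>R e"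
  have "v = H ?u"
  proof (rule coord_ext[OF v H_in_Vh[OF comb_in_Vh]])
    fix e assume e: "e \<in> S"
    show "ip v e = ip (H ?u) e" unfolding coord_H[OF comb_in_Vh e] coord_comb[OF e] using l_pos[OF e] by simp
  qed
  then show "\<exists>u\<in>V. v = H u" by (rule bexI[where x = ?u]) (rule comb_in_Vh)
qed (rule H_in_Vh)

lemma inv_H:
  assumes "v \<in> V"
  shows "inv_into V H v \<in> V" and "H (inv_into V H v) = v" and "inv_into V H (H v) = v"
    and "e \<in> S \<Longrightarrow> ip (inv_into V H v) e = ip v e / l e"
proof -
  show i: "inv_into V H v \<in> V" and h: "H (inv_into V H v) = v"
    using assms H_bij by (auto simp: bij_betw_def inv_into_into f_inv_into_f)
  show "inv_into V H (H v) = v" using assms H_bij by (simp add: bij_betw_def)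
  show "ip (inv_into V H v) e = ip v e / l e" if "e \<in> S"
    using coord_H[OF i that] l_pos[OF that] unfolding h by simp
qed

lemma a_ex_eq:
  assumes "u \<in> V" "v \<in> V"
  shows "aex u v = st / \<epsilon> * ip (inv_into V H u - c *\<^sub>R u) v"
proof -
  have "(\<lambda>x. st * (inv_into V H u x - c * u x)) = (\<lambda>x. st * (inv_into V H u - c *\<^sub>R u) x)" by simp
  then show ?thesis by (simp add: a_ex_def ip_scale_fun del: minus_apply scaleR_fun_apply)
qed

lemma a_ex_diag:
  assumes "v \<in> V"
  shows "aex v v = st / \<epsilon> * (\<Sum>e\<in>S. (1 / l e - c) * (ip v e)\<^sup>2)"
proof -
  have cv: "c *\<^sub>R v \<in> V" and d: "inv_into V H v - c *\<^sub>R v \<in> V"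
    using assms inv_H(1) subspace_scale[OF subspace_Vh] subspace_diff[OF subspace_Vh] by auto
  have "ip (inv_into V H v - c *\<^sub>R v) e = (1 / l e - c) * ip v e" if e: "e \<in> S" for e
  proof -
    have eV: "e \<in> V" using e S_V by blast
    show ?thesis
      unfolding ip.diff_left[OF inv_H(1)[OF assms] cv eV] ip.scale_left[OF assms eV] inv_H(4)[OF assms e]
      by (simp add: algebra_simps)
  qed
  then have "ip (inv_into V H v - c *\<^sub>R v) v = (\<Sum>e\<in>S. (1 / l e - c) * (ip v e)\<^sup>2)"
    unfolding parseval[OF d assms] by (intro sum.cong) (simp_all add: power2_eq_square)
  then show ?thesis by (simp add: a_ex_eq[OF assms assms])
qed

text \<open>Both \<open>l e\<close> and \<open>c\<close> are below 1. These weights are the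
  eigenvalues of the inverse of \<open>H\<close> minus \<open>c\<close>, so their positivity makes
  the exact correction form definite.\<close>

lemma weight_pos: "e \<in> S \<Longrightarrow> 0 < 1 / l e - c"
proof -
  assume e: "e \<in> S"
  have "1 < 1 / l e" using l_pos[OF e] l_less_1[OF e] by (simp add: field_simps)
  then show ?thesis using c_bounds by linarith
qed

lemma a_ex_pos: assumes "v \<in> V" "v \<noteq> 0" shows "0 < aex v v"
proof -
  obtain e where e: "e \<in> S" "ip v e \<noteq> 0" by (rule nonzero_coord[OF assms])
  have "0 \<le> (1 / l f - c) * (ip v f)\<^sup>2" if "f \<in> S" for f using weight_pos[OF that] by simp
  moreover have "0 < (1 / l e - c) * (ip v e)\<^sup>2" using weight_pos[OF e(1)] e(2) by simp
  ultimately have "0 < (\<Sum>e\<in>S. (1 / l e - c) * (ip v e)\<^sup>2)" by (intro sum_pos2[OF S_fin e(1)])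
  then show ?thesis unfolding a_ex_diag[OF assms(1)] using st eps by simp
qed

text \<open>The closed form that \<open>G_op\<close> will be identified with;
  \<open>restrict\<close> supplies the extensionality demanded there.\<close>

definition G :: "(real ^ 'd \<Rightarrow> real) \<Rightarrow> real ^ 'd \<Rightarrow> real" where
  "G = restrict (\<lambda>g. c *\<^sub>R H g) V"

lemma G_in_Vh: "v \<in> V \<Longrightarrow> G v \<in> V" and G_eq: "v \<in> V \<Longrightarrow> G v = c *\<^sub>R H v"
  using H_in_Vh subspace_scale[OF subspace_Vh] by (auto simp: G_def simp del: scaleR_fun_apply)

lemma coord_G: assumes "v \<in> V" "e \<in> S" shows "ip (G v) e = c * l e * ip v e"
proof -
  have eV: "e \<in> V" using assms(2) S_V by blast
  show ?thesis unfolding G_eq[OF assms(1)] ip.scale_left[OF H_in_Vh[OF assms(1)] eV] coord_H[OF assms] by simp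
qed

lemma coord_eq_iff: "u \<in> V \<Longrightarrow> v \<in> V \<Longrightarrow> u = v \<longleftrightarrow> (\<forall>e\<in>S. ip u e = ip v e)"
  using coord_ext by blast

lemma lincomb_fun: "(\<lambda>x. a * u x + b * v x) = a *\<^sub>R u + b *\<^sub>R v" for u v :: "real ^ 'd \<Rightarrow> real"
  by (simp add: fun_eq_iff)

lemma lincomb_in_Vh: "u \<in> V \<Longrightarrow> v \<in> V \<Longrightarrow> a *\<^sub>R u + b *\<^sub>R v \<in> V"
  by (intro subspace_add[OF subspace_Vh] subspace_scale[OF subspace_Vh])

lemma max_eigenvalue:
  obtains e where "e \<in> S" "l e = Max (l ` S)" "\<And>f. f \<in> S \<Longrightarrow> l f \<le> l e"
proof -
  have "Max (l ` S) \<in> l ` S" using S_fin S_ne by (intro Max_in) auto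
  then obtain e where e: "e \<in> S" "l e = Max (l ` S)" by auto
  moreover have "l f \<le> l e" if "f \<in> S" for f unfolding e(2) using that S_fin by (intro Max_ge) auto
  ultimately show thesis using that by blast
qed

lemma eigenvector_basis: "e \<in> S \<Longrightarrow> e \<in> V" "e \<in> S \<Longrightarrow> e \<noteq> (\<lambda>x. 0)"
  using S_V S_orth[of e e] ip.zero_left[of e] by (auto simp: zero_fun_def)

text \<open>An eigenvector has some nonzero coordinate, and comparing that coordinate identifies its
  eigenvalue as one of the \<open>l e\<close>; hence \<open>Max\<close> is taken over a finite
  nonempty set.\<close>

lemma lambda_max_eq: "lambda_max V H = Max (l ` S)"
proof -
  have "{k. \<exists>u\<in>V. u \<noteq> (\<lambda>x. 0) \<and> H u = (\<lambda>x. k * u x)} = l ` S"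
  proof safe
    fix k u assume u: "u \<in> V" "u \<noteq> (\<lambda>x. 0)" "H u = (\<lambda>x. k * u x)"
    have Hk: "H u = k *\<^sub>R u" using u(3) by (simp add: fun_eq_iff)
    have "u \<noteq> 0" using u(2) by (simp add: zero_fun_def)
    then obtain e where e: "e \<in> S" "ip u e \<noteq> 0" by (rule nonzero_coord[OF u(1)])
    then have "l e * ip u e = k * ip u e"
      using coord_H[OF u(1) e(1)] ip.scale_left[OF u(1), of e k] S_V unfolding Hk by auto
    then show "k \<in> l ` S" using e by auto
  next
    fix e assume e: "e \<in> S"
    then show "\<exists>u\<in>V. u \<noteq> (\<lambda>x. 0) \<and> H u = (\<lambda>x. l e * u x)"
      using eigenvector_basis[OF e] eig[OF e] by (intro bexI[of _ e]) (auto simp: fun_eq_iff)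
  qed
  then show ?thesis by (simp add: lambda_max_def)
qed

lemma spectral_radius_eq: "spectral_radius V G = c * Max (l ` S)"
proof -
  have "{z. complex_eigenvalue V G z} = (\<lambda>e. complex_of_real (c * l e)) ` S"
  proof safe
    fix z assume "complex_eigenvalue V G z"
    then obtain u v where V: "u \<in> V" "v \<in> V" and nz: "u \<noteq> (\<lambda>x. 0) \<or> v \<noteq> (\<lambda>x. 0)"
      and Guv: "G u = (\<lambda>x. Re z * u x - Im z * v x)" "G v = (\<lambda>x. Im z * u x + Re z * v x)"
      unfolding complex_eigenvalue_def by blast
    have uv: "u \<in> V" "v \<in> V" "u \<noteq> 0 \<or> v \<noteq> 0"
      "G u = Re z *\<^sub>R u + (- Im z) *\<^sub>R v" "G v = Im z *\<^sub>R u + Re z *\<^sub>R v"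
      subgoal by (rule V(1))
      subgoal by (rule V(2))
      subgoal using nz by (simp add: zero_fun_def)
      subgoal by (rule trans[OF Guv(1)]) (rule ext, simp)
      subgoal by (rule trans[OF Guv(2)]) (rule ext, simp)
      done
    have "\<exists>e\<in>S. ip u e \<noteq> 0 \<or> ip v e \<noteq> 0"
    proof (cases "u = 0")
      case True
      then have "v \<noteq> 0" using uv(3) by blast
      then obtain e where "e \<in> S" "ip v e \<noteq> 0" by (rule nonzero_coord[OF uv(2)])
      then show ?thesis by blast
    next
      case False
      then obtain e where "e \<in> S" "ip u e \<noteq> 0" by (rule nonzero_coord[OF uv(1)])
      then show ?thesis by blast
    qed
    then obtain e where e: "e \<in> S" "ip u e \<noteq> 0 \<or> ip v e \<noteq> 0" by blast
    have eV: "e \<in> V" using e S_V by blast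
    \<comment> \<open>The two relations below form a linear system for the coordinates of
      \<open>u\<close> and \<open>v\<close> whose determinant is the sum of the squares of
      \<open>\<delta>\<close> and \<open>Im z\<close>. A nonzero coordinate forces it to vanish, so
      \<open>z\<close> is real and equal to \<open>c * l e\<close>.\<close>
    define \<delta> where "\<delta> = c * l e - Re z"
    have 1: "\<delta> * ip u e = - Im z * ip v e"
      using coord_G[OF uv(1) e(1)] unfolding uv(4) ip.form_lincomb[OF uv(1,2) eV] by (simp add: \<delta>_def algebra_simps)
    have 2: "\<delta> * ip v e = Im z * ip u e"
      using coord_G[OF uv(2) e(1)] unfolding uv(5) ip.form_lincomb[OF uv(1,2) eV] by (simp add: \<delta>_def algebra_simps)
    have "(\<delta>\<^sup>2 + (Im z)\<^sup>2) * ip u e = \<delta> * (\<delta> * ip u e) + Im z * (Im z * ip u e)"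
      by (simp add: power2_eq_square algebra_simps)
    also have "\<dots> = 0" unfolding 1 2[symmetric] by simp
    finally have 3: "(\<delta>\<^sup>2 + (Im z)\<^sup>2) * ip u e = 0" .
    have "(\<delta>\<^sup>2 + (Im z)\<^sup>2) * ip v e = \<delta> * (\<delta> * ip v e) - Im z * (- Im z * ip v e)"
      by (simp add: power2_eq_square algebra_simps)
    also have "\<dots> = 0" unfolding 2 1[symmetric] by simp
    finally have "(\<delta>\<^sup>2 + (Im z)\<^sup>2) * ip v e = 0" .
    with 3 e(2) have "\<delta>\<^sup>2 + (Im z)\<^sup>2 = 0" by auto
    then have "\<delta> = 0" "Im z = 0" by (simp_all add: sum_power2_eq_zero_iff)
    then have "z = complex_of_real (c * l e)" by (simp add: complex_eq_iff \<delta>_def)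
    then show "z \<in> (\<lambda>e. complex_of_real (c * l e)) ` S" using e(1) by blast
  next
    fix e assume e: "e \<in> S"
    have "G e = (\<lambda>x. c * l e * e x)"
      using G_eq[OF eigenvector_basis(1)[OF e]] eig[OF e] by (simp add: fun_eq_iff)
    \<comment> \<open>For the converse, \<open>e\<close> is taken as the real part of the complex
      eigenvector and 0 as its imaginary part.\<close>
    moreover have "G 0 = (\<lambda>x. 0)"
      using G_eq[OF subspace_0[OF subspace_Vh]] H_scale[OF subspace_0[OF subspace_Vh], of 0] by (simp add: fun_eq_iff)
    ultimately show "complex_eigenvalue V G (complex_of_real (c * l e))"
      unfolding complex_eigenvalue_def
      using eigenvector_basis[OF e] subspace_0[OF subspace_Vh]
      by (intro bexI[of _ e] bexI[of _ 0]) auto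
  qed
  moreover have "cmod (complex_of_real (c * l e)) = c * l e" if "e \<in> S" for e
    unfolding norm_of_real by (intro abs_of_pos mult_pos_pos c_bounds l_pos that)
  ultimately have "cmod ` {z. complex_eigenvalue V G z} = (\<lambda>e. c * l e) ` S"
    by (simp only: image_image cong: image_cong)
  then have "spectral_radius V G = Max ((\<lambda>e. c * l e) ` S)" by (simp add: spectral_radius_def)
  also have "\<dots> = c * Max (l ` S)"
  proof -
    obtain e where e: "e \<in> S" "l e = Max (l ` S)" "\<And>f. f \<in> S \<Longrightarrow> l f \<le> l e" by (rule max_eigenvalue) blast
    show ?thesis
      by (rule Max_eqI) (use e c_bounds S_fin in \<open>auto simp: e(2)[symmetric] intro!: mult_left_mono\<close>)
  qed
  finally show ?thesis .
qed

text \<open>In coordinates the squared norm is a weighted sum of squares and \<open>G\<close>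
  multiplies each coordinate by \<open>c * l f\<close>. The largest factor bounds the quotient, and
  a basis vector with the largest \<open>l\<close> attains it.\<close>

lemma op_norm_ex_eq: "op_norm_ex M Q p st sa \<epsilon> G = c * Max (l ` S)"
proof -
  obtain e where e: "e \<in> S" "l e = Max (l ` S)" "\<And>f. f \<in> S \<Longrightarrow> l f \<le> l e" by (rule max_eigenvalue) blast
  define L where "L = c * l e"
  have L0: "L > 0" using c_bounds l_pos[OF e(1)] by (simp add: L_def)
  let ?n = nex
  have pos: "0 < ?n v" if "v \<in> V" "v \<noteq> (\<lambda>x. 0)" for v
    using a_ex_pos[of v] that by (simp add: norm_ex_def zero_fun_def)
  have le: "?n (G v) \<le> L * ?n v" if v: "v \<in> V" for v
  proof -
    have "(\<Sum>f\<in>S. (1 / l f - c) * (ip (G v) f)\<^sup>2) \<le> (\<Sum>f\<in>S. L\<^sup>2 * ((1 / l f - c) * (ip v f)\<^sup>2))"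
    proof (rule sum_mono)
      fix f assume f: "f \<in> S"
      have "c * l f \<le> L" unfolding L_def using e(3)[OF f] c_bounds by simp
      then have "(c * l f)\<^sup>2 \<le> L\<^sup>2" using c_bounds l_pos[OF f] by (intro power_mono) auto
      then have "(c * l f)\<^sup>2 * ((1 / l f - c) * (ip v f)\<^sup>2) \<le> L\<^sup>2 * ((1 / l f - c) * (ip v f)\<^sup>2)"
        using weight_pos[OF f] by (intro mult_right_mono) auto
      then show "(1 / l f - c) * (ip (G v) f)\<^sup>2 \<le> L\<^sup>2 * ((1 / l f - c) * (ip v f)\<^sup>2)"
        unfolding coord_G[OF v f] by (simp add: power_mult_distrib mult.left_commute)
    qed
    then have "aex (G v) (G v) \<le> L\<^sup>2 * aex v v"
      unfolding a_ex_diag[OF G_in_Vh[OF v]] a_ex_diag[OF v] sum_distrib_left[symmetric]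
      using st eps by (simp add: mult.left_commute[of "L\<^sup>2"] divide_right_mono)
    then have "?n (G v) \<le> sqrt (L\<^sup>2 * aex v v)" by (simp add: norm_ex_def)
    then show ?thesis using L0 by (simp add: norm_ex_def real_sqrt_mult)
  qed
  have Ge: "?n (G e) = L * ?n e"
  proof -
    have eV: "e \<in> V" using eigenvector_basis[OF e(1)] by blast
    have "(\<Sum>f\<in>S. (1 / l f - c) * (ip (G e) f)\<^sup>2) = (\<Sum>f\<in>S. L\<^sup>2 * ((1 / l f - c) * (ip e f)\<^sup>2))"
    proof (rule sum.cong[OF refl])
      fix f assume f: "f \<in> S"
      show "(1 / l f - c) * (ip (G e) f)\<^sup>2 = L\<^sup>2 * ((1 / l f - c) * (ip e f)\<^sup>2)"
        unfolding coord_G[OF eV f] using S_orth[OF e(1) f] by (cases "e = f") (auto simp: L_def)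
    qed
    then have "aex (G e) (G e) = L\<^sup>2 * aex e e"
      unfolding a_ex_diag[OF G_in_Vh[OF eV]] a_ex_diag[OF eV] sum_distrib_left[symmetric] by simp
    then show ?thesis using L0 by (simp add: norm_ex_def real_sqrt_mult)
  qed
  have "op_norm_ex M Q p st sa \<epsilon> G = L"
    unfolding op_norm_ex_def
  proof (rule cSup_eq_maximum)
    have "?n (G e) / ?n e = L" using Ge pos[OF eigenvector_basis[OF e(1)]] by simp
    then show "L \<in> (\<lambda>v. ?n (G v) / ?n v) ` (V - {\<lambda>x. 0})"
      using eigenvector_basis[OF e(1)] by (intro image_eqI[of _ _ e]) auto
    fix x assume "x \<in> (\<lambda>v. ?n (G v) / ?n v) ` (V - {\<lambda>x. 0})"
    then obtain v where v: "v \<in> V" "v \<noteq> (\<lambda>x. 0)" "x = ?n (G v) / ?n v" by blast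
    show "x \<le> L" unfolding v(3) pos_divide_le_eq[OF pos[OF v(1,2)]] by (rule le[OF v(1)])
  qed
  then show ?thesis by (simp add: L_def e(2))
qed

subsection \<open>Source iteration\<close>

text \<open>The source equals \<open>st / \<epsilon>\<close> times
  \<open>c *\<^sub>R \<phi> + (\<epsilon> / st) *\<^sub>R q\<close>, so every transport solve of the
  iteration is a directional response.\<close>

lemma transport_solution_iff:
  assumes m: "m \<in> ang" and \<phi>: "\<phi> \<in> V" and q: "q \<in> V" and \<psi>: "\<psi> \<in> V"
  shows "(\<forall>v\<in>V. bf m \<psi> v = ip (rhs q \<phi>) v)
    \<longleftrightarrow> \<psi> = Psi m (c *\<^sub>R \<phi> + (\<epsilon> / st) *\<^sub>R q)"
proof -
  let ?f = "c *\<^sub>R \<phi> + (\<epsilon> / st) *\<^sub>R q"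
  have fV: "?f \<in> V" by (rule lincomb_in_Vh[OF \<phi> q])
  have "sigma_s st sa \<epsilon> = c * (st / \<epsilon>)" using sigma_s_eq eps by (simp add: field_simps)
  then have f: "(rhs q \<phi>) = (\<lambda>x. (st / \<epsilon>) * ?f x)"
    using st eps by (simp add: fun_eq_iff field_simps)
  have eq: "bf m \<psi> v = ip (rhs q \<phi>) v \<longleftrightarrow> \<epsilon> * tf m \<psi> v = st * ip ?f v"
    if "v \<in> V" for v
    unfolding f ip_scale_fun bform_eq[OF \<psi> that] using eps by (auto simp: field_simps simp del: plus_fun_apply scaleR_fun_apply)
  show ?thesis
  proof
    assume "\<forall>v\<in>V. bf m \<psi> v = ip (rhs q \<phi>) v"
    then show "\<psi> = Psi m ?f" using eq by (intro Psi_hat(3)[OF m fV \<psi>]) blast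
  next
    assume "\<psi> = Psi m ?f"
    then show "\<forall>v\<in>V. bf m \<psi> v = ip (rhs q \<phi>) v"
      using eq Psi_hat(2)[OF m fV] by blast
  qed
qed

lemma phi_half_eq:
  assumes "\<phi> \<in> V" "q \<in> V"
  shows "phi_half M Q p st sa \<epsilon> q \<phi> = H (c *\<^sub>R \<phi> + (\<epsilon> / st) *\<^sub>R q)"
proof -
  let ?f = "c *\<^sub>R \<phi> + (\<epsilon> / st) *\<^sub>R q"
  have fV: "?f \<in> V" by (rule lincomb_in_Vh[OF assms])
  have "psi_half M Q p st sa \<epsilon> q \<phi> m = Psi m ?f" if m: "m \<in> ang" for m
    unfolding psi_half_def
  proof (rule the_equality)
    show "Psi m ?f \<in> V \<and> (\<forall>v\<in>V. bf m (Psi m ?f) v = ip (rhs q \<phi>) v)"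
      using Psi_hat(1)[OF m fV] transport_solution_iff[OF m assms Psi_hat(1)[OF m fV]] by blast
    show "\<psi> = Psi m ?f" if "\<psi> \<in> V \<and> (\<forall>v\<in>V. bf m \<psi> v = ip (rhs q \<phi>) v)" for \<psi>
      using transport_solution_iff[OF m assms] that by blast
  qed
  then show ?thesis by (simp add: phi_half_def H_op_def fun_eq_iff)
qed

text \<open>The discrete solution is the fixed point of an affine map. In coordinates the equation
  is \<open>(1 - c * l e) * ip \<phi> e = \<epsilon> / st * l e * ip q e\<close>, uniquely solvable
  since \<open>c * l e < 1\<close>; this resolves the definite description.\<close>

lemma phi_star:
  assumes q: "q \<in> V"
  shows "star q \<in> V"
    and "star q = H (c *\<^sub>R star q + (\<epsilon> / st) *\<^sub>R q)"
proof -
  define P where "P \<phi> \<longleftrightarrow> \<phi> \<in> V \<and> \<phi> = H (c *\<^sub>R \<phi> + (\<epsilon> / st) *\<^sub>R q)" for \<phi>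
  have iff: "(\<phi> \<in> V \<and> (\<exists>\<psi>. (\<forall>m\<in>ang. \<psi> m \<in> V \<and>
        (\<forall>v\<in>V. bf m (\<psi> m) v = ip (rhs q \<phi>) v)) \<and>
          \<phi> = (\<lambda>x. \<Sum>m=1..npts Q. wt Q m * \<psi> m x))) \<longleftrightarrow> P \<phi>" for \<phi>
  proof (cases "\<phi> \<in> V")
    case True
    let ?f = "c *\<^sub>R \<phi> + (\<epsilon> / st) *\<^sub>R q"
    have fV: "?f \<in> V" by (rule lincomb_in_Vh[OF True q])
    have "(\<forall>m\<in>ang. \<psi> m \<in> V \<and> (\<forall>v\<in>V. bf m (\<psi> m) v = ip (rhs q \<phi>) v))
        \<longleftrightarrow> (\<forall>m\<in>ang. \<psi> m = Psi m ?f)" for \<psi>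
    proof (rule ball_cong[OF refl])
      fix m assume m: "m \<in> ang"
      show "\<psi> m \<in> V \<and> (\<forall>v\<in>V. bf m (\<psi> m) v = ip (rhs q \<phi>) v)
        \<longleftrightarrow> \<psi> m = Psi m ?f"
      proof (cases "\<psi> m \<in> V")
        case \<psi>: True
        then show ?thesis unfolding transport_solution_iff[OF m True q \<psi>] by blast
      next
        case False
        then show ?thesis using Psi_hat(1)[OF m fV] by metis
      qed
    qed
    then have "(\<exists>\<psi>. (\<forall>m\<in>ang. \<psi> m \<in> V \<and>
        (\<forall>v\<in>V. bf m (\<psi> m) v = ip (rhs q \<phi>) v)) \<and>
          \<phi> = (\<lambda>x. \<Sum>m=1..npts Q. wt Q m * \<psi> m x))
      \<longleftrightarrow> (\<exists>\<psi>. (\<forall>m\<in>ang. \<psi> m = Psi m ?f) \<and> \<phi> = (\<lambda>x. \<Sum>m=1..npts Q. wt Q m * \<psi> m x))"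
      by (simp only:)
    also have "\<dots> \<longleftrightarrow> \<phi> = H ?f"
    proof
      assume "\<exists>\<psi>. (\<forall>m\<in>ang. \<psi> m = Psi m ?f) \<and> \<phi> = (\<lambda>x. \<Sum>m=1..npts Q. wt Q m * \<psi> m x)"
      then obtain \<psi> where \<psi>: "\<And>m. m \<in> ang \<Longrightarrow> \<psi> m = Psi m ?f" "\<phi> = (\<lambda>x. \<Sum>m=1..npts Q. wt Q m * \<psi> m x)" by blast
      show "\<phi> = H ?f" by (subst \<psi>(2)) (simp add: H_op_def \<psi>(1))
    next
      assume "\<phi> = H ?f"
      then show "\<exists>\<psi>. (\<forall>m\<in>ang. \<psi> m = Psi m ?f) \<and> \<phi> = (\<lambda>x. \<Sum>m=1..npts Q. wt Q m * \<psi> m x)"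
        by (intro exI[of _ "\<lambda>m. Psi m ?f"]) (simp add: H_op_def)
    qed
    finally show ?thesis using True by (simp only: P_def)
  qed (simp add: P_def)
  have coordP: "(1 - c * l e) * ip \<phi> e = \<epsilon> / st * l e * ip q e \<longleftrightarrow> ip \<phi> e = ip (H (c *\<^sub>R \<phi> + (\<epsilon> / st) *\<^sub>R q)) e"
    if \<phi>: "\<phi> \<in> V" and e: "e \<in> S" for \<phi> e
    unfolding coord_H[OF lincomb_in_Vh[OF \<phi> q] e] ip.form_lincomb[OF \<phi> q eigenvector_basis(1)[OF e]]
    by (auto simp: algebra_simps)
  have cl: "1 - c * l e > 0" if e: "e \<in> S" for e
    using mult_strict_mono[of c 1 "l e" 1] c_bounds l_pos[OF e] l_less_1[OF e] by simp
  define \<phi>0 where "\<phi>0 = (\<Sum>e\<in>S. (\<epsilon> / st * l e * ip q e / (1 - c * l e)) *\<^sub>R e)"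
  have \<phi>0: "\<phi>0 \<in> V" unfolding \<phi>0_def by (rule comb_in_Vh)
  have c0: "ip \<phi>0 e = \<epsilon> / st * l e * ip q e / (1 - c * l e)" if "e \<in> S" for e
    unfolding \<phi>0_def by (rule coord_comb[OF that])
  have P_iff: "P \<phi> \<longleftrightarrow> \<phi> = \<phi>0" for \<phi>
  proof (cases "\<phi> \<in> V")
    case True
    have "P \<phi> \<longleftrightarrow> (\<forall>e\<in>S. ip \<phi> e = ip (H (c *\<^sub>R \<phi> + (\<epsilon> / st) *\<^sub>R q)) e)"
      unfolding P_def using coord_eq_iff[OF True H_in_Vh[OF lincomb_in_Vh[OF True q]]] True by blast
    also have "\<dots> \<longleftrightarrow> (\<forall>e\<in>S. ip \<phi> e = ip \<phi>0 e)"
    proof (rule ball_cong[OF refl])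
      fix e assume e: "e \<in> S"
      have ne: "1 - c * l e \<noteq> 0" using cl[OF e] by simp
      show "ip \<phi> e = ip (H (c *\<^sub>R \<phi> + (\<epsilon> / st) *\<^sub>R q)) e \<longleftrightarrow> ip \<phi> e = ip \<phi>0 e"
        unfolding coordP[OF True e, symmetric] c0[OF e] nonzero_eq_divide_eq[OF ne] by (simp only: mult.commute)
    qed
    also have "\<dots> \<longleftrightarrow> \<phi> = \<phi>0" using coord_eq_iff[OF True \<phi>0] by blast
    finally show ?thesis .
  next
    case False
    then show ?thesis using \<phi>0 by (auto simp: P_def)
  qed
  have "star q = (THE \<phi>. P \<phi>)" unfolding phi_star_def iff ..
  also have "\<dots> = \<phi>0" unfolding P_iff by simp
  finally have "P (star q)" unfolding P_iff .
  then show "star q \<in> V"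
    "star q = H (c *\<^sub>R star q + (\<epsilon> / st) *\<^sub>R q)"
    unfolding P_def by blast+
qed

lemma err_in_Vh: "q \<in> V \<Longrightarrow> \<phi> \<in> V \<Longrightarrow> error q \<phi> \<in> V"
  and err_eq: "error q \<phi> = star q - \<phi>"
proof -
  show e: "error q \<phi> = star q - \<phi>" by (simp add: err_def fun_eq_iff)
  show "q \<in> V \<Longrightarrow> \<phi> \<in> V \<Longrightarrow> error q \<phi> \<in> V"
    unfolding e by (intro subspace_diff[OF subspace_Vh] phi_star(1))
qed

text \<open>The predictor is the same affine map evaluated at the iterate; subtracting it from the
  fixed-point equation cancels the source \<open>q\<close>.\<close>

lemma err_half_eq:
  assumes q: "q \<in> V" and \<phi>: "\<phi> \<in> V"
  shows "half_error q \<phi> = c *\<^sub>R H (error q \<phi>)"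
proof -
  let ?s = "star q" and ?b = "(\<epsilon> / st) *\<^sub>R q"
  note s = phi_star(1)[OF q]
  note d = err_in_Vh[OF q \<phi>]
  have eq: "c *\<^sub>R ?s + ?b = c *\<^sub>R error q \<phi> + (c *\<^sub>R \<phi> + ?b)"
    by (simp add: err_eq scaleR_diff_right del: scaleR_fun_apply)
  have "?s = H (c *\<^sub>R error q \<phi> + (c *\<^sub>R \<phi> + ?b))"
    unfolding eq[symmetric] by (rule phi_star(2)[OF q])
  also have "\<dots> = c *\<^sub>R H (error q \<phi>) + H (c *\<^sub>R \<phi> + ?b)"
    unfolding H_add[OF subspace_scale[OF subspace_Vh d] lincomb_in_Vh[OF \<phi> q]] H_scale[OF d] ..
  finally have "?s - phi_half M Q p st sa \<epsilon> q \<phi> = c *\<^sub>R H (error q \<phi>)"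
    unfolding phi_half_eq[OF \<phi> q] by (metis add_diff_cancel_right')
  then show ?thesis by (simp add: err_half_def fun_eq_iff)
qed

text \<open>Uniqueness holds because every \<open>g\<close> in \<open>Vh\<close> is the error of
  some iterate, namely of \<open>star q - g\<close>, so a propagator is determined on the whole
  space.\<close>

lemma G_op_eq:
  assumes q: "q \<in> V"
  shows "G_op M Q p st sa \<epsilon> q = G"
  unfolding G_op_def
proof (rule the_equality)
  have "G (\<lambda>x. a * u x + b * v x) = (\<lambda>x. a * G u x + b * G v x)" if uv: "u \<in> V" "v \<in> V" for u v a b
    unfolding lincomb_fun G_eq[OF lincomb_in_Vh[OF uv]] G_eq[OF uv(1)] G_eq[OF uv(2)]
      H_add[OF subspace_scale[OF subspace_Vh uv(1)] subspace_scale[OF subspace_Vh uv(2)]] H_scale[OF uv(1)] H_scale[OF uv(2)]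
    by (simp add: fun_eq_iff algebra_simps)
  then have "linear_map_on V G" unfolding linear_map_on_def using G_in_Vh by blast
  moreover have "half_error q \<phi> = G (error q \<phi>)" if "\<phi> \<in> V" for \<phi>
    unfolding err_half_eq[OF q that] G_eq[OF err_in_Vh[OF q that]] ..
  ultimately show "G \<in> extensional V \<and> linear_map_on V G \<and>
      (\<forall>\<phi>\<in>V. half_error q \<phi> = G (error q \<phi>))"
    unfolding G_def by auto
next
  fix G' assume G': "G' \<in> extensional V \<and> linear_map_on V G' \<and>
      (\<forall>\<phi>\<in>V. half_error q \<phi> = G' (error q \<phi>))"
  show "G' = G"
  proof (rule extensionalityI[of _ V])
    show "G' \<in> extensional V" "G \<in> extensional V" using G' by (auto simp: G_def)
    fix g assume g: "g \<in> V"
    define \<phi> where "\<phi> = star q - g"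
    have \<phi>: "\<phi> \<in> V" unfolding \<phi>_def by (intro subspace_diff[OF subspace_Vh] phi_star(1) q g)
    have "error q \<phi> = g" by (simp add: err_eq \<phi>_def)
    then show "G' g = G g" using G' \<phi> err_half_eq[OF q \<phi>] G_eq[OF g] by auto
  qed
qed

text \<open>The error after the step is \<open>H\<close> applied to \<open>c\<close> times the error
  before it. Hence the inverse of \<open>H\<close> minus \<open>c\<close>, applied to it, gives
  \<open>c\<close> times the difference of the two errors, and \<open>st / \<epsilon>\<close> turns
  \<open>c\<close> into \<open>sigma_s\<close>.\<close>

lemma a_ex_err_half:
  assumes q: "q \<in> V" and \<phi>: "\<phi> \<in> V" and v: "v \<in> V"
  shows "aex (half_error q \<phi>) v
    = ip (\<lambda>x. sigma_s st sa \<epsilon> * (error q \<phi> x - half_error q \<phi> x)) v"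
proof -
  let ?e = "error q \<phi>" and ?h = "half_error q \<phi>"
  note e = err_in_Vh[OF q \<phi>]
  have hH: "?h = H (c *\<^sub>R ?e)" unfolding err_half_eq[OF q \<phi>] H_scale[OF e] ..
  have ce: "c *\<^sub>R ?e \<in> V" by (rule subspace_scale[OF subspace_Vh e])
  then have hV: "?h \<in> V" unfolding hH by (rule H_in_Vh)
  have d: "?e - ?h \<in> V" by (rule subspace_diff[OF subspace_Vh e hV])
  have "inv_into V H ?h - c *\<^sub>R ?h = c *\<^sub>R (?e - ?h)"
    using inv_H(3)[OF ce] unfolding hH[symmetric] by (simp add: scaleR_diff_right)
  then have "aex ?h v = st / \<epsilon> * (c * ip (?e - ?h) v)"
    unfolding a_ex_eq[OF hV v] by (simp only: ip.scale_left[OF d v])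
  also have "st / \<epsilon> * (c * ip (?e - ?h) v) = sigma_s st sa \<epsilon> * ip (?e - ?h) v"
    using sigma_s_eq eps by (simp add: field_simps)
  also have "\<dots> = ip (\<lambda>x. sigma_s st sa \<epsilon> * (?e - ?h) x) v" by (rule ip_scale_fun[symmetric])
  finally show ?thesis by simp
qed

end

theorem lemma5p2:
  fixes M :: "'d::finite mesh" and Q :: "'d quadrature" and p :: nat
    and st sa \<epsilon> :: real and q :: "real ^ 'd \<Rightarrow> real"
  assumes "CARD('d) = 2 \<or> CARD('d) = 3"
    and "transport_mesh M" and "angular_quadrature Q"
    and "p \<ge> 1" and "st > 0" and "sa > 0"
    and "0 < \<epsilon>" and "\<epsilon> < sqrt (st / sa)"
    and "q \<in> Vh M p"
  shows "(\<forall>g\<in>Vh M p. G_op M Q p st sa \<epsilon> q g = (\<lambda>x. c_eps st sa \<epsilon> * H_op M Q p st \<epsilon> g x))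
    \<and> op_norm_ex M Q p st sa \<epsilon> (G_op M Q p st sa \<epsilon> q)
           = spectral_radius (Vh M p) (G_op M Q p st sa \<epsilon> q)
    \<and> spectral_radius (Vh M p) (G_op M Q p st sa \<epsilon> q)
           = c_eps st sa \<epsilon> * lambda_max (Vh M p) (H_op M Q p st \<epsilon>)
    \<and> c_eps st sa \<epsilon> * lambda_max (Vh M p) (H_op M Q p st \<epsilon>) \<le> c_eps st sa \<epsilon>
    \<and> c_eps st sa \<epsilon> * lambda_max (Vh M p) (H_op M Q p st \<epsilon>) < c_eps st sa \<epsilon>
    \<and> (\<forall>\<phi>\<in>Vh M p. \<forall>v\<in>Vh M p.
           a_ex M Q p st sa \<epsilon> (err_half M Q p st sa \<epsilon> q \<phi>) v
           = l2_inner (Omega M) (\<lambda>x. sigma_s st sa \<epsilon> *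
               (err M Q p st sa \<epsilon> q \<phi> x - err_half M Q p st sa \<epsilon> q \<phi> x)) v)"
proof -
  interpret transport_problem M p Q st sa \<epsilon>
    using assms by unfold_locales auto
  obtain S l where S: "ip.orthonormal S" "S \<noteq> {}" "\<And>e. e \<in> S \<Longrightarrow> H_op M Q p st \<epsilon> e = l e *\<^sub>R e"
    "\<And>v. v \<in> Vh M p \<Longrightarrow> v = (\<Sum>e\<in>S. l2_inner (Omega M) v e *\<^sub>R e)" "\<And>e. e \<in> S \<Longrightarrow> 0 < l e \<and> l e < 1"
    by (rule H_eigenbasis) blast
  interpret transport_eigenbasis M p Q st sa \<epsilon> S l
    by unfold_locales (use S in blast)+
  note q = \<open>q \<in> Vh M p\<close>
  obtain e where e: "e \<in> S" "l e = Max (l ` S)" by (rule max_eigenvalue) blast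
  \<comment> \<open>The maximum is attained at some basis vector, so the strict bound on each
    \<open>l e\<close> survives.\<close>
  have strict: "c_eps st sa \<epsilon> * lambda_max (Vh M p) (H_op M Q p st \<epsilon>) < c_eps st sa \<epsilon>"
    unfolding lambda_max_eq e(2)[symmetric] using l_less_1[OF e(1)] c_bounds by simp
  show ?thesis
    unfolding G_op_eq[OF q]
  proof (intro conjI ballI)
    show "G g = (\<lambda>x. c_eps st sa \<epsilon> * H_op M Q p st \<epsilon> g x)" if "g \<in> Vh M p" for g
      by (simp add: G_eq[OF that] fun_eq_iff)
    show "op_norm_ex M Q p st sa \<epsilon> G = spectral_radius (Vh M p) G"
      by (simp add: op_norm_ex_eq spectral_radius_eq)
    show "spectral_radius (Vh M p) G = c_eps st sa \<epsilon> * lambda_max (Vh M p) (H_op M Q p st \<epsilon>)"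
      by (simp add: spectral_radius_eq lambda_max_eq)
  qed (use strict a_ex_err_half[OF q] in auto)
qed

end
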